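(* Let $m>0$. There exist $\overline{p}\in(0,1)$ and, for every $p\in(0,\overline{p})$, a constant $\Omega_p>m$ such that, if $\Omega>\Omega_p$, there exists an unbounded increasing sequence $(x_k)_{k\in\mathbb{N}}$ of initial data $x_k\geq 0$ such that for every $k\in\mathbb{N}$ the Cauchy problem $$\left\{\begin{array}{l} u'+\dfrac{2u}{r}=v\left(-F(v^2-u^2)-(m-\Omega)\right)\\[1mm] v'=u\left(-F(v^2-u^2)-(m+\Omega)\right)\\[1mm] (u(0),v(0))=(0,x_k)\end{array}\right.$$ has a compactly supported solution $(u,v)$ on $[0,\infty)$ (in the extended sense) which crosses the set $\{(u,0)\,|\,u\neq 0\}$ exactly $k$ times.
   Context: Here $\mathbb{N}=\{0,1,2,\dots\}$, and $F:\mathbb{R}\to\mathbb{R}$ (depending on $p\in(0,1)$) is $F(s)=p|s|^{p-1}$ for $s\neq0$ and $F(0)=0$. The unknown $(u,v)$ is a pair of real functions of $r\geq 0$. Solutions are understood in the extended sense: a continuous function $w$ on an interval is a solution in the extended sense of a system of ordinary differential equations if there are at most finitely many points $R_1<\dots<R_n$ of the interval such that $w$ is of class $\mathcal{C}^1$ and satisfies the equations on the interior of the interval minus $\{R_1,\dots,R_n\}$. In particular a solution which reaches $(0,0)$ may be extended by zero. *)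

theory Defs
  imports "HOL-Analysis.Analysis"
begin

definition F :: "real \<Rightarrow> real \<Rightarrow> real" where
  "F p s = (if s = 0 then 0 else p * \<bar>s\<bar> powr (p - 1))"

text \<open>
  A system of ordinary differential equations is given as a relation between the variable
  \<open>r\<close>, the value \<open>w r\<close> and the derivative of \<open>w\<close> at \<open>r\<close>. The exceptional set \<open>S\<close> is the
  set \<open>{R\<^sub>1, \<dots>, R\<^sub>n}\<close>, possibly empty.
\<close>

definition extended_solution ::
  "real set \<Rightarrow> (real \<Rightarrow> 'a \<Rightarrow> 'a \<Rightarrow> bool) \<Rightarrow> (real \<Rightarrow> 'a::real_normed_vector) \<Rightarrow> bool" where
  "extended_solution I E w \<longleftrightarrow>
     continuous_on I w \<and>
     (\<exists>S. finite S \<and> S \<subseteq> I \<and>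
          w C1_differentiable_on (interior I - S) \<and>
          (\<forall>r \<in> interior I - S. E r (w r) (vector_derivative w (at r))))"

definition dirac_system ::
  "real \<Rightarrow> real \<Rightarrow> real \<Rightarrow> real \<Rightarrow> real \<times> real \<Rightarrow> real \<times> real \<Rightarrow> bool" where
  "dirac_system p m \<Omega> = (\<lambda>r (u, v) (u', v').
     u' + 2 * u / r = v * (- F p (v\<^sup>2 - u\<^sup>2) - (m - \<Omega>)) \<and>
     v' = u * (- F p (v\<^sup>2 - u\<^sup>2) - (m + \<Omega>)))"

definition compactly_supported_on :: "real set \<Rightarrow> (real \<Rightarrow> 'a::zero) \<Rightarrow> bool" where
  "compactly_supported_on I w \<longleftrightarrow> compact (closure {r \<in> I. w r \<noteq> 0})"

text \<open>
  Crossings of \<open>A\<close> are counted as the parameters at which the trajectory lies in \<open>A\<close>. For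
  solutions of the system above with \<open>m + \<Omega> > 0\<close> and \<open>A = {(u, 0) | u \<noteq> 0}\<close>, the right-hand
  side is continuous near \<open>A\<close> and there \<open>v'\<close> is nonzero with sign opposite to \<open>u\<close>, so every
  such meeting is transversal and tangential contacts cannot occur.
\<close>

definition crosses_exactly :: "real set \<Rightarrow> (real \<Rightarrow> 'a) \<Rightarrow> 'a set \<Rightarrow> nat \<Rightarrow> bool" where
  "crosses_exactly I w A k \<longleftrightarrow> finite {r \<in> I. w r \<in> A} \<and> card {r \<in> I. w r \<in> A} = k"

end

theory Submission
  imports Defs
begin

text \<open>
  Write \<open>u = \<surd>P sin \<theta>\<close>, \<open>v = \<surd>P cos \<theta>\<close>. The nonlinearity is singular exactly on the diagonals
  \<open>cos (2 \<theta>) = 0\<close>, so if \<open>\<theta>\<close> is taken as independent variable, the singularity sits at fixed times and is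
  integrable there, while the dependence on the unknowns \<open>(r, P)\<close> is smooth: Picard iteration and Gronwall's
  inequality apply. For small \<open>p\<close> and large \<open>\<Omega>\<close> one has \<open>\<theta>' > 0\<close> as long as the energy
  \<open>\<Omega> (u\<^sup>2 + v\<^sup>2) - m (v\<^sup>2 - u\<^sup>2) - \<bar>v\<^sup>2 - u\<^sup>2\<bar> powr p sgn (v\<^sup>2 - u\<^sup>2)\<close> is positive, and this energy is nonincreasing in \<open>r\<close>.
  Each half turn dissipates at least \<open>c / r\<close>, so the energy reaches \<open>0\<close> at a finite angle \<open>\<Theta>(x)\<close>, and
  \<open>\<Theta>(x)\<close> tends to infinity with the initial value \<open>x\<close>. The solution reaches the origin, after exactly \<open>k\<close> crossings of \<open>v = 0\<close>,
  iff \<open>\<Theta>(x) = k \<pi> + \<pi>/4\<close>. Both \<open>\<Theta>(x) > k \<pi> + \<pi>/4\<close> and, by dissipation, \<open>\<Theta>(x) < k \<pi> + \<pi>/4\<close> are open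
  conditions, so equality holds at the supremum of the \<open>x\<close> satisfying the latter.
\<close>

subsection \<open>Ordinary differential equations with finitely many singular times\<close>

text \<open>Why the origin is reached exactly at the angles pi/4 + k pi: a solution followed in the
  angle can stop in two ways only. Either its energy runs out while the amplitude is still positive,
  and it is abandoned there; or the amplitude tends to 0, that is, \<open>l\<close> tends to
  infinity. The second is impossible at other angles: modulo pi, before pi/4 positive energy bounds
  the amplitude from below; from pi/4 to pi/2 the angular speed grows along with the singular term
  and compensates it; from pi/2 to pi the singular term increases the amplitude. The first is
  impossible at the angles pi/4 + k pi, where the singular part of the energy vanishes and
  \<open>bb\<close> equals \<open>\<Omega>\<close>. So stopping there means reaching the origin. The
  angle is no good time variable at r = 0 because of the term sin (2 \<theta>) / r. The interval
  from 0 to \<open>r0\<close> is therefore handled by a separate fixed point in r, with v(0) scaled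
  to 1, whose end point supplies the initial data of the angular problem. Only continuity of these
  data in x is passed on to the shooting argument, together with their values at its two
  ends.\<close>

lemma nonincreasing_finite_exceptions:
  fixes f :: "real \<Rightarrow> real"
  assumes "finite Z" "a \<le> b" "continuous_on {a..b} f"
    and "\<And>x. x \<in> {a<..<b} - Z \<Longrightarrow> \<exists>d\<le>0. (f has_real_derivative d) (at x)"
  shows "f b \<le> f a"
  using assms
proof (induction arbitrary: a b)
  case empty
  have "\<exists>d. (f has_real_derivative d) (at x) \<and> d \<le> 0" if "a < x" "x < b" for x
    using empty.prems(3)[of x] that by auto
  then show ?case
    by (rule DERIV_nonpos_imp_decreasing_open[OF empty.prems(1) _ empty.prems(2)])
next
  \<comment> \<open>An exceptional point inside the interval splits it in two; continuity alone
    joins the halves.\<close>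
  case (insert z Z)
  show ?case
  proof (cases "z \<in> {a<..<b}")
    case True
    have "f z \<le> f a"
    proof (rule insert.IH)
      show "continuous_on {a..z} f"
        using insert.prems(2) by (rule continuous_on_subset) (use True in auto)
    qed (use True insert.prems in auto)
    moreover have "f b \<le> f z"
    proof (rule insert.IH)
      show "continuous_on {z..b} f"
        using insert.prems(2) by (rule continuous_on_subset) (use True in auto)
    qed (use True insert.prems in auto)
    ultimately show ?thesis by linarith
  next
    case False
    then have "{a<..<b} - insert z Z = {a<..<b} - Z" by auto
    with insert.prems show ?thesis by (intro insert.IH) simp_all
  qed
qed

text \<open>A function that strictly decreases through each of its zeros cannot become positive: the
  last point before \<open>t\<close> where \<open>f\<close> is nonpositive would be a zero with
  positive values immediately to its right.\<close>

lemma barrier_nonpos: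
  fixes f :: "real \<Rightarrow> real"
  assumes cont: "continuous_on {a..b} f" and "f a < 0"
    and zero: "\<And>x. x \<in> {a<..<b} \<Longrightarrow> f x = 0 \<Longrightarrow> \<exists>d<0. (f has_real_derivative d) (at x)"
    and t: "t \<in> {a..b}"
  shows "f t \<le> 0"
proof (rule ccontr)
  assume "\<not> f t \<le> 0"
  then have ft: "f t > 0" by simp
  define A where "A = {x \<in> {a..t}. f x \<le> 0}"
  have ct: "continuous_on {a..t} f"
    using cont by (rule continuous_on_subset) (use t in auto)
  have "closed A"
    unfolding A_def by (intro continuous_on_closed_Collect_le ct) auto
  have Ane: "A \<noteq> {}" "bdd_above A"
    using assms(2) t unfolding A_def by (auto intro!: bdd_aboveI[of _ t])
  define s where "s = Sup A"
  have sA: "s \<in> A"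
    unfolding s_def using Ane \<open>closed A\<close> by (rule closed_contains_Sup)
  then have s: "a \<le> s" "s \<le> t" "f s \<le> 0" by (auto simp: A_def)
  have st: "s < t" using s ft by (cases "s = t") auto
  have above: "f x > 0" if "x \<in> {s<..t}" for x
  proof (rule ccontr)
    assume "\<not> f x > 0"
    then have "x \<in> A" using that s by (auto simp: A_def)
    then have "x \<le> s" unfolding s_def using Ane by (intro cSup_upper)
    with that show False by auto
  qed
  have "f s = 0"
  proof (rule ccontr)
    assume "f s \<noteq> 0"
    then have "f s < 0" using s by simp
    have "\<exists>x\<ge>s. x \<le> t \<and> f x = 0"
    proof (rule IVT')
      show "continuous_on {s..t} f"
        using ct by (rule continuous_on_subset) (use s in auto)
    qed (use s ft in auto)
    then obtain x where "s \<le> x" "x \<le> t" "f x = 0" by auto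
    moreover have "x \<noteq> s" using \<open>f s < 0\<close> \<open>f x = 0\<close> by auto
    ultimately show False using above[of x] by auto
  qed
  then have "s \<noteq> a" using assms(2) by auto
  then obtain d where d: "d < 0" "(f has_real_derivative d) (at s)"
    using zero[of s] s st t \<open>f s = 0\<close> by auto
  obtain h where h: "h > 0" "\<And>k. k > 0 \<Longrightarrow> k < h \<Longrightarrow> f s > f (s + k)"
    using DERIV_neg_dec_right[OF d(2,1)] by auto
  define k where "k = min (h / 2) (t - s)"
  have "k > 0" "k < h" "s + k \<in> {s<..t}" using h st by (auto simp: k_def min_def)
  then show False using above h(2)[of k] \<open>f s = 0\<close> by fastforce
qed

lemma continuous_on_Icc_upper_bound:
  fixes f :: "real \<Rightarrow> real"
  assumes "continuous_on {a..b} f"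
  obtains B where "\<And>s. s \<in> {a..b} \<Longrightarrow> f s \<le> B"
proof -
  have "bdd_above (f ` {a..b})"
    using assms by (intro bounded_imp_bdd_above compact_imp_bounded compact_continuous_image) auto
  then show thesis using that unfolding bdd_above_def by blast
qed

text \<open>The hypothesis on \<open>\<Psi>\<close> is the contraction property in the weighted supremum norm with weight \<open>exp (- 2 K)\<close>.\<close>

lemma volterra_fixpoint:
  fixes \<Psi> :: "(real \<Rightarrow> 'a::banach) \<Rightarrow> real \<Rightarrow> 'a" and K :: "real \<Rightarrow> real"
  assumes K: "continuous_on {a..b} K"
    and cont: "\<And>y. continuous_on {a..b} y \<Longrightarrow> continuous_on {a..b} (\<Psi> y)"
    and contr: "\<And>y z C. continuous_on {a..b} y \<Longrightarrow> continuous_on {a..b} z \<Longrightarrow>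
        (\<And>s. s \<in> {a..b} \<Longrightarrow> norm (y s - z s) \<le> C * exp (2 * K s)) \<Longrightarrow>
        (\<And>t. t \<in> {a..b} \<Longrightarrow> norm (\<Psi> y t - \<Psi> z t) \<le> C / 2 * exp (2 * K t))"
  obtains y where "continuous_on {a..b} y" "\<And>t. t \<in> {a..b} \<Longrightarrow> \<Psi> y t = y t"
proof -
  define Y where "Y n = (\<Psi> ^^ n) (\<lambda>_. 0)" for n
  have Y_Suc: "Y (Suc n) = \<Psi> (Y n)" for n by (simp add: Y_def)
  have cY: "continuous_on {a..b} (Y n)" for n
    by (induction n) (simp_all add: Y_def cont)
  have cE: "continuous_on {a..b} (\<lambda>s. exp (2 * K s))"
    by (intro continuous_intros K)
  obtain E where E: "\<And>s. s \<in> {a..b} \<Longrightarrow> exp (2 * K s) \<le> E"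
    using continuous_on_Icc_upper_bound[OF cE] by blast
  have "continuous_on {a..b} (\<lambda>s. norm (Y 1 s) * exp (- 2 * K s))"
    by (intro continuous_intros K cY)
  then obtain C where C: "\<And>s. s \<in> {a..b} \<Longrightarrow> norm (Y 1 s) * exp (- 2 * K s) \<le> C"
    using continuous_on_Icc_upper_bound by blast
  have step: "norm (Y (Suc n) s - Y n s) \<le> C / 2 ^ n * exp (2 * K s)" if "s \<in> {a..b}" for n s
    using that
  proof (induction n arbitrary: s)
    case 0
    have "norm (Y 1 s) = norm (Y 1 s) * exp (- 2 * K s) * exp (2 * K s)"
      by (simp add: mult.assoc flip: exp_add)
    also have "\<dots> \<le> C * exp (2 * K s)"
      by (intro mult_right_mono C[OF 0]) auto
    finally show ?case by (simp add: Y_def)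
  next
    case (Suc n)
    have "norm (\<Psi> (Y (Suc n)) s - \<Psi> (Y n) s) \<le> (C / 2 ^ n) / 2 * exp (2 * K s)"
      by (rule contr[OF cY cY Suc.IH Suc.prems])
    then show ?case by (simp add: Y_Suc mult.commute)
  qed
  \<comment> \<open>The increments decay like 2 to the power -n in the weighted norm, so this
    telescoping series converges uniformly and its sum is continuous.\<close>
  define y where "y s = (\<Sum>n. Y (Suc n) s - Y n s)" for s
  have lim: "uniform_limit {a..b} (\<lambda>n s. \<Sum>i<n. Y (Suc i) s - Y i s) y sequentially"
    unfolding y_def
  proof (rule Weierstrass_m_test[where M = "\<lambda>n. \<bar>C\<bar> * E * (1/2) ^ n"])
    show "summable (\<lambda>n. \<bar>C\<bar> * E * (1/2) ^ n)"
      by (intro summable_mult summable_geometric) auto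
    fix n s assume s: "s \<in> {a..b}"
    have "C / 2 ^ n * exp (2 * K s) \<le> \<bar>C\<bar> / 2 ^ n * E"
      by (intro mult_mono divide_right_mono E[OF s]) auto
    then show "norm (Y (Suc n) s - Y n s) \<le> \<bar>C\<bar> * E * (1/2) ^ n"
      using step[OF s, of n] by (simp add: field_simps)
  qed
  moreover have tel: "(\<Sum>i<n. Y (Suc i) s - Y i s) = Y n s" for n s
    using sum_lessThan_telescope[of "\<lambda>i. Y i s" n] by (simp add: Y_def)
  ultimately have limY: "uniform_limit {a..b} Y y sequentially"
    by simp
  have cy: "continuous_on {a..b} y"
    by (rule uniform_limit_theorem[OF _ limY]) (auto simp: cY)
  have "\<Psi> y t = y t" if t: "t \<in> {a..b}" for t
  proof -
    have ptw: "(\<lambda>n. Y n t) \<longlonglongrightarrow> y t"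
      using tendsto_uniform_limitI[OF limY t] .
    have "(\<lambda>n. Y (Suc n) t) \<longlonglongrightarrow> \<Psi> y t"
    proof (rule metric_LIMSEQ_I)
      fix e :: real assume "e > 0"
      have "continuous_on {a..b} (\<lambda>s. exp (- 2 * K s))"
        by (intro continuous_intros K)
      then obtain E' where E': "\<And>s. s \<in> {a..b} \<Longrightarrow> exp (- 2 * K s) \<le> E'"
        using continuous_on_Icc_upper_bound by blast
      have E'0: "E' > 0" using E'[OF t] exp_gt_zero less_le_trans by blast
      \<comment> \<open>Uniform closeness of the iterates becomes closeness in the weighted norm at
        the cost of the factor \<open>E'\<close>; the contraction property then leaves
        \<open>e / 2\<close> at the point \<open>t\<close>.\<close>
      define \<epsilon> where "\<epsilon> = e / (E' * exp (2 * K t))"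
      have "\<epsilon> > 0" using \<open>e > 0\<close> E'0 by (simp add: \<epsilon>_def)
      then obtain N where N: "\<And>n s. n \<ge> N \<Longrightarrow> s \<in> {a..b} \<Longrightarrow> dist (Y n s) (y s) < \<epsilon>"
        using limY unfolding uniform_limit_sequentially_iff by metis
      have "dist (Y (Suc n) t) (\<Psi> y t) < e" if "n \<ge> N" for n
      proof -
        have "norm (Y n s - y s) \<le> (\<epsilon> * E') * exp (2 * K s)" if s: "s \<in> {a..b}" for s
        proof -
          have "norm (Y n s - y s) \<le> \<epsilon> * (exp (- 2 * K s) * exp (2 * K s))"
            using N[OF \<open>n \<ge> N\<close> s] by (simp add: dist_norm flip: exp_add)
          also have "\<dots> \<le> \<epsilon> * (E' * exp (2 * K s))"
            using E'[OF s] \<open>\<epsilon> > 0\<close> by (intro mult_left_mono mult_right_mono) auto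
          finally show ?thesis by simp
        qed
        then have "norm (\<Psi> (Y n) t - \<Psi> y t) \<le> (\<epsilon> * E') / 2 * exp (2 * K t)"
          by (rule contr[OF cY cy _ t])
        also have "\<dots> = e / 2" using E'0 by (simp add: \<epsilon>_def field_simps)
        finally show ?thesis using \<open>e > 0\<close> by (simp add: Y_Suc dist_norm)
      qed
      then show "\<exists>N. \<forall>n\<ge>N. dist (Y (Suc n) t) (\<Psi> y t) < e" by blast
    qed
    moreover have "(\<lambda>n. Y (Suc n) t) \<longlonglongrightarrow> y t"
      using ptw by (rule LIMSEQ_Suc)
    ultimately show ?thesis by (rule LIMSEQ_unique)
  qed
  with cy show thesis by (rule that)
qed

text \<open>Near an exceptional point \<open>f\<close> may be unbounded, but \<open>k\<close>
  dominates it, and \<open>k\<close> is integrable because it has the continuous antiderivative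
  \<open>K\<close>. Continuity off \<open>Z\<close> supplies measurability.\<close>

lemma integrable_finite_exceptions:
  fixes f :: "real \<Rightarrow> 'a::euclidean_space"
  assumes "finite Z" and cont: "continuous_on ({a<..<b} - Z) f"
    and K: "continuous_on {a..b} K"
    and K': "\<And>s. s \<in> {a<..<b} - Z \<Longrightarrow> (K has_real_derivative k s) (at s)"
    and bnd: "\<And>s. s \<in> {a<..<b} - Z \<Longrightarrow> norm (f s) \<le> k s"
  shows "f integrable_on {a..b}"
proof (cases "a \<le> b")
  case True
  have "(k has_integral (K b - K a)) {a..b}"
    using fundamental_theorem_of_calculus_interior_strong[OF \<open>finite Z\<close> True _ K, of k] K'
    by (auto simp: has_real_derivative_iff_has_vector_derivative)
  then have "k integrable_on {a..b}" by blast
  have N: "negligible (insert a (insert b Z))"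
    using \<open>finite Z\<close> by (simp add: negligible_finite)
  from \<open>k integrable_on {a..b}\<close> have ki: "k integrable_on ({a<..<b} - Z)"
    by (rule integrable_spike_set) (rule negligible_subset[OF N]; force)+
  have meas: "({a<..<b} - Z) \<in> sets lebesgue"
    using \<open>finite Z\<close> by (intro sets.Diff) (auto simp: finite_imp_closed borel_closed)
  have "f integrable_on ({a<..<b} - Z)"
    using continuous_imp_measurable_on_sets_lebesgue[OF cont meas] ki bnd meas
    by (rule measurable_bounded_by_integrable_imp_integrable)
  then show ?thesis
    by (rule integrable_spike_set) (rule negligible_subset[OF N]; force)+
qed auto

text \<open>One function \<open>k\<close> both bounds \<open>f\<close> and is its Lipschitz
  constant. Its antiderivative \<open>K\<close> is the weight under which the Picard map contracts
  on the whole interval at once, however large the integral of \<open>k\<close> is.\<close>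

lemma caratheodory_solution:
  fixes f :: "real \<Rightarrow> 'a::euclidean_space \<Rightarrow> 'a"
  assumes Z: "finite Z"
    and K: "continuous_on {a..b} K"
    and K': "\<And>s. s \<in> {a<..<b} - Z \<Longrightarrow> (K has_real_derivative k s) (at s)"
    and cont: "continuous_on (({a<..<b} - Z) \<times> UNIV) (\<lambda>(s, y). f s y)"
    and bnd: "\<And>s y. s \<in> {a<..<b} - Z \<Longrightarrow> norm (f s y) \<le> k s"
    and lip: "\<And>s y z. s \<in> {a<..<b} - Z \<Longrightarrow> norm (f s y - f s z) \<le> k s * norm (y - z)"
    and ab: "a \<le> b"
  obtains y where "continuous_on {a..b} y" "y a = y0"
    "\<And>s. s \<in> {a<..<b} - Z \<Longrightarrow> (y has_vector_derivative f s (y s)) (at s)"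
proof -
  have k0: "k s \<ge> 0" if "s \<in> {a<..<b} - Z" for s
    using bnd[OF that, of 0] norm_ge_zero[of "f s 0"] by linarith
  have cfy: "continuous_on ({a<..<b} - Z) (\<lambda>s. f s (y s))" if "continuous_on {a..b} y" for y
  proof -
    have "continuous_on ({a<..<b} - Z) (\<lambda>s. (s, y s))"
      by (intro continuous_intros continuous_on_subset[OF that]) auto
    from continuous_on_compose2[OF cont this] show ?thesis by auto
  qed
  have int: "(\<lambda>s. f s (y s)) integrable_on {a..b}" if "continuous_on {a..b} y" for y
    by (rule integrable_finite_exceptions[OF Z cfy[OF that] K K']) (auto intro: bnd)
  obtain y where cy: "continuous_on {a..b} y"
    and fix_y: "\<And>t. t \<in> {a..b} \<Longrightarrow> y0 + integral {a..t} (\<lambda>s. f s (y s)) = y t"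
  proof (rule volterra_fixpoint[of a b K "\<lambda>y t. y0 + integral {a..t} (\<lambda>s. f s (y s))"])
    show "continuous_on {a..b} K" by fact
    show "continuous_on {a..b} (\<lambda>t. y0 + integral {a..t} (\<lambda>s. f s (y s)))"
      if "continuous_on {a..b} y" for y
      by (intro continuous_intros indefinite_integral_continuous_1 int that)
    fix y z :: "real \<Rightarrow> 'a" and C t
    assume y: "continuous_on {a..b} y" and z: "continuous_on {a..b} z"
      and C: "\<And>s. s \<in> {a..b} \<Longrightarrow> norm (y s - z s) \<le> C * exp (2 * K s)" and t: "t \<in> {a..b}"
    have sub: "{a..t} \<subseteq> {a..b}" using t by auto
    have iy: "(\<lambda>s. f s (y s)) integrable_on {a..t}" and iz: "(\<lambda>s. f s (z s)) integrable_on {a..t}"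
      using int[OF y] int[OF z] sub integrable_on_subinterval by blast+
    \<comment> \<open>The contraction factor 1/2 originates here: \<open>C * k * exp (2 * K)\<close>
      is the derivative of \<open>C / 2 * exp (2 * K)\<close>.\<close>
    have *: "((\<lambda>s. C * k s * exp (2 * K s)) has_integral (C/2 * exp (2 * K t) - C/2 * exp (2 * K a))) {a..t}"
    proof (rule fundamental_theorem_of_calculus_interior_strong[OF Z])
      show "continuous_on {a..t} (\<lambda>t. C/2 * exp (2 * K t))"
        by (intro continuous_intros continuous_on_subset[OF K]) (use t in auto)
      fix s assume "s \<in> {a<..<t} - Z"
      then have "(K has_real_derivative k s) (at s)" using K' t by auto
      then show "((\<lambda>t. C/2 * exp (2 * K t)) has_vector_derivative C * k s * exp (2 * K s)) (at s)"
        unfolding has_real_derivative_iff_has_vector_derivative[symmetric]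
        by (auto intro!: derivative_eq_intros)
    qed (use t in auto)
    \<comment> \<open>The Lipschitz bound says nothing at the exceptional times. There the majorant
      is the integrand itself, so that the pointwise comparison holds everywhere, and it is replaced
      afterwards on this finite set.\<close>
    have "norm (integral {a..t} (\<lambda>s. f s (y s) - f s (z s)))
        \<le> integral {a..t} (\<lambda>s. if s \<in> {a<..<t} - Z then C * k s * exp (2 * K s) else norm (f s (y s) - f s (z s)))"
    proof (rule integral_norm_bound_integral)
      show "(\<lambda>s. f s (y s) - f s (z s)) integrable_on {a..t}" using iy iz by (rule integrable_diff)
      show "(\<lambda>s. if s \<in> {a<..<t} - Z then C * k s * exp (2 * K s) else norm (f s (y s) - f s (z s))) integrable_on {a..t}"
      proof (rule integrable_spike_finite[OF _ _ has_integral_integrable[OF *]])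
        show "finite (insert a (insert t Z))" using Z by simp
        fix s assume "s \<in> {a..t} - insert a (insert t Z)"
        then have "s \<in> {a<..<t} - Z" by auto
        then show "(if s \<in> {a<..<t} - Z then C * k s * exp (2 * K s) else norm (f s (y s) - f s (z s)))
            = C * k s * exp (2 * K s)" by (rule if_P)
      qed
      fix s assume s: "s \<in> {a..t}"
      show "norm (f s (y s) - f s (z s)) \<le>
          (if s \<in> {a<..<t} - Z then C * k s * exp (2 * K s) else norm (f s (y s) - f s (z s)))"
      proof (cases "s \<in> {a<..<t} - Z")
        case True
        then have s': "s \<in> {a<..<b} - Z" using t by auto
        have "norm (f s (y s) - f s (z s)) \<le> k s * norm (y s - z s)" by (rule lip[OF s'])
        also have "\<dots> \<le> k s * (C * exp (2 * K s))"
          using s' by (intro mult_left_mono C k0) auto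
        finally show ?thesis using True by (simp add: mult_ac)
      qed auto
    qed
    also have "\<dots> = integral {a..t} (\<lambda>s. C * k s * exp (2 * K s))"
    proof (rule integral_spike[OF negligible_finite])
      show "finite (insert a (insert t Z))" using Z by simp
      fix s assume "s \<in> {a..t} - insert a (insert t Z)"
      then have "s \<in> {a<..<t} - Z" by auto
      then show "C * k s * exp (2 * K s) = (if s \<in> {a<..<t} - Z then C * k s * exp (2 * K s) else norm (f s (y s) - f s (z s)))"
        by simp
    qed
    also have "\<dots> = C/2 * exp (2 * K t) - C/2 * exp (2 * K a)"
      using * by (rule integral_unique)
    also have "\<dots> \<le> C/2 * exp (2 * K t)"
    proof -
      have "norm (y a - z a) \<le> C * exp (2 * K a)" using ab by (intro C) simp
      then have "0 \<le> C * exp (2 * K a)" by (rule order_trans[OF norm_ge_zero])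
      then show ?thesis by simp
    qed
    finally show "norm (y0 + integral {a..t} (\<lambda>s. f s (y s)) - (y0 + integral {a..t} (\<lambda>s. f s (z s))))
        \<le> C / 2 * exp (2 * K t)"
      using iy iz by (simp add: integral_diff)
  qed blast
  have der: "(y has_vector_derivative f s (y s)) (at s)" if s: "s \<in> {a<..<b} - Z" for s
  proof -
    define S where "S = {a<..<b} - Z"
    have "open S" using Z unfolding S_def by (intro open_Diff finite_imp_closed) auto
    have "((\<lambda>u. integral {a..u} (\<lambda>s. f s (y s))) has_vector_derivative f s (y s)) (at s within ({a..b} - (insert a (insert b Z))))"
    proof (rule integral_has_vector_derivative_continuous_at[OF int[OF cy]])
      have "continuous (at s) (\<lambda>s. f s (y s))"
        using cfy[OF cy] s \<open>open S\<close> unfolding S_def by (simp add: continuous_on_eq_continuous_at)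
      then show "continuous (at s within ({a..b} - (insert a (insert b Z)))) (\<lambda>s. f s (y s))"
        by (rule continuous_at_imp_continuous_within)
    qed (use s Z in auto)
    moreover have "{a..b} - (insert a (insert b Z)) = S" unfolding S_def by auto
    moreover have "at s within S = at s"
      using s \<open>open S\<close> unfolding S_def by (intro at_within_open) auto
    ultimately have "((\<lambda>u. integral {a..u} (\<lambda>s. f s (y s))) has_vector_derivative f s (y s)) (at s)"
      by simp
    then have "((\<lambda>u. y0 + integral {a..u} (\<lambda>s. f s (y s))) has_vector_derivative f s (y s)) (at s)"
      by (auto intro!: derivative_eq_intros)
    then show ?thesis
      by (rule has_vector_derivative_transform_within_open[OF _ \<open>open S\<close>])
        (use s in \<open>auto simp: S_def fix_y\<close>)
  qed
  have "y a = y0" using fix_y[of a] ab by simp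
  with cy der show thesis by (intro that)
qed

text \<open>Only the component of the difference of the right-hand sides along
  \<open>y s - z s\<close> is restricted. A term that pulls solutions together may thus be
  arbitrarily large, as the friction 2 U / r is near r = 0. The proof shows that the squared
  distance times \<open>exp (- 2 * K t)\<close> does not increase.\<close>

lemma gronwall_diff:
  fixes y z :: "real \<Rightarrow> 'a::real_inner"
  assumes Z: "finite Z" and ab: "a \<le> b"
    and K: "continuous_on {a..b} K"
    and K': "\<And>s. s \<in> {a<..<b} - Z \<Longrightarrow> (K has_real_derivative k s) (at s)"
    and cy: "continuous_on {a..b} y" and cz: "continuous_on {a..b} z"
    and y': "\<And>s. s \<in> {a<..<b} - Z \<Longrightarrow> (y has_vector_derivative y' s) (at s)"
    and z': "\<And>s. s \<in> {a<..<b} - Z \<Longrightarrow> (z has_vector_derivative z' s) (at s)"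
    and le: "\<And>s. s \<in> {a<..<b} - Z \<Longrightarrow> (y s - z s) \<bullet> (y' s - z' s) \<le> k s * (norm (y s - z s))\<^sup>2"
  shows "norm (y b - z b) \<le> norm (y a - z a) * exp (K b - K a)"
proof -
  define \<phi> where "\<phi> t = (norm (y t - z t))\<^sup>2 * exp (- 2 * K t)" for t
  have "\<phi> b \<le> \<phi> a"
  proof (rule nonincreasing_finite_exceptions[OF Z ab])
    show "continuous_on {a..b} \<phi>"
      unfolding \<phi>_def by (intro continuous_intros cy cz K)
    fix s assume s: "s \<in> {a<..<b} - Z"
    have "((\<lambda>t. (y t - z t) \<bullet> (y t - z t)) has_real_derivative 2 * ((y s - z s) \<bullet> (y' s - z' s))) (at s)"
      unfolding has_real_derivative_iff_has_vector_derivative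
      using bounded_bilinear.has_vector_derivative[OF bounded_bilinear_inner
          has_vector_derivative_diff[OF y'[OF s] z'[OF s]] has_vector_derivative_diff[OF y'[OF s] z'[OF s]]]
      by (simp add: inner_commute)
    then have "((\<lambda>t. (y t - z t) \<bullet> (y t - z t) * exp (- 2 * K t)) has_real_derivative
        2 * ((y s - z s) \<bullet> (y' s - z' s)) * exp (- 2 * K s) + (y s - z s) \<bullet> (y s - z s) * (- 2 * k s * exp (- 2 * K s))) (at s)"
      by (auto intro!: derivative_eq_intros K'[OF s])
    moreover have "2 * ((y s - z s) \<bullet> (y' s - z' s)) * exp (- 2 * K s) + (y s - z s) \<bullet> (y s - z s) * (- 2 * k s * exp (- 2 * K s))
      = 2 * exp (- 2 * K s) * ((y s - z s) \<bullet> (y' s - z' s) - k s * (norm (y s - z s))\<^sup>2)"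
      by (simp add: power2_norm_eq_inner algebra_simps)
    moreover have "\<dots> \<le> 0"
      using le[OF s] by (intro mult_nonneg_nonpos) auto
    moreover have "\<phi> = (\<lambda>t. (y t - z t) \<bullet> (y t - z t) * exp (- 2 * K t))"
      by (simp add: fun_eq_iff \<phi>_def power2_norm_eq_inner)
    ultimately show "\<exists>d\<le>0. (\<phi> has_real_derivative d) (at s)" by metis
  qed
  then have "(norm (y b - z b))\<^sup>2 \<le> (norm (y a - z a))\<^sup>2 * (exp (- 2 * K a) * exp (2 * K b))"
    unfolding \<phi>_def by (simp add: exp_minus field_simps)
  also have "exp (- 2 * K a) * exp (2 * K b) = (exp (K b - K a))\<^sup>2"
    by (simp add: power2_eq_square flip: exp_add)
  finally have "(norm (y b - z b))\<^sup>2 \<le> (norm (y a - z a) * exp (K b - K a))\<^sup>2"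
    by (simp add: power_mult_distrib)
  then show ?thesis
    by (rule power2_le_imp_le) simp
qed

lemma gronwall_lipschitz:
  fixes y z :: "real \<Rightarrow> 'a::real_inner"
  assumes Z: "finite Z" and ab: "a \<le> b"
    and K: "continuous_on {a..b} K"
    and K': "\<And>s. s \<in> {a<..<b} - Z \<Longrightarrow> (K has_real_derivative k s) (at s)"
    and cy: "continuous_on {a..b} y" and cz: "continuous_on {a..b} z"
    and y': "\<And>s. s \<in> {a<..<b} - Z \<Longrightarrow> (y has_vector_derivative f s (y s)) (at s)"
    and z': "\<And>s. s \<in> {a<..<b} - Z \<Longrightarrow> (z has_vector_derivative f s (z s)) (at s)"
    and lip: "\<And>s y z. s \<in> {a<..<b} - Z \<Longrightarrow> norm (f s y - f s z) \<le> k s * norm (y - z)"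
  shows "norm (y b - z b) \<le> norm (y a - z a) * exp (K b - K a)"
proof (rule gronwall_diff[OF Z ab K K' cy cz y' z'])
  fix s assume s: "s \<in> {a<..<b} - Z"
  have "(y s - z s) \<bullet> (f s (y s) - f s (z s)) \<le> norm (y s - z s) * norm (f s (y s) - f s (z s))"
    by (rule norm_cauchy_schwarz)
  also have "\<dots> \<le> norm (y s - z s) * (k s * norm (y s - z s))"
    by (intro mult_left_mono lip[OF s]) auto
  finally show "(y s - z s) \<bullet> (f s (y s) - f s (z s)) \<le> k s * (norm (y s - z s))\<^sup>2"
    by (simp add: power2_eq_square mult_ac)
qed

text \<open>Projecting on the total increment \<open>y b - y a\<close> turns the vector estimate
  into the monotonicity of a scalar function.\<close>

lemma variation_bound:
  fixes y :: "real \<Rightarrow> 'a::real_inner"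
  assumes Z: "finite Z" and ab: "a \<le> b"
    and K: "continuous_on {a..b} K"
    and K': "\<And>s. s \<in> {a<..<b} - Z \<Longrightarrow> (K has_real_derivative k s) (at s)"
    and cy: "continuous_on {a..b} y"
    and y': "\<And>s. s \<in> {a<..<b} - Z \<Longrightarrow> (y has_vector_derivative y' s) (at s)"
    and bnd: "\<And>s. s \<in> {a<..<b} - Z \<Longrightarrow> norm (y' s) \<le> k s"
  shows "norm (y b - y a) \<le> K b - K a"
proof -
  define w where "w = y b - y a"
  define \<phi> where "\<phi> t = w \<bullet> y t - norm w * K t" for t
  have "\<phi> b \<le> \<phi> a"
  proof (rule nonincreasing_finite_exceptions[OF Z ab])
    show "continuous_on {a..b} \<phi>"
      unfolding \<phi>_def by (intro continuous_intros cy K)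
    fix s assume s: "s \<in> {a<..<b} - Z"
    have "((\<lambda>t. w \<bullet> y t) has_real_derivative w \<bullet> y' s) (at s)"
      unfolding has_real_derivative_iff_has_vector_derivative
      by (rule bounded_linear.has_vector_derivative[OF bounded_linear_inner_right y'[OF s]])
    then have "(\<phi> has_real_derivative w \<bullet> y' s - norm w * k s) (at s)"
      unfolding \<phi>_def by (auto intro!: derivative_eq_intros K'[OF s])
    moreover have "w \<bullet> y' s \<le> norm w * k s"
      by (rule order_trans[OF norm_cauchy_schwarz]) (intro mult_left_mono bnd[OF s] norm_ge_zero)
    ultimately show "\<exists>d\<le>0. (\<phi> has_real_derivative d) (at s)" by (metis diff_le_0_iff_le)
  qed
  then have "w \<bullet> w \<le> norm w * (K b - K a)"
    unfolding \<phi>_def w_def by (simp add: algebra_simps inner_diff_right)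
  then have "norm w * norm w \<le> norm w * (K b - K a)"
    by (simp add: norm_eq_sqrt_inner)
  \<comment> \<open>This settles the case of a zero increment, in which the factor
    \<open>norm w\<close> cannot be cancelled.\<close>
  moreover have "K a \<le> K b"
  proof -
    have "- K b \<le> - K a"
    proof (rule nonincreasing_finite_exceptions[OF Z ab])
      show "continuous_on {a..b} (\<lambda>t. - K t)" by (intro continuous_intros K)
      fix s assume s: "s \<in> {a<..<b} - Z"
      have "((\<lambda>t. - K t) has_real_derivative - k s) (at s)"
        by (intro DERIV_minus K' s)
      moreover have "0 \<le> k s" using bnd[OF s] norm_ge_zero order_trans by blast
      ultimately show "\<exists>d\<le>0. ((\<lambda>t. - K t) has_real_derivative d) (at s)"
        by (intro exI[of _ "- k s"]) simp
    qed
    then show ?thesis by simp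
  qed
  ultimately show ?thesis
    unfolding w_def[symmetric] by (cases "w = 0") (auto simp: mult_le_cancel_left)
qed

text \<open>The average in the conclusion is the solution of u' + 2 u / r = F with u = 0 at r = 0,
  because (r^2 u)' = r^2 F. Its kernel s^2 / r^2 is at most 1, so the singular coefficient costs
  nothing in the estimates.\<close>

lemma weighted_average_bound:
  fixes F :: "real \<Rightarrow> real"
  assumes F: "continuous_on {0..r} F" and r: "0 < r"
    and G: "(G has_integral I) {0..r}" and le: "\<And>s. s \<in> {0..r} \<Longrightarrow> \<bar>F s\<bar> \<le> G s"
  shows "\<bar>integral {0..r} (\<lambda>s. s\<^sup>2 * F s) / r\<^sup>2\<bar> \<le> I"
proof -
  have i: "(\<lambda>s. s\<^sup>2 * F s) integrable_on {0..r}"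
    by (intro integrable_continuous_interval continuous_intros F)
  have "norm (integral {0..r} (\<lambda>s. s\<^sup>2 * F s)) \<le> integral {0..r} (\<lambda>s. r\<^sup>2 * G s)"
  proof (rule integral_norm_bound_integral[OF i])
    show "(\<lambda>s. r\<^sup>2 * G s) integrable_on {0..r}"
      using has_integral_mult_right[OF G, of "r\<^sup>2"] by (rule has_integral_integrable)
    fix s assume s: "s \<in> {0..r}"
    then have "s\<^sup>2 \<le> r\<^sup>2" by (intro power_mono) auto
    then have "s\<^sup>2 * \<bar>F s\<bar> \<le> r\<^sup>2 * G s" using le[OF s] by (intro mult_mono) auto
    then show "norm (s\<^sup>2 * F s) \<le> r\<^sup>2 * G s" by (simp add: abs_mult)
  qed
  also have "\<dots> = r\<^sup>2 * I" using has_integral_mult_right[OF G, of "r\<^sup>2"] by (rule integral_unique)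
  finally show ?thesis using r by (simp add: field_simps)
qed

lemma weighted_average_continuous:
  fixes F :: "real \<Rightarrow> real"
  assumes F: "continuous_on {0..R} F"
  shows "continuous_on {0..R} (\<lambda>r. if r = 0 then 0 else integral {0..r} (\<lambda>s. s\<^sup>2 * F s) / r\<^sup>2)"
    (is "continuous_on _ ?A")
proof -
  have i: "(\<lambda>s. s\<^sup>2 * F s) integrable_on {0..R}"
    by (intro integrable_continuous_interval continuous_intros F)
  have "continuous_on {0<..R} (\<lambda>r. integral {0..r} (\<lambda>s. s\<^sup>2 * F s) / r\<^sup>2)"
    by (intro continuous_intros continuous_on_subset[OF indefinite_integral_continuous_1[OF i]]) auto
  then have cA: "continuous_on {0<..R} ?A"
    by (rule continuous_on_eq) auto
  obtain B where B: "\<And>s. s \<in> {0..R} \<Longrightarrow> \<bar>F s\<bar> \<le> B"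
    using continuous_on_Icc_upper_bound[of 0 R "\<lambda>s. \<bar>F s\<bar>"] F by (auto intro: continuous_intros)
  \<comment> \<open>The average is at most linear in \<open>r\<close>; this gives continuity at the
    singular point 0.\<close>
  have bound: "\<bar>?A r\<bar> \<le> B * r" if r: "r \<in> {0..R}" for r
  proof (cases "r = 0")
    case False
    then have r0: "0 < r" using r by simp
    have "\<bar>integral {0..r} (\<lambda>s. s\<^sup>2 * F s) / r\<^sup>2\<bar> \<le> (r - 0) *\<^sub>R B"
      by (rule weighted_average_bound[OF continuous_on_subset[OF F] r0])
        (use r r0 B has_integral_const_real[of B 0 r] in auto)
    then show ?thesis using False by (simp add: mult.commute)
  qed simp
  show ?thesis
    unfolding continuous_on_eq_continuous_within
  proof
    fix x assume x: "x \<in> {0..R}"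
    show "continuous (at x within {0..R}) ?A"
    proof (cases "x = 0")
      case True
      have "((\<lambda>r. B * r) \<longlongrightarrow> B * 0) (at 0 within {0..R})" by (intro tendsto_intros)
      then have "((\<lambda>r. B * r) \<longlongrightarrow> 0) (at 0 within {0..R})" by simp
      moreover have "\<forall>\<^sub>F r in at 0 within {0..R}. norm (?A r) \<le> B * r"
        unfolding eventually_at_filter real_norm_def using bound by (intro always_eventually) blast
      ultimately have "(?A \<longlongrightarrow> 0) (at 0 within {0..R})" by (rule Lim_null_comparison[rotated])
      then show ?thesis unfolding True continuous_within by simp
    next
      case False
      then have x': "x \<in> {0<..R}" using x by auto
      have "at x within {0..R} = at x within {0<..R}"
        by (rule at_within_nhd[of x "{0<..}"]) (use x' in auto)
      moreover have "continuous (at x within {0<..R}) ?A"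
        using cA x' by (simp only: continuous_on_eq_continuous_within)
      ultimately show ?thesis by simp
    qed
  qed
qed

lemma weighted_average_derivative:
  fixes F :: "real \<Rightarrow> real"
  assumes F: "continuous_on {0..R} F" and r: "0 < r" "r < R"
  shows "((\<lambda>r. if r = 0 then 0 else integral {0..r} (\<lambda>s. s\<^sup>2 * F s) / r\<^sup>2) has_real_derivative
     F r - 2 * (integral {0..r} (\<lambda>s. s\<^sup>2 * F s) / r\<^sup>2) / r) (at r)"
proof -
  let ?J = "\<lambda>r. integral {0..r} (\<lambda>s. s\<^sup>2 * F s)"
  have "continuous_on {0..R} (\<lambda>s. s\<^sup>2 * F s)" by (intro continuous_intros F)
  then have "(?J has_real_derivative r\<^sup>2 * F r) (at r within {0..R})"
    using integral_has_real_derivative[of 0 R "\<lambda>s. s\<^sup>2 * F s" r] r by simp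
  moreover have "at r within {0..R} = at r" using r by (intro at_within_interior) auto
  ultimately have J: "(?J has_real_derivative r\<^sup>2 * F r) (at r)" by simp
  have "((\<lambda>r. ?J r / r\<^sup>2) has_real_derivative (r\<^sup>2 * F r * r\<^sup>2 - ?J r * (2 * r)) / (r\<^sup>2 * r\<^sup>2)) (at r)"
    by (rule DERIV_divide[OF J]) (use r in \<open>auto intro!: derivative_eq_intros\<close>)
  moreover have "(r\<^sup>2 * F r * r\<^sup>2 - ?J r * (2 * r)) / (r\<^sup>2 * r\<^sup>2) = F r - 2 * (?J r / r\<^sup>2) / r"
    using r by (simp add: field_simps power2_eq_square)
  ultimately have "((\<lambda>r. ?J r / r\<^sup>2) has_real_derivative F r - 2 * (?J r / r\<^sup>2) / r) (at r)" by simp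
  then show ?thesis
    by (rule has_field_derivative_transform_within_open[OF _ open_greaterThan[of 0]]) (use r in auto)
qed

subsection \<open>Elementary inequalities\<close>

lemma exp_diff_le:
  fixes a b :: real
  assumes "a \<le> M" "b \<le> M"
  shows "\<bar>exp a - exp b\<bar> \<le> exp M * \<bar>a - b\<bar>"
proof -
  have *: "exp y - exp x \<le> exp M * (y - x)" if "x \<le> y" "y \<le> M" for x y :: real
  proof -
    have "exp y - exp x = exp y * (1 - exp (x - y))"
      by (simp add: exp_diff right_diff_distrib)
    also have "\<dots> \<le> exp y * (y - x)"
    proof (rule mult_left_mono)
      show "1 - exp (x - y) \<le> y - x" using exp_ge_add_one_self[of "x - y"] by linarith
    qed simp
    also have "\<dots> \<le> exp M * (y - x)" using that by (intro mult_right_mono) auto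
    finally show ?thesis .
  qed
  show ?thesis
    using *[of a b] *[of b a] assms by (cases "a \<le> b") (auto simp: abs_if)
qed

lemma inverse_diff_le:
  fixes x y c :: real
  assumes "c > 0" "x \<ge> c" "y \<ge> c"
  shows "\<bar>1 / x - 1 / y\<bar> \<le> \<bar>x - y\<bar> / c\<^sup>2"
proof -
  have xy: "x > 0" "y > 0" using assms by auto
  have "1 / x - 1 / y = (y - x) / (x * y)" using xy by (simp add: field_simps)
  then have "\<bar>1 / x - 1 / y\<bar> = \<bar>x - y\<bar> / (x * y)"
    using xy by (simp add: abs_mult abs_minus_commute)
  also have "\<dots> \<le> \<bar>x - y\<bar> / (c * c)"
    using assms by (intro divide_left_mono mult_mono mult_pos_pos) auto
  finally show ?thesis by (simp add: power2_eq_square)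
qed

lemma abs_snd_diff_le:
  fixes y z :: "real \<times> real"
  shows "\<bar>snd y - snd z\<bar> \<le> norm (y - z)"
  using norm_snd_le[of "snd (y - z)" "fst (y - z)"] unfolding prod.collapse by simp

lemma x_cos_le_sin:
  fixes x :: real
  assumes "0 \<le> x" "x \<le> pi"
  shows "x * cos x \<le> sin x"
proof -
  have "sin 0 - 0 * cos 0 \<le> sin x - x * cos x"
  proof (rule DERIV_nonneg_imp_nondecreasing[OF assms(1)])
    fix t assume t: "0 \<le> t" "t \<le> x"
    have "((\<lambda>x. sin x - x * cos x) has_real_derivative t * sin t) (at t)"
      by (auto intro!: derivative_eq_intros)
    moreover have "t * sin t \<ge> 0"
      using t assms by (simp add: sin_ge_zero)
    ultimately show "\<exists>d. ((\<lambda>x. sin x - x * cos x) has_real_derivative d) (at t) \<and> 0 \<le> d"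
      by blast
  qed
  then show ?thesis by simp
qed

text \<open>On this range the square of the cosine is at least 1/2, hence y \<le> 2 y (cos y)^2
  \<le> 2 sin y cos y. With this linear lower bound the singularity at a diagonal is no worse than
  the power p - 1 of the distance to it, which is integrable.\<close>

lemma abs_le_abs_sin_double:
  fixes x :: real
  assumes "\<bar>x\<bar> \<le> pi / 4"
  shows "\<bar>x\<bar> \<le> \<bar>sin (2 * x)\<bar>"
proof -
  define y where "y = \<bar>x\<bar>"
  have y: "0 \<le> y" "y \<le> pi / 4" using assms by (auto simp: y_def)
  have "cos (2 * y) \<ge> 0" using y by (intro cos_ge_zero) auto
  then have c: "(cos y)\<^sup>2 \<ge> 1 / 2" by (simp add: cos_double_cos)
  have c0: "cos y \<ge> 0" using y by (intro cos_ge_zero) auto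
  have "y \<le> 2 * (y * (cos y)\<^sup>2)" using mult_left_mono[OF c, of "2 * y"] y by simp
  also have "\<dots> = 2 * (y * cos y) * cos y" by (simp add: power2_eq_square)
  also have "\<dots> \<le> 2 * sin y * cos y"
    using x_cos_le_sin[of y] y c0 by (intro mult_right_mono) auto
  also have "\<dots> = sin (2 * y)" by (simp add: sin_double)
  finally have "y \<le> \<bar>sin (2 * y)\<bar>" by simp
  then show ?thesis by (auto simp: y_def abs_if split: if_splits)
qed

text \<open>The odd extension of the p-th power, which is the antiderivative of \<open>F p\<close>
  off 0 and for p > 0 is continuous at 0. It appears in the energy and again as the building block
  of the integrable weights.\<close>

definition spow :: "real \<Rightarrow> real \<Rightarrow> real" where
  "spow p x = x * \<bar>x\<bar> powr (p - 1)"

lemma spow_pos: "x > 0 \<Longrightarrow> spow p x = x powr p"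
  using powr_mult_base[of x "p - 1"] by (simp add: spow_def)

lemma spow_nonneg: "x \<ge> 0 \<Longrightarrow> spow p x \<ge> 0" and spow_nonpos: "x \<le> 0 \<Longrightarrow> spow p x \<le> 0"
  by (auto simp: spow_def mult_nonpos_nonneg)

lemma spow_0 [simp]: "spow p 0 = 0" by (simp add: spow_def)

lemma abs_spow: "\<bar>spow p x\<bar> = \<bar>x\<bar> powr p"
  using powr_mult_base[of "\<bar>x\<bar>" "p - 1"] by (cases "x = 0") (simp_all add: spow_def abs_mult)

lemma spow_altdef: "spow p x = sgn x * \<bar>x\<bar> powr p"
  using powr_mult_base[of "\<bar>x\<bar>" "p - 1"]
  by (cases x "0 :: real" rule: linorder_cases) (simp_all add: spow_def)

lemma abs_spow_le_1: "0 \<le> p \<Longrightarrow> \<bar>x\<bar> \<le> 1 \<Longrightarrow> \<bar>spow p x\<bar> \<le> 1"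
  unfolding abs_spow using powr_mono2[of p "\<bar>x\<bar>" 1] by simp

lemma spow_has_derivative:
  assumes "x \<noteq> 0"
  shows "(spow p has_real_derivative p * \<bar>x\<bar> powr (p - 1)) (at x)"
proof (cases "x > 0")
  case True
  have "((\<lambda>x. x powr p) has_real_derivative p * x powr (p - 1)) (at x)"
    using True by (rule has_real_derivative_powr)
  then have "(spow p has_real_derivative p * x powr (p - 1)) (at x)"
    by (rule has_field_derivative_transform_within_open[OF _ open_greaterThan[of 0]])
      (use True in \<open>auto simp: spow_pos\<close>)
  with True show ?thesis by simp
next
  case False
  then have x: "x < 0" using assms by simp
  have "((\<lambda>x. - ((- x) powr p)) has_real_derivative p * (- x) powr (p - 1)) (at x)"
    using x by (auto intro!: derivative_eq_intros)
  then have "(spow p has_real_derivative p * (- x) powr (p - 1)) (at x)"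
    by (rule has_field_derivative_transform_within_open[OF _ open_lessThan[of 0]])
      (use x in \<open>auto simp: spow_altdef\<close>)
  with x show ?thesis by simp
qed

lemma isCont_spow:
  assumes "p > 0"
  shows "isCont (spow p) x"
proof (cases "x = 0")
  case True
  have "((\<lambda>x. \<bar>x\<bar> powr p) \<longlongrightarrow> 0 powr p) (at 0)"
    using assms by (intro tendsto_powr2) (auto intro!: tendsto_eq_intros)
  then have "((\<lambda>x. \<bar>spow p x\<bar>) \<longlongrightarrow> 0) (at 0)"
    using assms by (simp add: abs_spow)
  then show ?thesis
    unfolding True isCont_def by (simp add: tendsto_rabs_zero_iff)
qed (use spow_has_derivative DERIV_isCont in blast)

lemma continuous_on_spow [continuous_intros]:
  assumes "p > 0" "continuous_on S f"
  shows "continuous_on S (\<lambda>x. spow p (f x))"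
  by (rule continuous_on_compose2[OF _ assms(2), of UNIV])
    (auto intro!: continuous_at_imp_continuous_on isCont_spow assms(1))

section \<open>Zeros of cos (2 s), the angles of the diagonals\<close>

lemma cos_double_eq_0_finite:
  assumes "s \<in> {0..real n * (pi / 2)}"
  shows "cos (2 * s) = 0 \<longleftrightarrow> s \<in> (\<lambda>j. pi / 4 + real j * (pi / 2)) ` {..n}"
proof
  assume "cos (2 * s) = 0"
  then obtain i :: int where i: "odd i" "2 * s = of_int i * (pi / 2)"
    unfolding cos_zero_iff_int by auto
  then obtain k where k: "i = 2 * k + 1" by (elim oddE)
  have s: "s = pi / 4 + of_int k * (pi / 2)" using i(2) k by (simp add: algebra_simps)
  have "of_int k * (pi / 2) \<ge> - pi / 4" "of_int k * (pi / 2) \<le> real n * (pi / 2)"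
    using assms s pi_gt_zero unfolding atLeastAtMost_iff by linarith+
  then have "of_int k * (pi / 2) > -1 * (pi / 2)" and "of_int k * (pi / 2) \<le> real n * (pi / 2)"
    using pi_gt_zero by linarith+
  moreover from this(2) have "of_int k \<le> real n"
    by (rule mult_right_le_imp_le) simp
  ultimately have "of_int k * (pi / 2) > -1 * (pi / 2)" "of_int k \<le> real n" by auto
  then have "of_int k > (-1 :: real)" by (simp only: mult_less_cancel_right) auto
  then have k0: "k \<ge> 0" by linarith
  then have "nat k \<le> n" using \<open>of_int k \<le> real n\<close> by linarith
  moreover have "s = pi / 4 + real (nat k) * (pi / 2)" using s k0 by simp
  ultimately show "s \<in> (\<lambda>j. pi / 4 + real j * (pi / 2)) ` {..n}" by blast
next
  assume "s \<in> (\<lambda>j. pi / 4 + real j * (pi / 2)) ` {..n}"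
  then obtain j where "s = pi / 4 + real j * (pi / 2)" by auto
  then have "2 * s = of_int (2 * int j + 1) * (pi / 2)" by (simp add: algebra_simps)
  then show "cos (2 * s) = 0" unfolding cos_zero_iff_int by (metis even_plus_one_iff even_mult_iff even_numeral)
qed

lemma finite_cos_double_zeros:
  fixes a b :: real
  assumes "0 \<le> a"
  shows "finite {s \<in> {a..b}. cos (2 * s) = 0}"
proof -
  obtain n :: nat where "b / (pi / 2) \<le> real n" using real_arch_simple by blast
  then have "{s \<in> {a..b}. cos (2 * s) = 0} \<subseteq> (\<lambda>j. pi / 4 + real j * (pi / 2)) ` {..n}"
    using cos_double_eq_0_finite[of _ n] assms by (auto simp: field_simps)
  then show ?thesis by (rule finite_subset) simp
qed

lemma monotone_with_slope:
  fixes r :: "real \<Rightarrow> real"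
  assumes "0 \<le> a" "a \<le> b" "continuous_on {a..b} r"
    and der: "\<And>s. s \<in> {a<..<b} \<Longrightarrow> cos (2 * s) \<noteq> 0 \<Longrightarrow> (r has_real_derivative r' s) (at s)"
    and lower: "\<And>s. s \<in> {a<..<b} \<Longrightarrow> cos (2 * s) \<noteq> 0 \<Longrightarrow> c \<le> r' s"
  shows "r a + c * (b - a) \<le> r b"
proof -
  have "c * b - r b \<le> c * a - r a"
  proof (rule nonincreasing_finite_exceptions[OF finite_cos_double_zeros[OF assms(1), of b] assms(2)])
    show "continuous_on {a..b} (\<lambda>s. c * s - r s)" by (intro continuous_intros assms)
    fix s assume "s \<in> {a<..<b} - {s \<in> {a..b}. cos (2 * s) = 0}"
    then have s: "s \<in> {a<..<b}" "cos (2 * s) \<noteq> 0" by auto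
    have "((\<lambda>s. c * s - r s) has_real_derivative c - r' s) (at s)"
      by (auto intro!: derivative_eq_intros der[OF s])
    then show "\<exists>d\<le>0. ((\<lambda>s. c * s - r s) has_real_derivative d) (at s)"
      using lower[OF s] by (intro exI[of _ "c - r' s"]) simp
  qed
  then show ?thesis by (simp add: algebra_simps)
qed

lemma monotone_with_slope_upper:
  fixes r :: "real \<Rightarrow> real"
  assumes "0 \<le> a" "a \<le> b" "continuous_on {a..b} r"
    and der: "\<And>s. s \<in> {a<..<b} \<Longrightarrow> cos (2 * s) \<noteq> 0 \<Longrightarrow> (r has_real_derivative r' s) (at s)"
    and upper: "\<And>s. s \<in> {a<..<b} \<Longrightarrow> cos (2 * s) \<noteq> 0 \<Longrightarrow> r' s \<le> c"
  shows "r b \<le> r a + c * (b - a)"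
proof -
  have "- r a + - c * (b - a) \<le> - r b"
    by (rule monotone_with_slope[OF assms(1,2), of _ "\<lambda>s. - r' s"])
      (auto intro!: continuous_intros DERIV_minus der upper assms(3))
  then show ?thesis by simp
qed

lemma cos_double_shift: "cos (2 * (real n * pi + x)) = cos (2 * x)"
  and sin_double_shift: "sin (2 * (real n * pi + x)) = sin (2 * x)"
proof -
  have *: "2 * (real n * pi + x) = 2 * x + 2 * real n * pi" by (simp add: algebra_simps)
  have "cos (2 * real n * pi) = 1" "sin (2 * real n * pi) = 0"
    using cos_2npi[of n] sin_2npi[of n] by (simp_all add: mult_ac)
  then show "cos (2 * (real n * pi + x)) = cos (2 * x)" "sin (2 * (real n * pi + x)) = sin (2 * x)"
    unfolding * by (simp_all add: cos_add sin_add)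
qed

lemma sin_sq_shift: "(sin (real n * pi + x))\<^sup>2 = (sin x)\<^sup>2"
proof -
  have "1 - 2 * (sin (real n * pi + x))\<^sup>2 = 1 - 2 * (sin x)\<^sup>2"
    unfolding cos_double_sin[symmetric] by (rule cos_double_shift)
  then show ?thesis by simp
qed

text \<open>The zeros are pi/2 + j pi. The first lies beyond every admissible starting angle, and
  the one with j = n lies a quarter of pi beyond \<open>T\<close>, so exactly the indices below
  \<open>n\<close> remain.\<close>

lemma cos_zeros_count:
  assumes t0: "0 < t0" "t0 < pi / 8" and T: "T = real n * pi + pi / 4"
  shows "finite {t \<in> {t0..<T}. cos t = 0}" "card {t \<in> {t0..<T}. cos t = 0} = n"
proof -
  have eq: "{t \<in> {t0..<T}. cos t = 0} = (\<lambda>j. real j * pi + pi / 2) ` {..<n}"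
  proof (intro equalityI subsetI)
    fix t assume "t \<in> {t \<in> {t0..<T}. cos t = 0}"
    then have t: "t0 \<le> t" "t < T" "cos t = 0" by auto
    then obtain i :: int where i: "odd i" "t = of_int i * (pi / 2)" unfolding cos_zero_iff_int by auto
    then obtain k where k: "i = 2 * k + 1" by (elim oddE)
    have tk: "t = of_int k * pi + pi / 2" using i(2) k by (simp add: algebra_simps)
    have "of_int k * pi > -1 * pi" using tk t t0 pi_gt_zero by linarith
    then have "of_int k > (-1 :: real)" by (rule mult_right_less_imp_less) simp
    then have k0: "k \<ge> 0" by linarith
    have "of_int k * pi < real n * pi" using tk t T pi_gt_zero by linarith
    then have "of_int k < real n" by (rule mult_right_less_imp_less) simp
    then have "nat k < n" using k0 by linarith
    moreover have "t = real (nat k) * pi + pi / 2" using tk k0 by simp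
    ultimately show "t \<in> (\<lambda>j. real j * pi + pi / 2) ` {..<n}" by blast
  next
    fix t assume "t \<in> (\<lambda>j. real j * pi + pi / 2) ` {..<n}"
    then obtain j where j: "j < n" "t = real j * pi + pi / 2" by auto
    have "real j + 1 \<le> real n" using j(1) by linarith
    then have "real j * pi + pi \<le> real n * pi" using mult_right_mono[of "real j + 1" "real n" pi] by (simp add: algebra_simps)
    moreover have "0 \<le> real j * pi" by simp
    ultimately have "t0 \<le> t" "t < T" using j t0 T pi_gt_zero by linarith+
    moreover have "cos t = 0" unfolding j(2) by (simp add: cos_add)
    ultimately show "t \<in> {t \<in> {t0..<T}. cos t = 0}" by auto
  qed
  show "finite {t \<in> {t0..<T}. cos t = 0}" unfolding eq by simp
  have "inj_on (\<lambda>j. real j * pi + pi / 2) {..<n}" by (auto intro!: inj_onI)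
  then show "card {t \<in> {t0..<T}. cos t = 0} = n" unfolding eq by (simp add: card_image)
qed

subsection \<open>The system with the angle as independent variable\<close>

text \<open>The thresholds are set by the angular speed. Positive energy bounds the singular term of
  the speed by \<open>p\<close> times \<open>\<Omega> - m * cos (2 * \<theta>)\<close>; with these
  values the speed keeps the margin \<open>\<Omega> / 8\<close> even when the geometric term sin (2
  \<theta>) / r takes away \<open>3 / 4 * \<Omega>\<close>.\<close>

locale dirac =
  fixes m p \<Omega> :: real
  assumes m_pos: "0 < m" and p_pos: "0 < p" and p_small: "p < 1 / 20" and Om_large: "20 * m < \<Omega>"
begin

lemma Om_pos: "0 < \<Omega>"
  using m_pos Om_large by linarith

text \<open>The radius at which the description near the origin hands over to the angular one. It is
  so short that the rescaled component V, whose slope is at most \<open>5 / 8 * \<Omega>\<close>,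
  stays within 1/100 of 1.\<close>

definition r0 :: real where "r0 = 1 / (100 * \<Omega>)"

lemma r0_pos: "0 < r0"
  using Om_pos by (simp add: r0_def)

text \<open>With v^2 - u^2 = P cos (2 \<theta>), the value of \<open>F p\<close> is p P^(p-1) times
  \<open>kap\<close>, and the signed p-th power is P^p times \<open>gam\<close>. At the diagonals
  \<open>kap\<close> is singular but integrable, while \<open>gam\<close> stays bounded and
  continuous.\<close>

definition kap :: "real \<Rightarrow> real" where "kap \<theta> = \<bar>cos (2 * \<theta>)\<bar> powr (p - 1)"

definition gam :: "real \<Rightarrow> real" where "gam \<theta> = spow p (cos (2 * \<theta>))"

lemma kap_nonneg: "kap \<theta> \<ge> 0" by (simp add: kap_def)

lemma abs_gam_le_1: "\<bar>gam \<theta>\<bar> \<le> 1"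
  unfolding gam_def by (rule abs_spow_le_1) (use p_pos in auto)

lemma gam_eq: "gam \<theta> = cos (2 * \<theta>) * kap \<theta>"
  by (simp add: gam_def kap_def spow_def)

lemma continuous_on_gam [continuous_intros]:
  fixes f :: "'a::t2_space \<Rightarrow> real"
  shows "continuous_on S f \<Longrightarrow> continuous_on S (\<lambda>x. gam (f x))"
  unfolding gam_def by (intro continuous_on_spow p_pos continuous_on_cos continuous_intros)

lemma continuous_on_kap [continuous_intros]:
  fixes f :: "'a::t2_space \<Rightarrow> real"
  shows "continuous_on S f \<Longrightarrow> (\<And>x. x \<in> S \<Longrightarrow> cos (2 * f x) \<noteq> 0) \<Longrightarrow> continuous_on S (\<lambda>x. kap (f x))"
  unfolding kap_def
  by (intro continuous_on_powr continuous_on_rabs continuous_on_cos continuous_on_mult continuous_on_const) auto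

lemma gam_has_derivative:
  assumes "cos (2 * \<theta>) \<noteq> 0"
  shows "(gam has_real_derivative - 2 * sin (2 * \<theta>) * (p * kap \<theta>)) (at \<theta>)"
proof -
  have "((\<lambda>\<theta>. cos (2 * \<theta>)) has_real_derivative - 2 * sin (2 * \<theta>)) (at \<theta>)"
    by (auto intro!: derivative_eq_intros)
  from DERIV_chain2[OF spow_has_derivative[OF assms] this, of p] show ?thesis
    unfolding gam_def[abs_def] kap_def by (simp add: mult_ac)
qed

text \<open>
  With \<open>u = \<surd>P sin \<theta>\<close>, \<open>v = \<surd>P cos \<theta>\<close> and \<open>P powr (p - 1) = exp l\<close>, a solution of the system
  satisfies \<open>d\<theta>/dr = D\<close> wherever the maximum below is attained by its second argument.
\<close>

definition Dn :: "real \<Rightarrow> real \<Rightarrow> real \<Rightarrow> real" where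
  "Dn \<theta> r l = max (\<Omega> / 8) (\<Omega> - m * cos (2 * \<theta>) - p * exp l * gam \<theta> - sin (2 * \<theta>) / r)"

text \<open>This is - P' / P along a solution of the system, the prime denoting d/dr. Since l = (p -
  1) ln P, division by \<theta>' turns it into dl/d\<theta>, which is \<open>dl\<close>.\<close>

definition Nm :: "real \<Rightarrow> real \<Rightarrow> real \<Rightarrow> real" where
  "Nm \<theta> r l = 2 * sin (2 * \<theta>) * (p * exp l * kap \<theta> + m) + 4 * (sin \<theta>)\<^sup>2 / r"

definition dl :: "real \<Rightarrow> real \<Rightarrow> real \<Rightarrow> real" where
  "dl \<theta> r l = (1 - p) * Nm \<theta> r l / Dn \<theta> r l"

lemma Dn_ge: "Dn \<theta> r l \<ge> \<Omega> / 8" by (simp add: Dn_def)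

lemma Dn_pos: "Dn \<theta> r l > 0" using Dn_ge[of \<theta> r l] Om_pos by linarith

text \<open>Both truncations, together with the floor in \<open>Dn\<close>, make the system globally
  Lipschitz with a multiple of \<open>1 + kap\<close> as constant. A cap of \<open>l\<close> from
  above is enough, since \<open>l\<close> enters through \<open>exp l\<close> only.\<close>

definition rhs :: "real \<Rightarrow> real \<Rightarrow> real \<times> real \<Rightarrow> real \<times> real" where
  "rhs M \<theta> y = (1 / Dn \<theta> (max r0 (fst y)) (min M (snd y)), dl \<theta> (max r0 (fst y)) (min M (snd y)))"

text \<open>Each interval of length pi/2 between multiples of pi/2 has one diagonal, its midpoint.
  The summand of the interval containing \<open>s\<close> already dominates \<open>kap s\<close>;
  the negative exponent reverses the inequality between distance and cosine.\<close>

lemma kap_le_sum: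
  assumes s: "s \<in> {0..real n * (pi / 2)}"
    and nz: "s \<notin> (\<lambda>j. pi / 4 + real j * (pi / 2)) ` {..n}"
  shows "kap s \<le> (\<Sum>j\<le>n. \<bar>s - (pi / 4 + real j * (pi / 2))\<bar> powr (p - 1))"
proof -
  define j where "j = nat \<lfloor>s / (pi / 2)\<rfloor>"
  have s0: "s \<ge> 0" using s by simp
  have rj: "real j = of_int \<lfloor>s / (pi / 2)\<rfloor>" using s0 by (simp add: j_def)
  have j1: "real j \<le> s / (pi / 2)" "s / (pi / 2) < real j + 1"
    unfolding rj by linarith+
  have "s / (pi / 2) \<le> real n" using s by (simp add: field_simps)
  then have jn: "j \<le> n" using j1 by linarith
  define \<delta> where "\<delta> = s - (pi / 4 + real j * (pi / 2))"
  have "\<bar>\<delta>\<bar> \<le> pi / 4"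
    using j1 by (auto simp: \<delta>_def abs_le_iff field_simps)
  have "\<delta> \<noteq> 0" using nz jn by (auto simp: \<delta>_def)
  have "cos (2 * s) = cos (2 * \<delta> + pi / 2 + real j * pi)"
    by (simp add: \<delta>_def algebra_simps)
  also have "\<bar>\<dots>\<bar> = \<bar>cos (2 * \<delta> + pi / 2)\<bar>"
    by (simp add: cos_add[of _ "real j * pi"] abs_mult flip: power_abs)
  also have "\<dots> = \<bar>sin (2 * \<delta>)\<bar>"
    by (simp add: cos_add)
  finally have "\<bar>\<delta>\<bar> \<le> \<bar>cos (2 * s)\<bar>"
    using abs_le_abs_sin_double[OF \<open>\<bar>\<delta>\<bar> \<le> pi / 4\<close>] by simp
  then have "kap s \<le> \<bar>\<delta>\<bar> powr (p - 1)"
    unfolding kap_def using \<open>\<delta> \<noteq> 0\<close> p_small by (intro powr_mono2') auto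
  also have "\<dots> \<le> (\<Sum>j\<le>n. \<bar>s - (pi / 4 + real j * (pi / 2))\<bar> powr (p - 1))"
    unfolding \<delta>_def
    by (rule member_le_sum[of j "{..n}" "\<lambda>j. \<bar>s - (pi / 4 + real j * (pi / 2))\<bar> powr (p - 1)"]) (use jn in auto)
  finally show ?thesis .
qed

text \<open>\<open>K\<close> is an explicit sum of shifted signed powers: continuous because p > 0,
  with a derivative that carries an integrable singularity at every diagonal up to
  \<open>T\<close>.\<close>

lemma weight_exists:
  assumes "C \<ge> 0"
  obtains Z K k where "finite Z" "continuous_on UNIV K"
    "\<And>s. s \<in> {0..T} \<Longrightarrow> cos (2 * s) = 0 \<longleftrightarrow> s \<in> Z"
    "\<And>s. s \<in> {0..T} - Z \<Longrightarrow> (K has_real_derivative k s) (at s)"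
    "\<And>s. s \<in> {0..T} - Z \<Longrightarrow> C * (1 + kap s) \<le> k s"
proof -
  obtain n :: nat where n: "T / (pi / 2) \<le> real n" using real_arch_simple by blast
  have nT: "{0..T} \<subseteq> {0..real n * (pi / 2)}" using n by (auto simp: field_simps)
  define a where "a j = pi / 4 + real j * (pi / 2)" for j
  define Z where "Z = a ` {..n}"
  define K where "K s = C * (s + (\<Sum>j\<le>n. spow p (s - a j)) / p)" for s
  define k where "k s = C * (1 + (\<Sum>j\<le>n. \<bar>s - a j\<bar> powr (p - 1)))" for s
  show thesis
  proof (rule that[of Z K k])
    show "finite Z" by (simp add: Z_def)
    show "continuous_on UNIV K"
      unfolding K_def by (intro continuous_intros p_pos) (use p_pos in auto)
    show "cos (2 * s) = 0 \<longleftrightarrow> s \<in> Z" if "s \<in> {0..T}" for s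
      using cos_double_eq_0_finite[of s n] nT that by (auto simp: Z_def a_def[abs_def])
    fix s assume s: "s \<in> {0..T} - Z"
    have *: "((\<lambda>s. spow p (s - a j)) has_real_derivative p * \<bar>s - a j\<bar> powr (p - 1)) (at s)" if "j \<le> n" for j
    proof -
      have "s - a j \<noteq> 0" using s that by (auto simp: Z_def)
      moreover have "((\<lambda>s. s - a j) has_real_derivative 1) (at s)"
        by (auto intro!: derivative_eq_intros)
      ultimately show ?thesis
        using DERIV_chain2[where g = "\<lambda>s. s - a j" and x = s, OF spow_has_derivative] by fastforce
    qed
    show "(K has_real_derivative k s) (at s)"
    proof -
      have "((\<lambda>s. \<Sum>j\<le>n. spow p (s - a j)) has_real_derivative (\<Sum>j\<le>n. p * \<bar>s - a j\<bar> powr (p - 1))) (at s)"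
        by (intro DERIV_sum *) simp
      then have "(K has_real_derivative C * (1 + (\<Sum>j\<le>n. p * \<bar>s - a j\<bar> powr (p - 1)) / p)) (at s)"
        unfolding K_def by (intro DERIV_cmult DERIV_add DERIV_cdivide DERIV_ident)
      then show ?thesis
        using p_pos by (simp add: k_def flip: sum_distrib_left)
    qed
    show "C * (1 + kap s) \<le> k s"
      unfolding k_def a_def using kap_le_sum[of s n] s nT assms
      by (intro mult_left_mono add_left_mono) (auto simp: Z_def a_def[abs_def])
  qed
qed

section \<open>Bounds and Lipschitz constants of the truncated right-hand side\<close>

lemma Dn_lipschitz:
  assumes "r \<ge> r0" "r' \<ge> r0" "l \<le> M" "l' \<le> M"
  shows "\<bar>Dn \<theta> r l - Dn \<theta> r' l'\<bar> \<le> (exp M + 1 / r0\<^sup>2) * (\<bar>r - r'\<bar> + \<bar>l - l'\<bar>)"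
proof -
  have "\<bar>p * exp l * gam \<theta> - p * exp l' * gam \<theta>\<bar> = p * \<bar>gam \<theta>\<bar> * \<bar>exp l - exp l'\<bar>"
    using p_pos by (simp add: abs_mult flip: left_diff_distrib right_diff_distrib)
  also have "\<dots> \<le> 1 * (exp M * \<bar>l - l'\<bar>)"
    using p_small p_pos abs_gam_le_1[of \<theta>] exp_diff_le[OF assms(3,4)]
    by (intro mult_mono mult_le_one) auto
  finally have 1: "\<bar>p * exp l * gam \<theta> - p * exp l' * gam \<theta>\<bar> \<le> exp M * \<bar>l - l'\<bar>" by simp
  have "\<bar>sin (2 * \<theta>) / r - sin (2 * \<theta>) / r'\<bar> = \<bar>sin (2 * \<theta>)\<bar> * \<bar>1 / r - 1 / r'\<bar>"
    by (simp add: right_diff_distrib flip: abs_mult)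
  also have "\<dots> \<le> 1 * (\<bar>r - r'\<bar> / r0\<^sup>2)"
    using inverse_diff_le[OF r0_pos assms(1,2)] by (intro mult_mono) auto
  finally have 2: "\<bar>sin (2 * \<theta>) / r - sin (2 * \<theta>) / r'\<bar> \<le> \<bar>r - r'\<bar> / r0\<^sup>2" by simp
  have "\<bar>Dn \<theta> r l - Dn \<theta> r' l'\<bar> \<le> \<bar>p * exp l * gam \<theta> - p * exp l' * gam \<theta>\<bar> + \<bar>sin (2 * \<theta>) / r - sin (2 * \<theta>) / r'\<bar>"
    unfolding Dn_def by linarith
  also have "\<dots> \<le> exp M * \<bar>l - l'\<bar> + \<bar>r - r'\<bar> / r0\<^sup>2" using 1 2 by linarith
  also have "\<dots> \<le> (exp M + 1 / r0\<^sup>2) * (\<bar>r - r'\<bar> + \<bar>l - l'\<bar>)"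
    by (simp add: algebra_simps)
  finally show ?thesis .
qed

lemma inverse_Dn_lipschitz:
  assumes "r \<ge> r0" "r' \<ge> r0" "l \<le> M" "l' \<le> M"
  shows "\<bar>1 / Dn \<theta> r l - 1 / Dn \<theta> r' l'\<bar> \<le> (8 / \<Omega>)\<^sup>2 * (exp M + 1 / r0\<^sup>2) * (\<bar>r - r'\<bar> + \<bar>l - l'\<bar>)"
proof -
  have "\<bar>1 / Dn \<theta> r l - 1 / Dn \<theta> r' l'\<bar> \<le> \<bar>Dn \<theta> r l - Dn \<theta> r' l'\<bar> / (\<Omega> / 8)\<^sup>2"
    using Om_pos by (intro inverse_diff_le Dn_ge) auto
  also have "\<dots> \<le> ((exp M + 1 / r0\<^sup>2) * (\<bar>r - r'\<bar> + \<bar>l - l'\<bar>)) / (\<Omega> / 8)\<^sup>2"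
    by (intro divide_right_mono Dn_lipschitz assms) auto
  finally show ?thesis by (simp add: power_divide field_simps)
qed

lemma Nm_bound:
  assumes "r \<ge> r0" "l \<le> M"
  shows "\<bar>Nm \<theta> r l\<bar> \<le> (2 * exp M + 2 * m + 4 / r0) * (1 + kap \<theta>)"
proof -
  have 1: "\<bar>2 * sin (2 * \<theta>) * (p * exp l * kap \<theta> + m)\<bar> \<le> 2 * (exp M * kap \<theta> + m)"
  proof -
    have "p * exp l * kap \<theta> \<le> 1 * exp M * kap \<theta>"
      using p_small p_pos assms kap_nonneg by (intro mult_mono) auto
    moreover have "0 \<le> p * exp l * kap \<theta>" using p_pos kap_nonneg by simp
    ultimately have "\<bar>sin (2 * \<theta>)\<bar> * \<bar>p * exp l * kap \<theta> + m\<bar> \<le> 1 * (exp M * kap \<theta> + m)"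
      using m_pos by (intro mult_mono) auto
    then show ?thesis by (simp add: abs_mult)
  qed
  have "(sin \<theta>)\<^sup>2 \<le> 1" using abs_square_le_1[of "sin \<theta>"] by simp
  then have "(sin \<theta>)\<^sup>2 / r \<le> 1 / r0"
    using assms r0_pos by (intro frac_le) auto
  moreover have "0 \<le> (sin \<theta>)\<^sup>2 / r" using assms r0_pos by simp
  ultimately have 2: "\<bar>4 * (sin \<theta>)\<^sup>2 / r\<bar> \<le> 4 / r0" by simp
  have "\<bar>Nm \<theta> r l\<bar> \<le> 2 * (exp M * kap \<theta> + m) + 4 / r0"
    unfolding Nm_def using 1 2 by linarith
  also have "\<dots> \<le> (2 * exp M + 2 * m + 4 / r0) * (1 + kap \<theta>)"
    using kap_nonneg[of \<theta>] m_pos r0_pos by (simp add: algebra_simps add_divide_distrib)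
  finally show ?thesis .
qed

lemma Nm_lipschitz:
  assumes "r \<ge> r0" "r' \<ge> r0" "l \<le> M" "l' \<le> M"
  shows "\<bar>Nm \<theta> r l - Nm \<theta> r' l'\<bar> \<le> (2 * exp M + 4 / r0\<^sup>2) * (1 + kap \<theta>) * (\<bar>r - r'\<bar> + \<bar>l - l'\<bar>)"
proof -
  have "Nm \<theta> r l - Nm \<theta> r' l' = 2 * sin (2 * \<theta>) * p * kap \<theta> * (exp l - exp l') + 4 * (sin \<theta>)\<^sup>2 * (1 / r - 1 / r')"
    unfolding Nm_def by (simp add: algebra_simps)
  also have "\<bar>\<dots>\<bar> \<le> \<bar>2 * sin (2 * \<theta>) * p * kap \<theta> * (exp l - exp l')\<bar> + \<bar>4 * (sin \<theta>)\<^sup>2 * (1 / r - 1 / r')\<bar>"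
    by (rule abs_triangle_ineq)
  also have "\<bar>2 * sin (2 * \<theta>) * p * kap \<theta> * (exp l - exp l')\<bar> = 2 * (\<bar>sin (2 * \<theta>)\<bar> * p) * (kap \<theta> * \<bar>exp l - exp l'\<bar>)"
    using p_pos kap_nonneg[of \<theta>] by (simp add: abs_mult)
  also have "\<dots> \<le> 2 * 1 * (kap \<theta> * (exp M * \<bar>l - l'\<bar>))"
    using p_pos p_small kap_nonneg[of \<theta>] exp_diff_le[OF assms(3,4)]
    by (intro mult_mono mult_le_one mult_nonneg_nonneg) auto
  also have "\<bar>4 * (sin \<theta>)\<^sup>2 * (1 / r - 1 / r')\<bar> = 4 * (sin \<theta>)\<^sup>2 * \<bar>1 / r - 1 / r'\<bar>"
    by (simp add: abs_mult)
  also have "\<dots> \<le> 4 * 1 * (\<bar>r - r'\<bar> / r0\<^sup>2)"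
    using inverse_diff_le[OF r0_pos assms(1,2)] abs_square_le_1[of "sin \<theta>"] by (intro mult_mono) auto
  finally have "\<bar>Nm \<theta> r l - Nm \<theta> r' l'\<bar> \<le> 2 * exp M * kap \<theta> * \<bar>l - l'\<bar> + 4 / r0\<^sup>2 * \<bar>r - r'\<bar>"
    by (simp add: mult_ac)
  also have "\<dots> \<le> (2 * exp M * (1 + kap \<theta>) + 4 / r0\<^sup>2 * (1 + kap \<theta>)) * \<bar>l - l'\<bar> +
      (2 * exp M * (1 + kap \<theta>) + 4 / r0\<^sup>2 * (1 + kap \<theta>)) * \<bar>r - r'\<bar>"
    using kap_nonneg[of \<theta>] by (intro add_mono mult_right_mono) (auto simp: distrib_left add_divide_distrib)
  finally show ?thesis by (simp add: algebra_simps add_divide_distrib)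
qed

lemma dl_bound:
  assumes "r \<ge> r0" "l \<le> M"
  shows "\<bar>dl \<theta> r l\<bar> \<le> (8 / \<Omega>) * (2 * exp M + 2 * m + 4 / r0) * (1 + kap \<theta>)"
proof -
  have "\<bar>dl \<theta> r l\<bar> = (1 - p) * \<bar>Nm \<theta> r l\<bar> * (1 / Dn \<theta> r l)"
    using p_small Dn_pos[of \<theta> r l] by (simp add: dl_def abs_mult)
  also have "\<dots> \<le> 1 * ((2 * exp M + 2 * m + 4 / r0) * (1 + kap \<theta>)) * (8 / \<Omega>)"
  proof (intro mult_mono)
    have "1 / Dn \<theta> r l \<le> 1 / (\<Omega> / 8)" using Dn_ge Om_pos by (intro divide_left_mono) (auto simp: Dn_pos)
    then show "1 / Dn \<theta> r l \<le> 8 / \<Omega>" by simp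
    show "0 \<le> 1 / Dn \<theta> r l" using Dn_pos[of \<theta> r l] by simp
    show "0 \<le> 1 * ((2 * exp M + 2 * m + 4 / r0) * (1 + kap \<theta>))"
      using Nm_bound[OF assms, of \<theta>] by simp
  qed (use p_small p_pos Nm_bound[OF assms] in auto)
  finally show ?thesis by (simp add: mult_ac)
qed

lemma dl_lipschitz:
  assumes "r \<ge> r0" "r' \<ge> r0" "l \<le> M" "l' \<le> M"
  shows "\<bar>dl \<theta> r l - dl \<theta> r' l'\<bar> \<le>
    ((8 / \<Omega>) * (2 * exp M + 4 / r0\<^sup>2) + (2 * exp M + 2 * m + 4 / r0) * ((8 / \<Omega>)\<^sup>2 * (exp M + 1 / r0\<^sup>2)))
      * (1 + kap \<theta>) * (\<bar>r - r'\<bar> + \<bar>l - l'\<bar>)" (is "_ \<le> (?a + ?b * ?c) * _ * ?d")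
proof -
  have "dl \<theta> r l - dl \<theta> r' l' =
      (1 - p) * ((Nm \<theta> r l - Nm \<theta> r' l') * (1 / Dn \<theta> r l) + Nm \<theta> r' l' * (1 / Dn \<theta> r l - 1 / Dn \<theta> r' l'))"
    by (simp add: dl_def algebra_simps)
  then have "\<bar>dl \<theta> r l - dl \<theta> r' l'\<bar> =
      (1 - p) * \<bar>(Nm \<theta> r l - Nm \<theta> r' l') * (1 / Dn \<theta> r l) + Nm \<theta> r' l' * (1 / Dn \<theta> r l - 1 / Dn \<theta> r' l')\<bar>"
    using p_small by (simp add: abs_mult)
  also have "\<dots> \<le> 1 * \<bar>(Nm \<theta> r l - Nm \<theta> r' l') * (1 / Dn \<theta> r l) + Nm \<theta> r' l' * (1 / Dn \<theta> r l - 1 / Dn \<theta> r' l')\<bar>"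
    using p_pos by (intro mult_right_mono) auto
  also have "\<dots> \<le> \<bar>Nm \<theta> r l - Nm \<theta> r' l'\<bar> * \<bar>1 / Dn \<theta> r l\<bar> + \<bar>Nm \<theta> r' l'\<bar> * \<bar>1 / Dn \<theta> r l - 1 / Dn \<theta> r' l'\<bar>"
    unfolding abs_mult[symmetric] mult_1 by (rule abs_triangle_ineq)
  also have "\<dots> \<le> ((2 * exp M + 4 / r0\<^sup>2) * (1 + kap \<theta>) * ?d) * (8 / \<Omega>) + (?b * (1 + kap \<theta>)) * (?c * ?d)"
  proof (intro add_mono mult_mono)
    have "1 / Dn \<theta> r l \<le> 1 / (\<Omega> / 8)" using Dn_ge Om_pos by (intro divide_left_mono) (auto simp: Dn_pos)
    then show "\<bar>1 / Dn \<theta> r l\<bar> \<le> 8 / \<Omega>" using Dn_pos[of \<theta> r l] by simp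
    show "0 \<le> ?b * (1 + kap \<theta>)" using Nm_bound[OF assms(1,3), of \<theta>] by simp
    show "0 \<le> (2 * exp M + 4 / r0\<^sup>2) * (1 + kap \<theta>) * ?d"
      using kap_nonneg[of \<theta>] by simp
    show "\<bar>Nm \<theta> r l - Nm \<theta> r' l'\<bar> \<le> (2 * exp M + 4 / r0\<^sup>2) * (1 + kap \<theta>) * ?d"
      by (rule Nm_lipschitz[OF assms])
    show "\<bar>Nm \<theta> r' l'\<bar> \<le> ?b * (1 + kap \<theta>)" by (rule Nm_bound[OF assms(2,4)])
    show "\<bar>1 / Dn \<theta> r l - 1 / Dn \<theta> r' l'\<bar> \<le> ?c * ?d" by (rule inverse_Dn_lipschitz[OF assms])
  qed auto
  also have "\<dots> = (?a + ?b * ?c) * (1 + kap \<theta>) * ?d"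
  proof -
    have "x * k * d * w + b * k * (c * d) = (w * x + b * c) * k * d" for x k d w b c :: real
      by (simp add: algebra_simps)
    then show ?thesis .
  qed
  finally show ?thesis .
qed

lemma rhs_weight:
  obtains Z K k where "finite Z" "continuous_on UNIV K"
    "\<And>s. s \<in> {0..T} \<Longrightarrow> cos (2 * s) = 0 \<longleftrightarrow> s \<in> Z"
    "\<And>s. s \<in> {0..T} - Z \<Longrightarrow> (K has_real_derivative k s) (at s)"
    "\<And>s y. s \<in> {0..T} - Z \<Longrightarrow> norm (rhs M s y) \<le> k s"
    "\<And>s y z. s \<in> {0..T} - Z \<Longrightarrow> norm (rhs M s y - rhs M s z) \<le> k s * norm (y - z)"
proof -
  define C1 where "C1 = 8 / \<Omega> + (8 / \<Omega>) * (2 * exp M + 2 * m + 4 / r0)"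
  define C2 where "C2 = (8 / \<Omega>)\<^sup>2 * (exp M + 1 / r0\<^sup>2)"
  define C3 where "C3 = (8 / \<Omega>) * (2 * exp M + 4 / r0\<^sup>2) + (2 * exp M + 2 * m + 4 / r0) * ((8 / \<Omega>)\<^sup>2 * (exp M + 1 / r0\<^sup>2))"
  \<comment> \<open>\<open>C1\<close> bounds the right-hand side and \<open>C2 + C3\<close> is its
    Lipschitz constant for the sum of the two coordinate distances; the factor 2 passes from this
    sum to the Euclidean norm.\<close>
  define C where "C = C1 + 2 * (C2 + C3)"
  have C: "C1 \<ge> 0" "C2 \<ge> 0" "C3 \<ge> 0"
    using Om_pos r0_pos m_pos unfolding C1_def C2_def C3_def by auto
  then have "C \<ge> 0" by (simp add: C_def)
  then obtain Z K k where *: "finite Z" "continuous_on UNIV K"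
    "\<And>s. s \<in> {0..T} \<Longrightarrow> cos (2 * s) = 0 \<longleftrightarrow> s \<in> Z"
    "\<And>s. s \<in> {0..T} - Z \<Longrightarrow> (K has_real_derivative k s) (at s)"
    "\<And>s. s \<in> {0..T} - Z \<Longrightarrow> C * (1 + kap s) \<le> k s"
    using weight_exists[of C T] by metis
  show thesis
  proof (rule that[OF *(1-4)])
    fix s y assume s: "s \<in> {0..T} - Z"
    let ?r = "max r0 (fst y)" and ?l = "min M (snd y)"
    have "norm (rhs M s y) \<le> \<bar>1 / Dn s ?r ?l\<bar> + \<bar>dl s ?r ?l\<bar>"
      unfolding rhs_def using norm_Pair_le[of "1 / Dn s ?r ?l" "dl s ?r ?l"] by simp
    also have "\<bar>1 / Dn s ?r ?l\<bar> \<le> 1 / (\<Omega> / 8)"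
      unfolding abs_of_pos[OF divide_pos_pos[OF zero_less_one Dn_pos]]
      using Om_pos by (intro divide_left_mono Dn_ge mult_pos_pos Dn_pos) auto
    also have "1 / (\<Omega> / 8) \<le> (8 / \<Omega>) * (1 + kap s)"
      using kap_nonneg[of s] Om_pos by (simp add: field_simps)
    also have "\<bar>dl s ?r ?l\<bar> \<le> (8 / \<Omega>) * (2 * exp M + 2 * m + 4 / r0) * (1 + kap s)"
      by (rule dl_bound) auto
    finally have "norm (rhs M s y) \<le> C1 * (1 + kap s)"
      by (simp add: C1_def algebra_simps)
    also have "\<dots> \<le> C * (1 + kap s)"
      using C kap_nonneg[of s] by (intro mult_right_mono) (auto simp: C_def)
    also have "\<dots> \<le> k s" by (rule *(5)[OF s])
    finally show "norm (rhs M s y) \<le> k s" .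
  next
    fix s and y z :: "real \<times> real" assume s: "s \<in> {0..T} - Z"
    let ?r = "max r0 (fst y)" and ?l = "min M (snd y)"
    let ?r' = "max r0 (fst z)" and ?l' = "min M (snd z)"
    let ?d = "\<bar>?r - ?r'\<bar> + \<bar>?l - ?l'\<bar>"
    have "norm (rhs M s y - rhs M s z) \<le> \<bar>1 / Dn s ?r ?l - 1 / Dn s ?r' ?l'\<bar> + \<bar>dl s ?r ?l - dl s ?r' ?l'\<bar>"
      unfolding rhs_def using norm_Pair_le[of "1 / Dn s ?r ?l - 1 / Dn s ?r' ?l'" "dl s ?r ?l - dl s ?r' ?l'"] by simp
    also have "\<bar>1 / Dn s ?r ?l - 1 / Dn s ?r' ?l'\<bar> \<le> C2 * ?d"
      unfolding C2_def by (rule inverse_Dn_lipschitz) auto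
    also have "\<bar>dl s ?r ?l - dl s ?r' ?l'\<bar> \<le> C3 * (1 + kap s) * ?d"
      unfolding C3_def by (rule dl_lipschitz) auto
    also have "C2 * ?d + C3 * (1 + kap s) * ?d \<le> (C2 + C3) * (1 + kap s) * ?d"
      using C kap_nonneg[of s] by (simp add: algebra_simps)
    also have "\<dots> \<le> (C2 + C3) * (1 + kap s) * (2 * norm (y - z))"
    proof (rule mult_left_mono)
      have "?d \<le> \<bar>fst (y - z)\<bar> + \<bar>snd (y - z)\<bar>"
        unfolding fst_diff snd_diff by linarith
      also have "\<dots> \<le> 2 * norm (y - z)"
        using norm_fst_le[of "fst (y - z)" "snd (y - z)"] norm_snd_le[of "snd (y - z)" "fst (y - z)"]
          by (simp del: fst_diff snd_diff)
      finally show "?d \<le> 2 * norm (y - z)" .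
    qed (use C kap_nonneg[of s] in simp)
    also have "\<dots> = (2 * (C2 + C3)) * (1 + kap s) * norm (y - z)" by simp
    also have "\<dots> \<le> C * (1 + kap s) * norm (y - z)"
      using C kap_nonneg[of s] by (intro mult_right_mono) (auto simp: C_def)
    also have "\<dots> \<le> k s * norm (y - z)" by (intro mult_right_mono *(5)[OF s]) auto
    finally show "norm (rhs M s y - rhs M s z) \<le> k s * norm (y - z)" by simp
  qed
qed

lemma continuous_on_rhs:
  assumes "\<And>s. s \<in> S \<Longrightarrow> cos (2 * s) \<noteq> 0"
  shows "continuous_on (S \<times> UNIV) (\<lambda>(s, y). rhs M s y)"
proof -
  have [simp]: "max r0 x \<noteq> 0" for x using r0_pos by (simp add: max_def)
  have "continuous_on (S \<times> UNIV) (\<lambda>z. rhs M (fst z) (snd z))"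
    unfolding rhs_def dl_def Nm_def Dn_def
    by (intro continuous_intros) (use assms Om_pos in auto)
  then show ?thesis by (simp add: case_prod_beta')
qed

text \<open>With \<open>P = exp (- l / (1 - p))\<close>, the energy is \<open>P * bb \<theta> l = en \<theta> l\<close>.\<close>

definition bb :: "real \<Rightarrow> real \<Rightarrow> real" where
  "bb \<theta> l = \<Omega> - m * cos (2 * \<theta>) - exp l * gam \<theta>"

definition en :: "real \<Rightarrow> real \<Rightarrow> real" where
  "en \<theta> l = exp (- l / (1 - p)) * bb \<theta> l"

text \<open>The last condition says that sin (2 t0) / r0 starts strictly below
  \<open>3 / 4 * \<Omega>\<close>, which \<open>sol_barrier\<close> propagates. The bound pi/8 puts
  the start before the first diagonal and before the windows in which energy loss is
  measured.\<close>

definition adm :: "real \<Rightarrow> bool" where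
  "adm t0 \<longleftrightarrow> 0 < t0 \<and> t0 < pi / 8 \<and> 4 / (3 * \<Omega>) * sin (2 * t0) < r0"

text \<open>Positive energy on the closed interval is part of the notion. A start with nonpositive
  energy therefore has no solution at all, and running out of energy and blow-up of \<open>l\<close>
  count alike as the end of a solution.\<close>

definition sol :: "real \<Rightarrow> real \<Rightarrow> real \<Rightarrow> (real \<Rightarrow> real) \<Rightarrow> (real \<Rightarrow> real) \<Rightarrow> bool" where
  "sol t0 l0 T r l \<longleftrightarrow> t0 \<le> T \<and> continuous_on {t0..T} r \<and> continuous_on {t0..T} l \<and>
     r t0 = r0 \<and> l t0 = l0 \<and>
     (\<forall>s\<in>{t0<..<T}. cos (2 * s) \<noteq> 0 \<longrightarrow>
        (r has_real_derivative 1 / Dn s (r s) (l s)) (at s) \<and>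
        (l has_real_derivative dl s (r s) (l s)) (at s)) \<and>
     (\<forall>s\<in>{t0..T}. bb s (l s) > 0)"

text \<open>Solutions of the globally Lipschitz system obtained by capping \<open>l\<close> at \<open>M\<close>.\<close>

definition trunc_sol :: "real \<Rightarrow> real \<Rightarrow> real \<Rightarrow> real \<Rightarrow> (real \<Rightarrow> real \<times> real) \<Rightarrow> bool" where
  "trunc_sol t0 l0 T M y \<longleftrightarrow> t0 \<le> T \<and> continuous_on {t0..T} y \<and> y t0 = (r0, l0) \<and>
     (\<forall>s\<in>{t0<..<T}. cos (2 * s) \<noteq> 0 \<longrightarrow> (y has_vector_derivative rhs M s (y s)) (at s))"

lemma continuous_on_bb [continuous_intros]:
  fixes f g :: "'a::t2_space \<Rightarrow> real"
  assumes "continuous_on S f" "continuous_on S g"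
  shows "continuous_on S (\<lambda>x. bb (f x) (g x))"
  unfolding bb_def by (intro continuous_intros assms)

lemma continuous_on_en [continuous_intros]:
  fixes f g :: "'a::t2_space \<Rightarrow> real"
  assumes "continuous_on S f" "continuous_on S g"
  shows "continuous_on S (\<lambda>x. en (f x) (g x))"
  unfolding en_def by (intro continuous_intros assms) (use p_small in auto)

lemma trunc_sol_exists:
  assumes "0 \<le> t0" "t0 \<le> T"
  obtains y where "trunc_sol t0 l0 T M y"
proof -
  obtain Z K k where *: "finite Z" "continuous_on UNIV K"
    "\<And>s. s \<in> {0..T} \<Longrightarrow> cos (2 * s) = 0 \<longleftrightarrow> s \<in> Z"
    "\<And>s. s \<in> {0..T} - Z \<Longrightarrow> (K has_real_derivative k s) (at s)"
    "\<And>s y. s \<in> {0..T} - Z \<Longrightarrow> norm (rhs M s y) \<le> k s"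
    "\<And>s y z. s \<in> {0..T} - Z \<Longrightarrow> norm (rhs M s y - rhs M s z) \<le> k s * norm (y - z)"
    using rhs_weight[of T M] by metis
  have sub: "s \<in> {0..T} - Z" if "s \<in> {t0<..<T} - Z" for s using that assms by auto
  obtain y where "continuous_on {t0..T} y" "y t0 = (r0, l0)"
    "\<And>s. s \<in> {t0<..<T} - Z \<Longrightarrow> (y has_vector_derivative rhs M s (y s)) (at s)"
  proof (rule caratheodory_solution[of Z t0 T K k "rhs M" "(r0, l0)"])
    show "continuous_on (({t0<..<T} - Z) \<times> UNIV) (\<lambda>(s, y). rhs M s y)"
      by (rule continuous_on_rhs) (use *(3) sub in blast)
  qed (use * sub assms continuous_on_subset in blast)+
  then show thesis
    by (intro that[of y]) (use assms *(3) in \<open>auto simp: trunc_sol_def\<close>)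
qed

text \<open>\<open>K\<close> depends on \<open>T\<close> and \<open>M\<close> but not on the initial
  data. This uniformity is what allows comparing solutions that start at different angles.\<close>

lemma trunc_sol_compare:
  assumes "0 < T"
  obtains K where "continuous_on UNIV K" "\<And>s t. 0 \<le> s \<Longrightarrow> s \<le> t \<Longrightarrow> t \<le> T \<Longrightarrow> K s \<le> K t"
    "\<And>t0 l0 y s t. trunc_sol t0 l0 T M y \<Longrightarrow> 0 \<le> t0 \<Longrightarrow> t0 \<le> s \<Longrightarrow> s \<le> t \<Longrightarrow> t \<le> T \<Longrightarrow>
       norm (y t - y s) \<le> K t - K s"
    "\<And>t0 l0 y t0' l0' z s t. trunc_sol t0 l0 T M y \<Longrightarrow> trunc_sol t0' l0' T M z \<Longrightarrow> 0 \<le> t0 \<Longrightarrow> 0 \<le> t0' \<Longrightarrow>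
       t0 \<le> s \<Longrightarrow> t0' \<le> s \<Longrightarrow> s \<le> t \<Longrightarrow> t \<le> T \<Longrightarrow>
       norm (y t - z t) \<le> norm (y s - z s) * exp (K t - K s)"
proof -
  obtain Z K k where *: "finite Z" "continuous_on UNIV K"
    "\<And>s. s \<in> {0..T} \<Longrightarrow> cos (2 * s) = 0 \<longleftrightarrow> s \<in> Z"
    "\<And>s. s \<in> {0..T} - Z \<Longrightarrow> (K has_real_derivative k s) (at s)"
    "\<And>s y. s \<in> {0..T} - Z \<Longrightarrow> norm (rhs M s y) \<le> k s"
    "\<And>s y z. s \<in> {0..T} - Z \<Longrightarrow> norm (rhs M s y - rhs M s z) \<le> k s * norm (y - z)"
    using rhs_weight[of T M] by metis
  show thesis
  proof (rule that[of K])
    show "continuous_on UNIV K" by fact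
    show "K s \<le> K t" if st: "0 \<le> s" "s \<le> t" "t \<le> T" for s t
    proof -
      have "norm ((0 :: real) - 0) \<le> K t - K s"
      proof (rule variation_bound[OF *(1) st(2), of K k "\<lambda>_. 0 :: real" "\<lambda>_. 0"])
        show "norm (0 :: real) \<le> k u" if "u \<in> {s<..<t} - Z" for u
        proof -
          have "u \<in> {0..T} - Z" using that st by auto
          from order_trans[OF norm_ge_zero *(5)[OF this, of 0]] show ?thesis by simp
        qed
        show "continuous_on {s..t} K" using *(2) continuous_on_subset by blast
        show "(K has_real_derivative k u) (at u)" if "u \<in> {s<..<t} - Z" for u
          by (rule *(4)) (use that st in auto)
      qed auto
      then show ?thesis by simp
    qed
    show "norm (y t - y s) \<le> K t - K s"
      if y: "trunc_sol t0 l0 T M y" and st: "0 \<le> t0" "t0 \<le> s" "s \<le> t" "t \<le> T" for t0 l0 y s t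
    proof (rule variation_bound[OF *(1) st(3), of K k y "\<lambda>s. rhs M s (y s)"])
      show "continuous_on {s..t} K" using *(2) continuous_on_subset by blast
      show "continuous_on {s..t} y"
        using y st unfolding trunc_sol_def by (elim conjE) (erule continuous_on_subset, auto)
      fix u assume u: "u \<in> {s<..<t} - Z"
      then have u': "u \<in> {0..T} - Z" using st by auto
      show "(K has_real_derivative k u) (at u)" by (rule *(4)[OF u'])
      show "norm (rhs M u (y u)) \<le> k u" by (rule *(5)[OF u'])
      have "u \<in> {t0<..<T}" "cos (2 * u) \<noteq> 0" using u st *(3)[of u] u' by auto
      then show "(y has_vector_derivative rhs M u (y u)) (at u)"
        using y unfolding trunc_sol_def by blast
    qed
    show "norm (y t - z t) \<le> norm (y s - z s) * exp (K t - K s)"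
      if y: "trunc_sol t0 l0 T M y" and z: "trunc_sol t0' l0' T M z"
        and st: "0 \<le> t0" "0 \<le> t0'" "t0 \<le> s" "t0' \<le> s" "s \<le> t" "t \<le> T" for t0 l0 y t0' l0' z s t
    proof (rule gronwall_lipschitz[OF *(1) st(5), of K k y z "rhs M"])
      show "continuous_on {s..t} K" using *(2) continuous_on_subset by blast
      show "continuous_on {s..t} y"
        using y st unfolding trunc_sol_def by (elim conjE) (erule continuous_on_subset, auto)
      show "continuous_on {s..t} z"
        using z st unfolding trunc_sol_def by (elim conjE) (erule continuous_on_subset, auto)
      fix u assume u: "u \<in> {s<..<t} - Z"
      then have u': "u \<in> {0..T} - Z" using st by auto
      show "(K has_real_derivative k u) (at u)" by (rule *(4)[OF u'])
      show "norm (rhs M u y - rhs M u z) \<le> k u * norm (y - z)" for y z by (rule *(6)[OF u'])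
      have "u \<in> {t0<..<T}" "u \<in> {t0'<..<T}" "cos (2 * u) \<noteq> 0" using u st *(3)[of u] u' by auto
      then show "(y has_vector_derivative rhs M u (y u)) (at u)" "(z has_vector_derivative rhs M u (z u)) (at u)"
        using y z unfolding trunc_sol_def by blast+
    qed
  qed
qed

lemma trunc_sol_restrict:
  assumes "trunc_sol t0 l0 T M y" "t0 \<le> T'" "T' \<le> T"
  shows "trunc_sol t0 l0 T' M y"
  using assms unfolding trunc_sol_def by (auto intro: continuous_on_subset)

lemma trunc_sol_unique:
  assumes y: "trunc_sol t0 l0 T M y" and z: "trunc_sol t0 l0 T M z" and t: "0 < t0" "t \<in> {t0..T}"
  shows "y t = z t"
proof -
  have "0 < T" using t by auto
  then obtain K where "norm (y t - z t) \<le> norm (y t0 - z t0) * exp (K t - K t0)"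
    using trunc_sol_compare[of T M thesis] y z t by (metis atLeastAtMost_iff less_imp_le order_refl)
  moreover have "y t0 = z t0" using y z by (simp add: trunc_sol_def)
  ultimately show ?thesis by simp
qed

text \<open>The angular speed is positive by truncation, so the radius increases and its truncation
  at \<open>r0\<close> never acts. Below its cap, a truncated solution with positive energy is thus
  a solution in the sense of \<open>sol\<close>.\<close>

lemma trunc_sol_fst_ge:
  assumes y: "trunc_sol t0 l0 T M y" and "0 \<le> t0" and t: "t \<in> {t0..T}"
  shows "fst (y t) \<ge> r0"
proof -
  have "fst (y t0) + 0 * (t - t0) \<le> fst (y t)"
  proof (rule monotone_with_slope)
    show "continuous_on {t0..t} (\<lambda>s. fst (y s))"
      using y t unfolding trunc_sol_def by (intro continuous_intros) (auto intro: continuous_on_subset)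
    fix s assume s: "s \<in> {t0<..<t}" "cos (2 * s) \<noteq> 0"
    then have "(y has_vector_derivative rhs M s (y s)) (at s)"
      using y t unfolding trunc_sol_def by auto
    then show "((\<lambda>s. fst (y s)) has_real_derivative fst (rhs M s (y s))) (at s)"
      unfolding has_real_derivative_iff_has_vector_derivative
      by (rule bounded_linear.has_vector_derivative[OF bounded_linear_fst])
    show "0 \<le> fst (rhs M s (y s))" using Dn_pos by (simp add: rhs_def less_imp_le)
  qed (use assms in auto)
  then show ?thesis using y by (simp add: trunc_sol_def)
qed

lemma trunc_sol_imp_sol:
  assumes y: "trunc_sol t0 l0 T M y" and t0: "0 \<le> t0"
    and M: "\<And>s. s \<in> {t0..T} \<Longrightarrow> snd (y s) \<le> M"
    and pos: "\<And>s. s \<in> {t0..T} \<Longrightarrow> bb s (snd (y s)) > 0"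
  shows "sol t0 l0 T (\<lambda>s. fst (y s)) (\<lambda>s. snd (y s))"
  unfolding sol_def
proof (intro conjI ballI impI)
  show "t0 \<le> T" "fst (y t0) = r0" "snd (y t0) = l0" using y by (simp_all add: trunc_sol_def)
  show "continuous_on {t0..T} (\<lambda>s. fst (y s))" "continuous_on {t0..T} (\<lambda>s. snd (y s))"
    using y unfolding trunc_sol_def by (intro continuous_intros; simp)+
  fix s assume s: "s \<in> {t0<..<T}" "cos (2 * s) \<noteq> 0"
  then have *: "(y has_vector_derivative rhs M s (y s)) (at s)"
    using y unfolding trunc_sol_def by auto
  have "max r0 (fst (y s)) = fst (y s)" "min M (snd (y s)) = snd (y s)"
    using trunc_sol_fst_ge[OF y t0, of s] M[of s] s by auto
  then have r: "rhs M s (y s) = (1 / Dn s (fst (y s)) (snd (y s)), dl s (fst (y s)) (snd (y s)))"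
    by (simp add: rhs_def)
  show "((\<lambda>s. fst (y s)) has_real_derivative 1 / Dn s (fst (y s)) (snd (y s))) (at s)"
    using bounded_linear.has_vector_derivative[OF bounded_linear_fst *]
    unfolding has_real_derivative_iff_has_vector_derivative r by simp
  show "((\<lambda>s. snd (y s)) has_real_derivative dl s (fst (y s)) (snd (y s))) (at s)"
    using bounded_linear.has_vector_derivative[OF bounded_linear_snd *]
    unfolding has_real_derivative_iff_has_vector_derivative r by simp
qed (use pos in auto)

lemma sol_r_growth:
  assumes s: "sol t0 l0 T r l" "0 \<le> t0" "t0 \<le> a" "a \<le> b" "b \<le> T"
  shows "r a \<le> r b" "r b \<le> r a + 8 / \<Omega> * (b - a)"
proof -
  have c: "continuous_on {a..b} r"
    using s unfolding sol_def by (elim conjE) (erule continuous_on_subset, auto)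
  have d: "(r has_real_derivative 1 / Dn u (r u) (l u)) (at u)" if "u \<in> {a<..<b}" "cos (2 * u) \<noteq> 0" for u
    using s that unfolding sol_def by auto
  show "r a \<le> r b"
    using monotone_with_slope[OF _ s(4) c d, of 0] s(2,3) Dn_pos by (simp add: less_imp_le)
  have "1 / Dn u (r u) (l u) \<le> 1 / (\<Omega> / 8)" for u
    using Om_pos by (intro divide_left_mono Dn_ge mult_pos_pos Dn_pos) auto
  then show "r b \<le> r a + 8 / \<Omega> * (b - a)"
    using monotone_with_slope_upper[OF _ s(4) c d, of "8 / \<Omega>"] s(2,3) by simp
qed

lemma sol_r_ge:
  assumes "sol t0 l0 T r l" "0 \<le> t0" "t \<in> {t0..T}"
  shows "r t \<ge> r0"
  using sol_r_growth(1)[of t0 l0 T r l t0 t] assms by (auto simp: sol_def)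

lemma sol_r_pos:
  assumes "sol t0 l0 T r l" "0 \<le> t0" "t \<in> {t0..T}"
  shows "r t > 0"
  using sol_r_ge[OF assms] r0_pos by linarith

lemma sol_imp_trunc_sol:
  assumes s: "sol t0 l0 T r l" and t0: "0 \<le> t0" and M: "\<And>t. t \<in> {t0..T} \<Longrightarrow> l t \<le> M"
  shows "trunc_sol t0 l0 T M (\<lambda>t. (r t, l t))"
  unfolding trunc_sol_def
proof (intro conjI ballI impI)
  show "t0 \<le> T" "(r t0, l t0) = (r0, l0)" using s by (simp_all add: sol_def)
  show "continuous_on {t0..T} (\<lambda>t. (r t, l t))"
    using s unfolding sol_def by (intro continuous_intros; simp)
  fix t assume t: "t \<in> {t0<..<T}" "cos (2 * t) \<noteq> 0"
  have "rhs M t (r t, l t) = (1 / Dn t (r t) (l t), dl t (r t) (l t))"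
    using M[of t] sol_r_ge[OF s t0, of t] t by (simp add: rhs_def max_absorb2 min_absorb2)
  then show "((\<lambda>t. (r t, l t)) has_vector_derivative rhs M t (r t, l t)) (at t)"
    using s t unfolding sol_def has_real_derivative_iff_has_vector_derivative
    by (auto intro!: has_vector_derivative_Pair)
qed

lemma sol_l_bounded:
  assumes "sol t0 l0 T r l"
  obtains M where "\<And>t. t \<in> {t0..T} \<Longrightarrow> l t \<le> M"
  using continuous_on_Icc_upper_bound[of t0 T l] assms unfolding sol_def by blast

lemma sol_restrict:
  assumes "sol t0 l0 T r l" "t0 \<le> T'" "T' \<le> T"
  shows "sol t0 l0 T' r l"
  using assms unfolding sol_def by (auto intro: continuous_on_subset)

lemma sol_unique:
  assumes s: "sol t0 l0 T r l" and s': "sol t0 l0 T r' l'" and t: "0 < t0" "t \<in> {t0..T}"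
  shows "r t = r' t" "l t = l' t"
proof -
  obtain M where M: "\<And>t. t \<in> {t0..T} \<Longrightarrow> l t \<le> M" using sol_l_bounded[OF s] by blast
  obtain M' where M': "\<And>t. t \<in> {t0..T} \<Longrightarrow> l' t \<le> M'" using sol_l_bounded[OF s'] by blast
  have "trunc_sol t0 l0 T (max M M') (\<lambda>t. (r t, l t))" "trunc_sol t0 l0 T (max M M') (\<lambda>t. (r' t, l' t))"
    using s s' t M M' by (auto intro!: sol_imp_trunc_sol simp: le_max_iff_disj)
  from trunc_sol_unique[OF this t] show "r t = r' t" "l t = l' t" by auto
qed

lemma sol_cong:
  assumes s: "sol t0 l0 T r l" and eq: "\<And>t. t \<in> {t0..T} \<Longrightarrow> r' t = r t \<and> l' t = l t"
  shows "sol t0 l0 T r' l'"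
  unfolding sol_def
proof (intro conjI ballI impI)
  show "t0 \<le> T" "r' t0 = r0" "l' t0 = l0" using s eq[of t0] by (auto simp: sol_def)
  show "continuous_on {t0..T} r'" "continuous_on {t0..T} l'"
    using s eq unfolding sol_def by (metis continuous_on_cong)+
  show "0 < bb t (l' t)" if "t \<in> {t0..T}" for t using s eq[OF that] that by (auto simp: sol_def)
  fix t assume t: "t \<in> {t0<..<T}" "cos (2 * t) \<noteq> 0"
  have d: "(r has_real_derivative 1 / Dn t (r t) (l t)) (at t)" "(l has_real_derivative dl t (r t) (l t)) (at t)"
    using s t unfolding sol_def by auto
  have e: "r' t = r t" "l' t = l t" using eq[of t] t by auto
  show "(r' has_real_derivative 1 / Dn t (r' t) (l' t)) (at t)"
    unfolding e by (rule has_field_derivative_transform_within_open[OF d(1), of "{t0<..<T}"]) (use t eq in auto)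
  show "(l' has_real_derivative dl t (r' t) (l' t)) (at t)"
    unfolding e by (rule has_field_derivative_transform_within_open[OF d(2), of "{t0<..<T}"]) (use t eq in auto)
qed

subsection \<open>Monotonicity of the angle and dissipation of the energy\<close>

text \<open>Keeps \<open>D\<close> away from \<open>0\<close>: where \<open>sin (2 \<theta>) / r\<close> attains the bound, \<open>D \<le> \<Omega> / 4\<close>, so \<open>r\<close> grows too fast for it to be exceeded.\<close>

lemma sol_barrier:
  assumes s: "sol t0 l0 T r l" and adm: "adm t0" and t: "t \<in> {t0..T}"
  shows "sin (2 * t) / r t \<le> 3 / 4 * \<Omega>"
proof -
  have t0: "0 < t0" "t0 < pi / 8" "4 / (3 * \<Omega>) * sin (2 * t0) < r0"
    using adm by (auto simp: adm_def)
  \<comment> \<open>The bound to be proved, multiplied by the radius: it reads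
    \<open>\<phi> t \<le> 0\<close>.\<close>
  define \<phi> where "\<phi> t = 4 / (3 * \<Omega>) * sin (2 * t) - r t" for t
  have le: "\<phi> t \<le> 0" if t: "t \<in> {t0..min T (pi / 4)}" for t
  proof (rule barrier_nonpos[of t0 "min T (pi / 4)" \<phi>, OF _ _ _ t])
    show "continuous_on {t0..min T (pi / 4)} \<phi>"
      using s unfolding \<phi>_def sol_def
      by (intro continuous_intros) (auto intro: continuous_on_subset)
    show "\<phi> t0 < 0" using s t0 by (simp add: \<phi>_def sol_def)
    fix u assume u: "u \<in> {t0<..<min T (pi / 4)}" and z: "\<phi> u = 0"
    have c: "cos (2 * u) > 0" using u t0 by (intro cos_gt_zero) auto
    have ru: "r u > 0" using sol_r_pos[OF s, of u] u t0 by auto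
    have beta: "sin (2 * u) / r u = 3 / 4 * \<Omega>"
      using z ru Om_pos by (simp add: \<phi>_def field_simps)
    have "gam u \<ge> 0" unfolding gam_def using c by (intro spow_nonneg) auto
    then have "p * exp (l u) * gam u \<ge> 0" "m * cos (2 * u) \<ge> 0" using p_pos m_pos c by simp_all
    then have "Dn u (r u) (l u) \<le> \<Omega> / 4"
      unfolding Dn_def beta using Om_pos by linarith
    then have "1 / (\<Omega> / 4) \<le> 1 / Dn u (r u) (l u)"
      using Om_pos by (intro divide_left_mono mult_pos_pos Dn_pos) auto
    \<comment> \<open>At contact the radius grows at rate at least \<open>4 / \<Omega>\<close>,
      while the sine term grows at rate at most \<open>8 / (3 * \<Omega>)\<close>.\<close>
    moreover have "4 / (3 * \<Omega>) * (cos (2 * u) * 2) \<le> 4 / (3 * \<Omega>) * (1 * 2)"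
      using Om_pos by (intro mult_left_mono mult_right_mono) auto
    moreover have "4 / (3 * \<Omega>) * (1 * 2) < 1 / (\<Omega> / 4)" using Om_pos by (simp add: field_simps)
    ultimately have neg: "4 / (3 * \<Omega>) * (cos (2 * u) * 2) - 1 / Dn u (r u) (l u) < 0" by linarith
    have "(r has_real_derivative 1 / Dn u (r u) (l u)) (at u)"
      using s u c unfolding sol_def by auto
    then have "(\<phi> has_real_derivative 4 / (3 * \<Omega>) * (cos (2 * u) * 2) - 1 / Dn u (r u) (l u)) (at u)"
      unfolding \<phi>_def using Om_pos by (auto intro!: derivative_eq_intros)
    with neg show "\<exists>d<0. (\<phi> has_real_derivative d) (at u)" by blast
  qed
  show ?thesis
  proof (cases "t \<le> pi / 4")
    case True
    then have "\<phi> t \<le> 0" using t by (intro le) auto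
    moreover have "r t > 0" using sol_r_pos[OF s _ t] t0 by simp
    ultimately show ?thesis using Om_pos by (simp add: \<phi>_def field_simps)
  next
    \<comment> \<open>After pi/4 the sign of the cosine is lost, but the radius has by then reached
      \<open>4 / (3 * \<Omega>)\<close> and keeps growing, so bounding the sine by 1
      suffices.\<close>
    case False
    then have "\<phi> (pi / 4) \<le> 0" using t t0 by (intro le) auto
    then have "4 / (3 * \<Omega>) \<le> r (pi / 4)" by (simp add: \<phi>_def)
    also have "\<dots> \<le> r t" using sol_r_growth(1)[OF s, of "pi / 4" t] t t0 False by auto
    finally have rt: "4 / (3 * \<Omega>) \<le> r t" .
    have rp: "r t > 0" using sol_r_pos[OF s _ t] t0 by simp
    have "sin (2 * t) / r t \<le> 1 / r t" using rp by (intro divide_right_mono) auto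
    also have "\<dots> \<le> 1 / (4 / (3 * \<Omega>))"
      using rt rp Om_pos by (intro divide_left_mono) auto
    finally show ?thesis by simp
  qed
qed

text \<open>Where the cosine is positive, positive energy bounds \<open>exp l * gam t\<close> by
  \<open>\<Omega> - m * cos (2 * t)\<close>, and (19/20)^2 - 3/4 exceeds 1/8. Where it is
  nonpositive the singular term has the favourable sign; the second bound retains it, since it is
  what controls the growth of \<open>l\<close> there.\<close>

lemma Dn_raw_lower:
  assumes beta: "sin (2 * t) / r \<le> 3 / 4 * \<Omega>" and pos: "bb t l > 0"
  shows "\<Omega> / 8 \<le> \<Omega> - m * cos (2 * t) - p * exp l * gam t - sin (2 * t) / r"
    and "cos (2 * t) \<le> 0 \<Longrightarrow> \<Omega> / 4 + p * exp l * \<bar>gam t\<bar> \<le> \<Omega> - m * cos (2 * t) - p * exp l * gam t - sin (2 * t) / r"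
proof -
  show 1: "\<Omega> / 4 + p * exp l * \<bar>gam t\<bar> \<le> \<Omega> - m * cos (2 * t) - p * exp l * gam t - sin (2 * t) / r"
    if c: "cos (2 * t) \<le> 0"
  proof -
    have "gam t \<le> 0" unfolding gam_def by (rule spow_nonpos[OF c])
    moreover have "m * cos (2 * t) \<le> 0" using m_pos c by (simp add: mult_nonneg_nonpos)
    ultimately show ?thesis using beta by simp
  qed
  show "\<Omega> / 8 \<le> \<Omega> - m * cos (2 * t) - p * exp l * gam t - sin (2 * t) / r"
  proof (cases "cos (2 * t) \<le> 0")
    case True
    moreover have "0 \<le> p * exp l * \<bar>gam t\<bar>" using p_pos by simp
    ultimately show ?thesis using 1 Om_pos by linarith
  next
    case False
    have mc: "m * cos (2 * t) \<le> \<Omega> / 20"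
      using mult_left_mono[OF cos_le_one[of "2 * t"], of m] m_pos Om_large by linarith
    have "p * (exp l * gam t) \<le> p * (\<Omega> - m * cos (2 * t))"
      using pos p_pos unfolding bb_def by (intro mult_left_mono) auto
    also have "\<dots> \<le> 1 / 20 * (\<Omega> - m * cos (2 * t))"
      using p_small mc Om_pos by (intro mult_right_mono) auto
    finally show ?thesis using mc beta Om_pos by simp
  qed
qed

text \<open>The floor in \<open>Dn\<close> is never active on a solution, so \<open>sol\<close>
  describes the original system and not a modified one.\<close>

lemma sol_Dn:
  assumes s: "sol t0 l0 T r l" and adm: "adm t0" and t: "t \<in> {t0..T}"
  shows "Dn t (r t) (l t) = \<Omega> - m * cos (2 * t) - p * exp (l t) * gam t - sin (2 * t) / r t"
  unfolding Dn_def
  using Dn_raw_lower(1)[OF sol_barrier[OF s adm t], of "l t"] s t by (simp add: sol_def)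

text \<open>Without the term 2 u / r the energy is conserved. With it, dE/dr = - 4 u^2 (\<Omega> + m
  + F) / r, and dividing by the angular speed gives the formula. The radial factor u^2 becomes P
  (sin \<theta>)^2.\<close>

lemma en_derivative:
  assumes s: "sol t0 l0 T r l" and adm: "adm t0" and t: "t \<in> {t0<..<T}" "cos (2 * t) \<noteq> 0"
  shows "((\<lambda>t. en t (l t)) has_real_derivative
    - (4 * exp (- l t / (1 - p)) * (sin t)\<^sup>2 / (r t * Dn t (r t) (l t)) * (\<Omega> + m + p * exp (l t) * kap t))) (at t)"
proof -
  have t': "t \<in> {t0..T}" using t by auto
  define P a D S C k R where "P = exp (- l t / (1 - p))" and "a = exp (l t)" and "D = Dn t (r t) (l t)"
    and "S = sin (2 * t)" and "C = cos (2 * t)" and "k = kap t" and "R = r t"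
  have l': "(l has_real_derivative dl t (r t) (l t)) (at t)"
    using s t unfolding sol_def by auto
  have R: "R > 0" unfolding R_def using sol_r_pos[OF s _ t'] adm by (simp add: adm_def)
  have D0: "D > 0" unfolding D_def by (rule Dn_pos)
  have D: "D = \<Omega> - m * C - p * a * (C * k) - S / R"
    unfolding D_def sol_Dn[OF s adm t'] by (simp add: a_def S_def C_def k_def R_def gam_eq)
  have lam: "dl t (r t) (l t) = (1 - p) * (Nm t (r t) (l t) / D)" by (simp add: dl_def D_def)
  define L where "L = Nm t (r t) (l t) / D"
  \<comment> \<open>This identity lets the factor (sin t)^2 be taken out of the terms that are
    quadratic in \<open>S\<close>.\<close>
  have S2: "S\<^sup>2 = 2 * (sin t)\<^sup>2 * (1 + C)"
    by (simp add: S_def C_def sin_double cos_double_cos power_mult_distrib)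
  have LD: "L * D = 2 * S * (p * a * k + m) + 4 * (sin t)\<^sup>2 / R"
    using D0 by (simp add: L_def Nm_def S_def a_def k_def R_def)
  have "((\<lambda>t. en t (l t)) has_real_derivative
      P * (- L) * (\<Omega> - m * C - a * (C * k)) + P * (2 * m * S - (a * ((1 - p) * L) * (C * k) + a * (- 2 * S * (p * k))))) (at t)"
  proof -
    have "((\<lambda>t. cos (2 * t)) has_real_derivative - 2 * S) (at t)"
      unfolding S_def by (auto intro!: derivative_eq_intros)
    note dcos = this
    have dbb: "((\<lambda>t. \<Omega> - m * cos (2 * t) - exp (l t) * gam t) has_real_derivative
        2 * m * S - (a * ((1 - p) * L) * (C * k) + a * (- 2 * S * (p * k)))) (at t)"
      by (rule DERIV_cong[OF DERIV_diff[OF DERIV_diff[OF DERIV_const DERIV_cmult[OF dcos]]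
            DERIV_mult[OF DERIV_fun_exp[OF l'] gam_has_derivative[OF t(2)]]]])
        (simp add: a_def S_def C_def k_def L_def lam gam_eq)
    have dP: "((\<lambda>t. exp (- l t / (1 - p))) has_real_derivative P * (- L)) (at t)"
      by (rule DERIV_cong[OF DERIV_fun_exp[OF DERIV_cdivide[OF DERIV_minus[OF l']]]])
        (use p_small in \<open>simp add: P_def L_def lam\<close>)
    show ?thesis
      unfolding en_def[abs_def] bb_def[abs_def]
      by (rule DERIV_cong[OF DERIV_mult[OF dP dbb]])
        (simp add: P_def a_def C_def k_def gam_eq)
  qed
  also have "P * (- L) * (\<Omega> - m * C - a * (C * k)) + P * (2 * m * S - (a * ((1 - p) * L) * (C * k) + a * (- 2 * S * (p * k))))
      = P * (2 * S * (m + p * a * k) - L * (\<Omega> - m * C - p * a * (C * k)))"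
    by (simp add: algebra_simps)
  \<comment> \<open>The conservative part of the angular speed is the full speed plus the geometric
    term; the part with \<open>D\<close> cancels the conservative terms and leaves friction
    only.\<close>
  also have "\<Omega> - m * C - p * a * (C * k) = D + S / R" using D by simp
  also have "2 * S * (m + p * a * k) - L * (D + S / R) = - (4 * (sin t)\<^sup>2 / R) - L * (S / R)"
    using LD by (simp add: algebra_simps)
  also have "L * (S / R) = (2 * S\<^sup>2 * (p * a * k + m) / R + 4 * (sin t)\<^sup>2 * S / R\<^sup>2) / D"
  proof -
    have Leq: "L = (2 * S * (p * a * k + m) + 4 * (sin t)\<^sup>2 / R) / D" using LD D0 by (simp add: field_simps)
    show ?thesis unfolding Leq using R D0 by (simp add: field_simps power2_eq_square)
  qed
  also have "P * (- (4 * (sin t)\<^sup>2 / R) - (2 * S\<^sup>2 * (p * a * k + m) / R + 4 * (sin t)\<^sup>2 * S / R\<^sup>2) / D)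
    = - (4 * P * (sin t)\<^sup>2 / (R * D) * (D + (1 + C) * (p * a * k + m) + S / R))"
    unfolding S2 using R D0 by (simp add: field_simps power2_eq_square)
  also have "D + (1 + C) * (p * a * k + m) + S / R = \<Omega> + m + p * a * k"
    using D by (simp add: algebra_simps)
  finally show ?thesis by (simp add: P_def a_def k_def R_def D_def)
qed

lemma sol_en_pos: "sol t0 l0 T r l \<Longrightarrow> t \<in> {t0..T} \<Longrightarrow> en t (l t) > 0"
  by (simp add: sol_def en_def)

lemma sol_en_mono:
  assumes s: "sol t0 l0 T r l" and adm: "adm t0" and ab: "t0 \<le> a" "a \<le> b" "b \<le> T"
  shows "en b (l b) \<le> en a (l a)"
proof -
  have t0: "0 < t0" using adm by (simp add: adm_def)
  have "en b (l b) \<le> en a (l a) + 0 * (b - a)"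
  proof (rule monotone_with_slope_upper)
    show "continuous_on {a..b} (\<lambda>t. en t (l t))"
      using s ab unfolding sol_def by (intro continuous_intros) (auto intro: continuous_on_subset)
    fix t assume t: "t \<in> {a<..<b}" "cos (2 * t) \<noteq> 0"
    then have t': "t \<in> {t0<..<T}" using ab by auto
    show "((\<lambda>t. en t (l t)) has_real_derivative
      - (4 * exp (- l t / (1 - p)) * (sin t)\<^sup>2 / (r t * Dn t (r t) (l t)) * (\<Omega> + m + p * exp (l t) * kap t))) (at t)"
      by (rule en_derivative[OF s adm t' t(2)])
    have "r t > 0" using sol_r_pos[OF s, of t] t' t0 by auto
    then show "- (4 * exp (- l t / (1 - p)) * (sin t)\<^sup>2 / (r t * Dn t (r t) (l t)) * (\<Omega> + m + p * exp (l t) * kap t)) \<le> 0"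
      using Dn_pos[of t "r t" "l t"] Om_pos m_pos p_pos kap_nonneg[of t] by simp
  qed (use ab t0 in auto)
  then show ?thesis by simp
qed

text \<open>Between \<alpha> and \<beta> the cosine of the double angle is bounded below, so
  positive energy forces the amplitude to be bounded below, and the loss per unit angle is at least
  a constant over r. That constant depends on the window alone, neither on the solution nor on the
  number of half turns.\<close>

lemma energy_loss:
  assumes ab: "0 < \<alpha>" "\<alpha> < \<beta>" "\<beta> < pi / 4"
  obtains \<epsilon> where "\<epsilon> > 0"
    "\<And>t0 l0 T r l n. adm t0 \<Longrightarrow> sol t0 l0 T r l \<Longrightarrow> t0 \<le> real n * pi + \<alpha> \<Longrightarrow> real n * pi + \<beta> \<le> T \<Longrightarrow>
       en (real n * pi + \<beta>) (l (real n * pi + \<beta>)) + \<epsilon> / r (real n * pi + \<beta>)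
         \<le> en (real n * pi + \<alpha>) (l (real n * pi + \<alpha>))"
proof -
  \<comment> \<open>The lower bound of P on the window, obtained by solving
    \<open>exp l * gam t \<le> \<Omega>\<close> for P with \<open>gam\<close> replaced by its
    smallest value there.\<close>
  define q where "q = (spow p (cos (2 * \<beta>)) / \<Omega>) powr (1 / (1 - p))"
  define \<epsilon>1 where "\<epsilon>1 = 4 * q * (sin \<alpha>)\<^sup>2"
  have cb: "cos (2 * \<beta>) > 0" using ab by (intro cos_gt_zero) auto
  then have "spow p (cos (2 * \<beta>)) > 0" by (simp add: spow_pos)
  then have q: "q > 0" using Om_pos by (simp add: q_def)
  have sa: "sin \<alpha> > 0" using ab by (intro sin_gt_zero) auto
  have e1: "\<epsilon>1 > 0" using q sa by (simp add: \<epsilon>1_def)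
  show thesis
  proof (rule that[of "\<epsilon>1 * (\<beta> - \<alpha>)"])
    show "\<epsilon>1 * (\<beta> - \<alpha>) > 0" using e1 ab by simp
    fix t0 l0 T r l and n :: nat
    assume adm: "adm t0" and s: "sol t0 l0 T r l" and le: "t0 \<le> real n * pi + \<alpha>" "real n * pi + \<beta> \<le> T"
    let ?a = "real n * pi + \<alpha>" and ?b = "real n * pi + \<beta>"
    have t0: "0 < t0" using adm by (simp add: adm_def)
    have rb: "r ?b > 0" using sol_r_pos[OF s, of ?b] t0 le ab by auto
    have "en ?b (l ?b) \<le> en ?a (l ?a) + (- (\<epsilon>1 / r ?b)) * (?b - ?a)"
    proof (rule monotone_with_slope_upper)
      show "continuous_on {?a..?b} (\<lambda>t. en t (l t))"
        using s le unfolding sol_def by (intro continuous_intros) (auto intro: continuous_on_subset)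
      fix t assume t: "t \<in> {?a<..<?b}" "cos (2 * t) \<noteq> 0"
      then have t': "t \<in> {t0<..<T}" using le by auto
      show "((\<lambda>t. en t (l t)) has_real_derivative
        - (4 * exp (- l t / (1 - p)) * (sin t)\<^sup>2 / (r t * Dn t (r t) (l t)) * (\<Omega> + m + p * exp (l t) * kap t))) (at t)"
        by (rule en_derivative[OF s adm t' t(2)])
      define x where "x = t - real n * pi"
      have x: "t = real n * pi + x" "\<alpha> < x" "x < \<beta>" using t by (auto simp: x_def)
      have cx: "cos (2 * t) = cos (2 * x)" "sin (2 * t) = sin (2 * x)" "(sin t)\<^sup>2 = (sin x)\<^sup>2"
        unfolding x(1) by (rule cos_double_shift sin_double_shift sin_sq_shift)+
      have "cos (2 * \<beta>) \<le> cos (2 * x)" using x ab by (intro cos_monotone_0_pi_le) auto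
      then have g: "spow p (cos (2 * \<beta>)) \<le> gam t"
        unfolding gam_def cx using cb p_pos by (simp add: spow_pos powr_mono2)
      have c0: "cos (2 * t) > 0" unfolding cx using \<open>cos (2 * \<beta>) \<le> cos (2 * x)\<close> cb by linarith
      have s0: "sin (2 * t) \<ge> 0" unfolding cx using x ab by (intro sin_ge_zero) auto
      have rt: "r t > 0" using sol_r_pos[OF s, of t] t' t0 by auto
      have "bb t (l t) > 0" using s t' by (auto simp: sol_def)
      then have "exp (l t) * gam t \<le> \<Omega>"
        unfolding bb_def using m_pos c0 by (smt (verit) mult_pos_pos)
      then have "exp (l t) * spow p (cos (2 * \<beta>)) \<le> \<Omega>"
        using g by (smt (verit) exp_gt_zero mult_left_mono)
      then have "spow p (cos (2 * \<beta>)) / \<Omega> \<le> exp (- l t)"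
        using Om_pos by (simp add: exp_minus field_simps)
      then have "q \<le> exp (- l t) powr (1 / (1 - p))"
        unfolding q_def using \<open>spow p (cos (2 * \<beta>)) > 0\<close> Om_pos p_small by (intro powr_mono2) auto
      then have qP: "q \<le> exp (- l t / (1 - p))" by (simp add: powr_def)
      have "sin \<alpha> \<le> sin x" using x ab by (intro sin_monotone_2pi_le) auto
      then have sx: "(sin \<alpha>)\<^sup>2 \<le> (sin t)\<^sup>2" unfolding cx using sa by (intro power_mono) auto
      have "m * cos (2 * t) \<ge> 0" "p * exp (l t) * gam t \<ge> 0" "sin (2 * t) / r t \<ge> 0"
        using m_pos c0 p_pos s0 rt g \<open>spow p (cos (2 * \<beta>)) > 0\<close> by auto
      then have "Dn t (r t) (l t) \<le> \<Omega>"
        unfolding Dn_def using Om_pos by linarith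
      \<comment> \<open>The factor in the dissipation formula that involves the angular speed is
        therefore at least 1.\<close>
      then have D: "Dn t (r t) (l t) \<le> \<Omega> + m + p * exp (l t) * kap t"
        using m_pos p_pos kap_nonneg[of t] by (smt (verit) exp_ge_zero mult_nonneg_nonneg)
      have rtb: "r t \<le> r ?b" using sol_r_growth(1)[OF s, of t ?b] t t' t0 le by auto
      have "\<epsilon>1 / r ?b \<le> \<epsilon>1 / r t * 1"
        using rtb rt e1 by (simp add: divide_left_mono)
      also have "\<dots> \<le> (4 * exp (- l t / (1 - p)) * (sin t)\<^sup>2) / r t * ((\<Omega> + m + p * exp (l t) * kap t) / Dn t (r t) (l t))"
        unfolding \<epsilon>1_def using rt D Dn_pos[of t "r t" "l t"] qP sx q
        by (intro mult_mono divide_right_mono) auto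
      also have "\<dots> = 4 * exp (- l t / (1 - p)) * (sin t)\<^sup>2 / (r t * Dn t (r t) (l t)) * (\<Omega> + m + p * exp (l t) * kap t)"
        by simp
      finally show "- (4 * exp (- l t / (1 - p)) * (sin t)\<^sup>2 / (r t * Dn t (r t) (l t)) * (\<Omega> + m + p * exp (l t) * kap t)) \<le> - (\<epsilon>1 / r ?b)"
        by simp
    qed (use ab t0 le in auto)
    then show "en ?b (l ?b) + \<epsilon>1 * (\<beta> - \<alpha>) / r ?b \<le> en ?a (l ?a)" by simp
  qed
qed

subsection \<open>Continuous dependence and blow-up\<close>

definition alive :: "real \<Rightarrow> real \<Rightarrow> real \<Rightarrow> bool" where
  "alive t0 l0 T \<longleftrightarrow> (\<exists>r l. sol t0 l0 T r l)"

lemma alive_restrict: "alive t0 l0 T \<Longrightarrow> t0 \<le> T' \<Longrightarrow> T' \<le> T \<Longrightarrow> alive t0 l0 T'"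
  unfolding alive_def using sol_restrict by blast

lemma bb_pos_nhd:
  assumes "bb t l > 0"
  obtains \<rho> where "\<rho> > 0" "\<And>s x. \<bar>s - t\<bar> < \<rho> \<Longrightarrow> \<bar>x - l\<bar> < \<rho> \<Longrightarrow> bb s x > 0"
proof -
  have "open {z :: real \<times> real. 0 < bb (fst z) (snd z)}"
    by (intro open_Collect_less continuous_intros)
  then obtain e where e: "e > 0" "ball (t, l) e \<subseteq> {z. 0 < bb (fst z) (snd z)}"
    using assms openE[of "{z :: real \<times> real. 0 < bb (fst z) (snd z)}" "(t, l)"] by auto
  show thesis
  proof (rule that[of "e / 2"])
    fix s x assume "\<bar>s - t\<bar> < e / 2" "\<bar>x - l\<bar> < e / 2"
    then have "dist (s, x) (t, l) < e"
      using norm_Pair_le[of "s - t" "x - l"] by (simp add: dist_norm)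
    then have "(s, x) \<in> ball (t, l) e" by (simp add: dist_commute)
    then show "bb s x > 0" using e by auto
  qed (use e in simp)
qed

lemma bb_diff_le:
  assumes "l \<le> M" "l' \<le> M"
  shows "\<bar>bb t l - bb t l'\<bar> \<le> exp M * \<bar>l - l'\<bar>"
proof -
  have "bb t l - bb t l' = (exp l' - exp l) * gam t" by (simp add: bb_def algebra_simps)
  then have "\<bar>bb t l - bb t l'\<bar> = \<bar>exp l - exp l'\<bar> * \<bar>gam t\<bar>"
    by (simp add: abs_mult abs_minus_commute)
  also have "\<dots> \<le> (exp M * \<bar>l - l'\<bar>) * 1"
    by (intro mult_mono exp_diff_le assms abs_gam_le_1) auto
  finally show ?thesis by simp
qed

text \<open>The starting angle is perturbed as well as \<open>l0\<close>, because both depend on the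
  shooting parameter. Until the later of the two starts only one of the solutions exists, and it
  moves by at most an increment of \<open>K\<close>; from then on the Lipschitz estimate
  applies.\<close>

lemma sol_stable:
  assumes s: "sol t1 l1 T r l" and t1: "0 < t1" and eps: "\<epsilon> > 0"
  obtains \<delta> where "\<delta> > 0"
    "\<And>t0 l0. \<bar>t0 - t1\<bar> < \<delta> \<Longrightarrow> \<bar>l0 - l1\<bar> < \<delta> \<Longrightarrow> 0 < t0 \<Longrightarrow> t0 \<le> T \<Longrightarrow>
       \<exists>r' l'. sol t0 l0 T r' l' \<and> \<bar>l' T - l T\<bar> < \<epsilon>"
proof -
  have T: "t1 \<le> T" and l1: "l t1 = l1" using s by (auto simp: sol_def)
  obtain M0 where M0: "\<And>t. t \<in> {t1..T} \<Longrightarrow> l t \<le> M0" using sol_l_bounded[OF s] by blast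
  \<comment> \<open>One unit of room above the reference solution keeps nearby truncated solutions
    below the cap, so that they are genuine.\<close>
  define M where "M = M0 + 1"
  have lM: "l t \<le> M - 1" if "t \<in> {t1..T}" for t using M0[OF that] by (simp add: M_def)
  define z where "z = (\<lambda>t. (r t, l t))"
  have z: "trunc_sol t1 l1 T M z"
    unfolding z_def using s t1 lM by (intro sol_imp_trunc_sol) force+
  have "continuous_on {t1..T} (\<lambda>t. bb t (l t))"
    using s unfolding sol_def by (intro continuous_intros) auto
  then obtain tm where tm: "tm \<in> {t1..T}" "\<And>t. t \<in> {t1..T} \<Longrightarrow> bb tm (l tm) \<le> bb t (l t)"
    using continuous_attains_inf[of "{t1..T}" "\<lambda>t. bb t (l t)"] T by auto
  define b1 where "b1 = bb tm (l tm)"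
  have b1: "b1 > 0" using s tm by (simp add: b1_def sol_def)
  have "bb t1 l1 > 0" using s T by (auto simp: sol_def)
  \<comment> \<open>A perturbed solution may start before \<open>t1\<close>, where the reference
    solution gives no lower bound for \<open>bb\<close>; there continuity of \<open>bb\<close> at
    the initial point is used.\<close>
  then obtain \<rho> where rho: "\<rho> > 0" "\<And>s x. \<bar>s - t1\<bar> < \<rho> \<Longrightarrow> \<bar>x - l1\<bar> < \<rho> \<Longrightarrow> bb s x > 0"
    using bb_pos_nhd by blast
  \<comment> \<open>At this distance the perturbed solution respects the cap, meets the required
    accuracy, and retains half of the least value \<open>b1\<close> of \<open>bb\<close> on the
    reference solution.\<close>
  define \<epsilon>' where "\<epsilon>' = min (min 1 \<epsilon>) (b1 / (2 * exp M))"
  have e': "\<epsilon>' > 0" "\<epsilon>' \<le> 1" "\<epsilon>' \<le> \<epsilon>" "exp M * \<epsilon>' \<le> b1 / 2"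
  proof -
    show "\<epsilon>' > 0" "\<epsilon>' \<le> 1" "\<epsilon>' \<le> \<epsilon>" using eps b1 by (auto simp: \<epsilon>'_def)
    have "exp M * \<epsilon>' \<le> exp M * (b1 / (2 * exp M))" by (intro mult_left_mono) (auto simp: \<epsilon>'_def)
    then show "exp M * \<epsilon>' \<le> b1 / 2" by simp
  qed
  have "0 < T" using t1 T by simp
  then obtain K where K: "continuous_on UNIV K" "\<And>s t. 0 \<le> s \<Longrightarrow> s \<le> t \<Longrightarrow> t \<le> T \<Longrightarrow> K s \<le> K t"
    and K1: "\<And>t0 l0 y s t. trunc_sol t0 l0 T M y \<Longrightarrow> 0 \<le> t0 \<Longrightarrow> t0 \<le> s \<Longrightarrow> s \<le> t \<Longrightarrow> t \<le> T \<Longrightarrow>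
       norm (y t - y s) \<le> K t - K s"
    and K2: "\<And>t0 l0 y t0' l0' z s t. trunc_sol t0 l0 T M y \<Longrightarrow> trunc_sol t0' l0' T M z \<Longrightarrow> 0 \<le> t0 \<Longrightarrow> 0 \<le> t0' \<Longrightarrow>
       t0 \<le> s \<Longrightarrow> t0' \<le> s \<Longrightarrow> s \<le> t \<Longrightarrow> t \<le> T \<Longrightarrow>
       norm (y t - z t) \<le> norm (y s - z s) * exp (K t - K s)"
    using trunc_sol_compare[of T M] by blast
  define B where "B = exp (K T - K 0)"
  have B1: "B \<ge> 1" using K(2)[of 0 T] \<open>0 < T\<close> by (simp add: B_def)
  define \<eta> where "\<eta> = min (\<epsilon>' / (2 * B)) (\<rho> / 2)"
  have eta: "\<eta> > 0" "2 * \<eta> \<le> \<rho>" "2 * \<eta> * B \<le> \<epsilon>'"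
  proof -
    show "\<eta> > 0" "2 * \<eta> \<le> \<rho>" using e' rho B1 by (auto simp: \<eta>_def)
    have "2 * \<eta> * B \<le> 2 * (\<epsilon>' / (2 * B)) * B" using B1 by (intro mult_right_mono) (auto simp: \<eta>_def)
    then show "2 * \<eta> * B \<le> \<epsilon>'" using B1 by simp
  qed
  have eta1: "2 * \<eta> \<le> 1"
  proof -
    have "2 * \<eta> * 1 \<le> 2 * \<eta> * B" using B1 eta(1) by (intro mult_left_mono) auto
    then show ?thesis using eta(3) e'(2) by linarith
  qed
  have "isCont K t1" using K(1) by (simp add: continuous_on_eq_continuous_at)
  then obtain d where d: "d > 0" "\<And>s. \<bar>s - t1\<bar> < d \<Longrightarrow> \<bar>K s - K t1\<bar> < \<eta>"
    using eta(1) unfolding continuous_at_eps_delta by (auto simp: dist_real_def)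
  show thesis
  proof (rule that[of "min d (min \<eta> \<rho>)"])
    show "min d (min \<eta> \<rho>) > 0" using d eta rho by simp
    fix t0 l0 assume c: "\<bar>t0 - t1\<bar> < min d (min \<eta> \<rho>)" "\<bar>l0 - l1\<bar> < min d (min \<eta> \<rho>)" "0 < t0" "t0 \<le> T"
    obtain y where y: "trunc_sol t0 l0 T M y" using trunc_sol_exists[of t0 T l0 M] c by auto
    have y0: "y t0 = (r0, l0)" and z0: "z t1 = (r0, l1)" using y z by (auto simp: trunc_sol_def)
    have K01: "\<bar>K t0 - K t1\<bar> < \<eta>" using d(2)[of t0] c by simp
    have n01: "norm (y t0 - z t1) < \<eta>" using c by (simp add: y0 z0)
    \<comment> \<open>The later of the two starting angles, from which both solutions are
      defined.\<close>
    define a where "a = max t0 t1"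
    have a: "t0 \<le> a" "t1 \<le> a" "a \<le> T" using c T by (auto simp: a_def)
    have na: "norm (y a - z a) < 2 * \<eta>"
    proof (cases "t0 \<le> t1")
      case True
      have "norm (y t1 - z t1) \<le> norm (y t1 - y t0) + norm (y t0 - z t1)"
        using norm_triangle_ineq[of "y t1 - y t0" "y t0 - z t1"] by simp
      also have "norm (y t1 - y t0) \<le> K t1 - K t0" using K1[OF y, of t0 t1] c T True by simp
      finally show ?thesis using True K01 n01 by (simp add: a_def)
    next
      case False
      have "norm (y t0 - z t0) \<le> norm (y t0 - z t1) + norm (z t0 - z t1)"
        using norm_triangle_ineq4[of "y t0 - z t1" "z t0 - z t1"] by simp
      also have "norm (z t0 - z t1) \<le> K t0 - K t1" using K1[OF z, of t1 t0] t1 c False by simp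
      finally show ?thesis using False K01 n01 by (simp add: a_def)
    qed
    have late: "norm (y t - z t) < \<epsilon>'" if t: "t \<in> {a..T}" for t
    proof -
      have "norm (y t - z t) \<le> norm (y a - z a) * exp (K t - K a)"
        using K2[OF y z, of a t] a t c t1 by simp
      also have "\<dots> \<le> norm (y a - z a) * B"
        using K(2)[of t T] K(2)[of 0 a] a t t1 unfolding B_def by (intro mult_left_mono) auto
      also have "\<dots> < 2 * \<eta> * B" using na B1 by (intro mult_strict_right_mono) auto
      finally show ?thesis using eta(3) by linarith
    qed
    have l_late: "\<bar>snd (y t) - l t\<bar> < \<epsilon>'" if t: "t \<in> {a..T}" for t
      using late[OF t] abs_snd_diff_le[of "y t" "z t"] by (simp add: z_def)
    have l_early: "\<bar>snd (y t) - l1\<bar> < 2 * \<eta>" "\<bar>t - t1\<bar> < \<rho>" if t: "t \<in> {t0..<a}" for t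
    proof -
      have tt: "t0 \<le> t" "t \<le> t1" "a = t1" using t by (auto simp: a_def max_def split: if_splits)
      have "\<bar>snd (y t) - l0\<bar> \<le> norm (y t - y t0)"
        using abs_snd_diff_le[of "y t" "y t0"] by (simp add: y0)
      also have "\<dots> \<le> K t - K t0" using K1[OF y, of t0 t] tt T c by simp
      also have "\<dots> \<le> K t1 - K t0" using K(2)[of t t1] tt T c by simp
      finally show "\<bar>snd (y t) - l1\<bar> < 2 * \<eta>" using K01 c by linarith
      show "\<bar>t - t1\<bar> < \<rho>" using tt c by linarith
    qed
    have "sol t0 l0 T (\<lambda>s. fst (y s)) (\<lambda>s. snd (y s))"
    proof (rule trunc_sol_imp_sol[OF y])
      fix t assume t: "t \<in> {t0..T}"
      show sM: "snd (y t) \<le> M"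
      proof (cases "t < a")
        case True
        then show ?thesis using l_early(1)[of t] t eta1 lM[of t1] l1 T by auto
      next
        case False
        then have "t \<in> {a..T}" using t by simp
        then show ?thesis using l_late[of t] e'(2) lM[of t] a by auto
      qed
      show "0 < bb t (snd (y t))"
      proof (cases "t < a")
        case True
        then show ?thesis using l_early[of t] t eta(2) by (intro rho) auto
      next
        case False
        then have ta: "t \<in> {a..T}" using t by simp
        have "\<bar>bb t (snd (y t)) - bb t (l t)\<bar> \<le> exp M * \<bar>snd (y t) - l t\<bar>"
          using sM lM[of t] ta a by (intro bb_diff_le) auto
        also have "\<dots> \<le> exp M * \<epsilon>'" using l_late[OF ta] by (intro mult_left_mono) auto
        also have "\<dots> \<le> b1 / 2" by (rule e')
        finally have "\<bar>bb t (snd (y t)) - bb t (l t)\<bar> \<le> b1 / 2" .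
        moreover have "b1 \<le> bb t (l t)" using tm(2)[of t] ta a unfolding b1_def by auto
        ultimately show ?thesis using b1 by linarith
      qed
    qed (use c in simp)
    moreover have "\<bar>snd (y T) - l T\<bar> < \<epsilon>" using l_late[of T] a e'(3) by auto
    ultimately show "\<exists>r' l'. sol t0 l0 T r' l' \<and> \<bar>l' T - l T\<bar> < \<epsilon>" by blast
  qed
qed

section \<open>Continuation of solutions and what can end them\<close>

lemma sol_glue:
  assumes "0 < t0" "t0 < T" "\<And>T'. t0 \<le> T' \<Longrightarrow> T' < T \<Longrightarrow> alive t0 l0 T'"
  obtains r l where "\<And>T'. t0 \<le> T' \<Longrightarrow> T' < T \<Longrightarrow> sol t0 l0 T' r l"
proof -
  obtain R L where RL: "\<And>T'. t0 \<le> T' \<Longrightarrow> T' < T \<Longrightarrow> sol t0 l0 T' (R T') (L T')"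
    using assms(3) unfolding alive_def by metis
  \<comment> \<open>A point strictly between \<open>s\<close> and \<open>T\<close>, so that the
    solution chosen for \<open>h s\<close> is defined at \<open>s\<close>; uniqueness makes the
    choices agree.\<close>
  define h where "h s = (s + T) / 2" for s
  show thesis
  proof (rule that[of "\<lambda>s. R (h s) s" "\<lambda>s. L (h s) s"])
    fix T' assume T': "t0 \<le> T'" "T' < T"
    show "sol t0 l0 T' (\<lambda>s. R (h s) s) (\<lambda>s. L (h s) s)"
    proof (rule sol_cong[OF RL[OF T']])
      fix s assume s: "s \<in> {t0..T'}"
      have "sol t0 l0 s (R (h s)) (L (h s))"
        by (rule sol_restrict[OF RL]) (use s T' in \<open>auto simp: h_def\<close>)
      moreover have "sol t0 l0 s (R T') (L T')"
        by (rule sol_restrict[OF RL]) (use s T' in auto)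
      ultimately show "R (h s) s = R T' s \<and> L (h s) s = L T' s"
        using sol_unique[of t0 l0 s _ _ _ _ s] assms(1) s by auto
    qed
  qed
qed

text \<open>Staying strictly below the cap with positive \<open>bb\<close> is an open condition, so
  it persists a little beyond \<open>T\<close> along the truncated solution, which is defined
  further.\<close>

lemma trunc_sol_continue:
  assumes y: "trunc_sol t0 l0 T1 M y" and t0: "0 < t0" "t0 \<le> T" "T < T1"
    and pos: "\<And>t. t \<in> {t0..T} \<Longrightarrow> snd (y t) < M \<and> 0 < bb t (snd (y t))"
  shows "\<exists>T'>T. alive t0 l0 T'"
proof -
  have cy: "continuous_on {t0..T1} y" using y by (simp add: trunc_sol_def)
  define f where "f t = min (bb t (snd (y t))) (M - snd (y t))" for t
  have cf: "continuous_on {t0..T1} f"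
    unfolding f_def by (intro continuous_intros cy)
  have fT: "f T > 0" using pos[of T] t0 by (simp add: f_def)
  have "T \<in> {t0..T1}" using t0 by simp
  then obtain d where d: "d > 0" "\<And>t. t \<in> {t0..T1} \<Longrightarrow> \<bar>t - T\<bar> < d \<Longrightarrow> \<bar>f t - f T\<bar> < f T"
    using cf fT unfolding continuous_on_iff dist_real_def by blast
  define T' where "T' = min (T + d / 2) T1"
  have T': "T' > T" "T' \<le> T1" "T' < T + d" using d(1) t0 by (auto simp: T'_def min_def)
  have fpos: "f t > 0" if t: "t \<in> {t0..T'}" for t
  proof (cases "t \<le> T")
    case True
    then show ?thesis using pos[of t] t by (auto simp: f_def)
  next
    case False
    then have "\<bar>f t - f T\<bar> < f T" using t T' by (intro d) auto
    then show ?thesis by linarith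
  qed
  have "sol t0 l0 T' (\<lambda>s. fst (y s)) (\<lambda>s. snd (y s))"
  proof (rule trunc_sol_imp_sol)
    show "trunc_sol t0 l0 T' M y" by (rule trunc_sol_restrict[OF y]) (use T' t0 in auto)
    show "snd (y t) \<le> M" "0 < bb t (snd (y t))" if "t \<in> {t0..T'}" for t
      using fpos[OF that] by (auto simp: f_def)
  qed (use t0 in simp)
  then show ?thesis using T' unfolding alive_def by blast
qed

lemma alive_beyond_start:
  assumes "0 < t0" "bb t0 l0 > 0"
  shows "\<exists>T>t0. alive t0 l0 T"
proof -
  obtain y where y: "trunc_sol t0 l0 (t0 + 1) (l0 + 1) y"
    using trunc_sol_exists[of t0 "t0 + 1" l0 "l0 + 1"] assms by auto
  then have "y t0 = (r0, l0)" by (simp add: trunc_sol_def)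
  then show ?thesis using assms by (intro trunc_sol_continue[OF y]) auto
qed

text \<open>While \<open>l\<close> stays bounded the solution agrees with a truncated one whose cap
  is out of reach, and so has a limit at \<open>T\<close>. The only remaining obstacle to
  continuation is \<open>bb = 0\<close> in the limit.\<close>

lemma sol_extend:
  assumes t0: "0 < t0" "t0 < T" and s: "\<And>T'. t0 \<le> T' \<Longrightarrow> T' < T \<Longrightarrow> sol t0 l0 T' r l"
    and M: "\<And>t. t \<in> {t0..<T} \<Longrightarrow> l t \<le> M"
  obtains y where "continuous_on {t0..T} y" "\<And>t. t \<in> {t0..<T} \<Longrightarrow> y t = (r t, l t)"
    "snd (y T) \<le> M" "bb T (snd (y T)) \<ge> 0"
    "bb T (snd (y T)) > 0 \<Longrightarrow> \<exists>T'>T. alive t0 l0 T'"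
proof -
  obtain y where y: "trunc_sol t0 l0 (T + 1) (M + 1) y"
    using trunc_sol_exists[of t0 "T + 1" l0 "M + 1"] t0 by auto
  have eq: "y t = (r t, l t)" if t: "t \<in> {t0..<T}" for t
  proof -
    have "trunc_sol t0 l0 t (M + 1) (\<lambda>t. (r t, l t))"
      by (rule sol_imp_trunc_sol[OF s]) (use t t0 M in force)+
    moreover have "trunc_sol t0 l0 t (M + 1) y" by (rule trunc_sol_restrict[OF y]) (use t in auto)
    ultimately show ?thesis using trunc_sol_unique[of t0 l0 t "M + 1" y _ t] t0 t by auto
  qed
  have cy: "continuous_on {t0..T + 1} y" using y by (simp add: trunc_sol_def)
  have cyT: "continuous_on {t0..T} y" using cy by (rule continuous_on_subset) auto
  have cl: "closure {t0..<T} = {t0..T}" using t0 by simp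
  have "snd (y T) \<le> M"
    by (rule continuous_le_on_closure[of "{t0..<T}" "\<lambda>t. snd (y t)"])
      (use cl t0 M eq in \<open>auto intro!: continuous_intros cyT\<close>)
  moreover have "bb T (snd (y T)) \<ge> 0"
    by (rule continuous_ge_on_closure[of "{t0..<T}" "\<lambda>t. bb t (snd (y t))"])
      (use cl t0 s eq in \<open>auto intro!: continuous_intros cyT less_imp_le simp: sol_def\<close>)
  moreover have "\<exists>T'>T. alive t0 l0 T'" if pos: "bb T (snd (y T)) > 0"
  proof (rule trunc_sol_continue[OF y t0(1)])
    fix t assume t: "t \<in> {t0..T}"
    show "snd (y t) < M + 1 \<and> 0 < bb t (snd (y t))"
    proof (cases "t < T")
      case True
      then have "t \<in> {t0..<T}" using t by simp
      then show ?thesis using s[of t] M[of t] eq[of t] by (auto simp: sol_def)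
    next
      case False
      then show ?thesis using t pos \<open>snd (y T) \<le> M\<close> by auto
    qed
  qed (use t0 in auto)
  ultimately show thesis using that[OF cyT eq] by blast
qed

lemma l_bounded_of_near_end:
  assumes s: "\<And>T'. t0 \<le> T' \<Longrightarrow> T' < T \<Longrightarrow> sol t0 l0 T' r l"
    and a: "t0 \<le> a" "a < T" and C: "\<And>t. a \<le> t \<Longrightarrow> t < T \<Longrightarrow> l t \<le> C"
  shows "\<exists>M. \<forall>t\<in>{t0..<T}. l t \<le> M"
proof -
  obtain M where M: "\<And>t. t \<in> {t0..a} \<Longrightarrow> l t \<le> M" using sol_l_bounded[OF s[OF a]] by blast
  have "l t \<le> max M C" if "t \<in> {t0..<T}" for t
    using M[of t] C[of t] that by (cases "t \<le> a") (auto simp: le_max_iff_disj)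
  then show ?thesis by blast
qed

lemma l_bounded_of_slope:
  assumes s: "\<And>T'. t0 \<le> T' \<Longrightarrow> T' < T \<Longrightarrow> sol t0 l0 T' r l"
    and a: "0 \<le> t0" "t0 \<le> a" "a < T" and "C \<ge> 0"
    and C: "\<And>t. a < t \<Longrightarrow> t < T \<Longrightarrow> cos (2 * t) \<noteq> 0 \<Longrightarrow> dl t (r t) (l t) \<le> C"
  shows "\<exists>M. \<forall>t\<in>{t0..<T}. l t \<le> M"
proof (rule l_bounded_of_near_end[OF s a(2,3)])
  fix t assume t: "a \<le> t" "t < T"
  have st: "sol t0 l0 t r l" using s t a by auto
  have "l t \<le> l a + C * (t - a)"
  proof (rule monotone_with_slope_upper)
    show "continuous_on {a..t} l"
      using st a unfolding sol_def by (elim conjE) (erule continuous_on_subset, auto)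
    show "(l has_real_derivative dl u (r u) (l u)) (at u)" if "u \<in> {a<..<t}" "cos (2 * u) \<noteq> 0" for u
      using st a that unfolding sol_def by auto
  qed (use a t C in auto)
  also have "\<dots> \<le> l a + C * (T - a)"
    using t \<open>C \<ge> 0\<close> by (intro add_left_mono mult_left_mono) auto
  finally show "l t \<le> l a + C * (T - a)" .
qed auto

text \<open>Three mechanisms, according to the position of \<open>T\<close> modulo pi. Before pi/4
  positive energy bounds \<open>exp l\<close>. From pi/4 to pi/2 the angular speed is at least a
  multiple of the singular term, so the quotient \<open>dl\<close> is bounded. From pi/2 to pi the
  sine is nonpositive and the singular term lowers \<open>l\<close>. Only at pi/4 do they all
  fail.\<close>

lemma l_bounded_unless_diagonal:
  assumes adm: "adm t0" and t0: "t0 < T"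
    and s: "\<And>T'. t0 \<le> T' \<Longrightarrow> T' < T \<Longrightarrow> sol t0 l0 T' r l"
    and nd: "\<And>n :: nat. T \<noteq> real n * pi + pi / 4"
  shows "\<exists>M. \<forall>t\<in>{t0..<T}. l t \<le> M"
proof -
  have t00: "0 < t0" using adm by (simp add: adm_def)
  \<comment> \<open>The remainder \<tau> is normalised to lie in (0, pi], closed on the right,
    because \<open>T\<close> is approached from the left.\<close>
  define n where "n = nat (\<lceil>T / pi\<rceil> - 1)"
  have "\<lceil>T / pi\<rceil> \<ge> 1" using t00 t0 by (simp add: one_le_ceiling)
  then have rn: "real n = of_int \<lceil>T / pi\<rceil> - 1" by (simp add: n_def)
  have "real n < T / pi" "T / pi \<le> real n + 1" unfolding rn by linarith+
  then have nT: "real n * pi < T" "T \<le> real n * pi + pi" by (simp_all add: field_simps)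
  define \<tau> where "\<tau> = T - real n * pi"
  have tau: "0 < \<tau>" "\<tau> \<le> pi" "\<tau> \<noteq> pi / 4" "T = real n * pi + \<tau>"
    using nT nd[of n] by (auto simp: \<tau>_def)
  have shift: "cos (2 * t) = cos (2 * (t - real n * pi))" "sin (2 * t) = sin (2 * (t - real n * pi))" for t
    using cos_double_shift[of n "t - real n * pi"] sin_double_shift[of n "t - real n * pi"] by simp_all
  have rpos: "r t \<ge> r0" and bpos: "bb t (l t) > 0" and st: "sol t0 l0 t r l" if "t0 \<le> t" "t < T" for t
    using s[OF that] sol_r_ge[OF s[OF that], of t] t00 that by (auto simp: sol_def)
  have sinterm: "4 * (sin t)\<^sup>2 / r t \<le> 4 / r0" if "t0 \<le> t" "t < T" for t
    using rpos[OF that] r0_pos abs_square_le_1[of "sin t"] by (intro frac_le) auto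
  have quot: "a / Dn t x y \<le> a * (8 / \<Omega>)" if "a \<ge> 0" for a t x y
  proof -
    have "a / Dn t x y \<le> a / (\<Omega> / 8)"
      using that Om_pos by (intro divide_left_mono Dn_ge mult_pos_pos Dn_pos) auto
    then show ?thesis by simp
  qed
  consider "\<tau> < pi / 4" | "pi / 4 < \<tau>" "\<tau> \<le> pi / 2" | "pi / 2 < \<tau>" using tau by linarith
  then show ?thesis
  proof cases
    case 1
    define c where "c = spow p (cos (2 * \<tau>))"
    have ct: "cos (2 * \<tau>) > 0" using tau 1 by (intro cos_gt_zero) auto
    then have c: "c > 0" by (simp add: c_def spow_pos)
    show ?thesis
    proof (rule l_bounded_of_near_end[OF s, where a = "max t0 (real n * pi)"])
      fix t assume t: "max t0 (real n * pi) \<le> t" "t < T"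
      have "cos (2 * \<tau>) \<le> cos (2 * t)"
        unfolding shift[of t] using t 1 tau by (intro cos_monotone_0_pi_le) auto
      then have g: "c \<le> gam t" "cos (2 * t) > 0"
        unfolding gam_def c_def using ct p_pos by (auto simp: spow_pos intro!: powr_mono2)
      have "m * cos (2 * t) \<ge> 0" using m_pos g by simp
      moreover have "bb t (l t) > 0" using bpos[of t] t by auto
      ultimately have "exp (l t) * gam t \<le> \<Omega>" unfolding bb_def by linarith
      moreover have "exp (l t) * c \<le> exp (l t) * gam t" using g by (intro mult_left_mono) auto
      ultimately have "exp (l t) * c \<le> \<Omega>" by linarith
      then have "exp (l t) \<le> \<Omega> / c" using c by (simp add: pos_le_divide_eq)
      then show "l t \<le> ln (\<Omega> / c)" using Om_pos c by (simp add: ln_ge_iff)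
    qed (use t0 nT in auto)
  next
    case 2
    \<comment> \<open>A point strictly between the diagonal and \<open>T\<close>: from there on the
      cosine is bounded away from 0.\<close>
    define \<sigma> where "\<sigma> = (pi / 4 + \<tau>) / 2"
    have sg: "pi / 4 < \<sigma>" "\<sigma> < \<tau>" using 2 by (auto simp: \<sigma>_def)
    define c where "c = - cos (2 * \<sigma>)"
    have "cos (2 * \<sigma>) < cos (2 * (pi / 4))" using sg 2 by (intro cos_monotone_0_pi) auto
    then have c: "c > 0" by (simp add: c_def)
    show ?thesis
    proof (rule l_bounded_of_slope[OF s, where a = "max t0 (real n * pi + \<sigma>)" and C = "2 / c + (2 * m + 4 / r0) * (8 / \<Omega>)"])
      show "0 \<le> 2 / c + (2 * m + 4 / r0) * (8 / \<Omega>)" using c m_pos r0_pos Om_pos by simp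
      fix t assume t: "max t0 (real n * pi + \<sigma>) < t" "t < T"
      then have t': "t0 \<le> t" "t < T" "t \<in> {t0..t}" by auto
      have ct: "cos (2 * t) \<le> - c"
        unfolding shift[of t] c_def minus_minus using t 2 sg tau by (intro cos_monotone_0_pi_le) auto
      then have ac: "\<bar>cos (2 * t)\<bar> \<ge> c" using c by auto
      have k: "kap t > 0" unfolding kap_def using ac c by simp
      define X where "X = p * exp (l t) * kap t"
      have X: "X > 0" using p_pos k by (simp add: X_def)
      define D where "D = Dn t (r t) (l t)"
      \<comment> \<open>The singular term appears in the speed with the factor of absolute value of
        the cosine, hence at least \<open>c\<close>, which absorbs the same term in the
        numerator.\<close>
      have "D \<ge> \<Omega> / 4 + p * exp (l t) * \<bar>gam t\<bar>"
        unfolding D_def sol_Dn[OF st[OF t'(1,2)] adm t'(3)]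
        by (rule Dn_raw_lower(2)) (use sol_barrier[OF st[OF t'(1,2)] adm t'(3)] bpos t' ct c in auto)
      moreover have "p * exp (l t) * \<bar>gam t\<bar> = X * \<bar>cos (2 * t)\<bar>"
        using k by (simp add: X_def gam_eq abs_mult)
      moreover have "X * c \<le> X * \<bar>cos (2 * t)\<bar>" using ac X by (intro mult_left_mono) auto
      ultimately have DX: "X * c \<le> D" using Om_pos by linarith
      have D0: "D > 0" unfolding D_def by (rule Dn_pos)
      have XD: "X / D \<le> 1 / c" using DX D0 c by (simp add: field_simps)
      have "Nm t (r t) (l t) \<le> 2 * X + (2 * m + 4 / r0)"
      proof -
        have "sin (2 * t) * (X + m) \<le> 1 * (X + m)" using X m_pos by (intro mult_right_mono) auto
        then show ?thesis unfolding Nm_def using sinterm[OF t'(1,2)] by (simp add: X_def)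
      qed
      then have "Nm t (r t) (l t) / D \<le> (2 * X + (2 * m + 4 / r0)) / D"
        using D0 by (intro divide_right_mono) auto
      also have "\<dots> = 2 * (X / D) + (2 * m + 4 / r0) / D" by (simp add: add_divide_distrib)
      also have "\<dots> \<le> 2 * (1 / c) + (2 * m + 4 / r0) * (8 / \<Omega>)"
        unfolding D_def using XD m_pos r0_pos by (intro add_mono mult_left_mono quot) (auto simp: D_def)
      finally have *: "Nm t (r t) (l t) / D \<le> 2 / c + (2 * m + 4 / r0) * (8 / \<Omega>)" (is "_ \<le> ?C") by simp
      have C0: "?C \<ge> 0" using c m_pos r0_pos Om_pos by simp
      have "dl t (r t) (l t) = (1 - p) * (Nm t (r t) (l t) / D)" by (simp add: dl_def D_def)
      also have "\<dots> \<le> (1 - p) * ?C" using * p_small by (intro mult_left_mono) auto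
      also have "\<dots> \<le> 1 * ?C" using C0 p_pos by (intro mult_right_mono) auto
      finally show "dl t (r t) (l t) \<le> ?C" by simp
    qed (use t0 t00 sg tau in auto)
  next
    case 3
    show ?thesis
    proof (rule l_bounded_of_slope[OF s, where a = "max t0 (real n * pi + pi / 2)" and C = "4 / r0 * (8 / \<Omega>)"])
      show "0 \<le> 4 / r0 * (8 / \<Omega>)" using r0_pos Om_pos by simp
      fix t assume t: "max t0 (real n * pi + pi / 2) < t" "t < T"
      then have t': "t0 \<le> t" "t < T" by auto
      have "sin (2 * t) \<le> 0"
        unfolding shift[of t] using t tau by (intro sin_le_zero) auto
      then have "2 * sin (2 * t) * (p * exp (l t) * kap t + m) \<le> 0"
        using p_pos m_pos kap_nonneg[of t] by (intro mult_nonpos_nonneg[of "2 * sin (2 * t)"]) auto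
      then have "Nm t (r t) (l t) \<le> 4 / r0" unfolding Nm_def using sinterm[OF t'] by linarith
      then have "Nm t (r t) (l t) / Dn t (r t) (l t) \<le> (4 / r0) / Dn t (r t) (l t)"
        by (intro divide_right_mono) (auto simp: Dn_pos less_imp_le)
      also have "\<dots> \<le> 4 / r0 * (8 / \<Omega>)" using r0_pos by (intro quot) auto
      finally have *: "Nm t (r t) (l t) / Dn t (r t) (l t) \<le> 4 / r0 * (8 / \<Omega>)" (is "_ \<le> ?C") .
      have C0: "?C \<ge> 0" using r0_pos Om_pos by simp
      have "dl t (r t) (l t) = (1 - p) * (Nm t (r t) (l t) / Dn t (r t) (l t))" by (simp add: dl_def)
      also have "\<dots> \<le> (1 - p) * ?C" using * p_small by (intro mult_left_mono) auto
      also have "\<dots> \<le> 1 * ?C" using C0 p_pos by (intro mult_right_mono) auto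
      finally show "dl t (r t) (l t) \<le> ?C" by simp
    qed (use t0 t00 3 tau in auto)
  qed
qed

text \<open>In the quadrant from n pi to n pi + pi/2 the sine of the double angle is nonnegative, so
  the amplitude can only decrease.\<close>

lemma l_mono_before_diagonal:
  assumes adm: "adm t0" and s: "sol t0 l0 b r l"
    and ab: "t0 \<le> a" "real n * pi \<le> a" "a \<le> b" "b \<le> real n * pi + pi / 2"
  shows "l a \<le> l b"
proof -
  have t00: "0 < t0" using adm by (simp add: adm_def)
  have "l a + 0 * (b - a) \<le> l b"
  proof (rule monotone_with_slope)
    show "continuous_on {a..b} l"
      using s ab unfolding sol_def by (elim conjE) (erule continuous_on_subset, auto)
    fix u assume u: "u \<in> {a<..<b}" "cos (2 * u) \<noteq> 0"
    show "(l has_real_derivative dl u (r u) (l u)) (at u)"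
      using s ab u unfolding sol_def by auto
    have "sin (2 * u) = sin (2 * (u - real n * pi))"
      using sin_double_shift[of n "u - real n * pi"] by simp
    also have "\<dots> \<ge> 0" using u ab by (intro sin_ge_zero) auto
    finally have "sin (2 * u) \<ge> 0" .
    moreover have "r u > 0" using sol_r_pos[OF s, of u] u ab t00 by auto
    ultimately show "0 \<le> dl u (r u) (l u)"
      unfolding dl_def Nm_def using p_small p_pos m_pos kap_nonneg[of u] Dn_pos[of u "r u" "l u"] by simp
  qed (use ab t00 in auto)
  then show ?thesis by simp
qed

text \<open>Monotonicity of \<open>l\<close> near the diagonal upgrades unboundedness to
  divergence.\<close>

lemma l_unbounded_imp_at_top:
  assumes adm: "adm t0" and t0: "t0 < T" and T: "T = real n * pi + pi / 4"
    and s: "\<And>T'. t0 \<le> T' \<Longrightarrow> T' < T \<Longrightarrow> sol t0 l0 T' r l"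
    and unb: "\<not> (\<exists>M. \<forall>t\<in>{t0..<T}. l t \<le> M)"
  shows "\<exists>T1. t0 < T1 \<and> real n * pi \<le> T1 \<and> T1 < T \<and> (\<forall>t\<in>{T1..<T}. B \<le> l t)"
proof -
  have t00: "0 < t0" using adm by (simp add: adm_def)
  have nT: "real n * pi < T" using T pi_gt_zero by linarith
  define A where "A = max ((t0 + T) / 2) (real n * pi)"
  have A: "t0 < A" "A < T" "real n * pi \<le> A" using t0 nT by (auto simp: A_def less_max_iff_disj)
  obtain M where M: "\<And>t. t \<in> {t0..A} \<Longrightarrow> l t \<le> M" using sol_l_bounded[OF s[of A]] A by auto
  from unb obtain t where t: "t \<in> {t0..<T}" "l t > max B M" by (meson not_le)
  then have tA: "t > A" using M[of t] by (cases "t \<le> A") auto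
  have "B \<le> l u" if u: "u \<in> {t..<T}" for u
  proof -
    have "sol t0 l0 u r l" using u t by (intro s) auto
    then have "l t \<le> l u"
      by (rule l_mono_before_diagonal[OF adm, where n = n]) (use u tA A t T pi_gt_zero in auto)
    then show ?thesis using t by simp
  qed
  then show ?thesis using tA A t by (intro exI[of _ t]) auto
qed

text \<open>If \<open>l\<close> stays bounded, then \<open>bb\<close> vanishes in the limit, as the
  solution could otherwise be continued. If \<open>l\<close> is unbounded, \<open>T\<close> is a
  diagonal, P tends to 0 and \<open>bb\<close> is at most \<open>\<Omega>\<close> on the approach.
  Either way the energy tends to 0.\<close>

lemma energy_at_blowup:
  assumes adm: "adm t0" and t0: "t0 < T"
    and s: "\<And>T'. t0 \<le> T' \<Longrightarrow> T' < T \<Longrightarrow> sol t0 l0 T' r l"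
    and dead: "\<And>T'. T' > T \<Longrightarrow> \<not> alive t0 l0 T'" and eps: "\<epsilon> > 0"
  shows "\<exists>T'. t0 < T' \<and> T' < T \<and> en T' (l T') < \<epsilon>"
proof (cases "\<exists>M. \<forall>t\<in>{t0..<T}. l t \<le> M")
  case True
  have t00: "0 < t0" using adm by (simp add: adm_def)
  obtain M where M: "\<And>t. t \<in> {t0..<T} \<Longrightarrow> l t \<le> M" using True by blast
  obtain y where y: "continuous_on {t0..T} y" "\<And>t. t \<in> {t0..<T} \<Longrightarrow> y t = (r t, l t)"
    "bb T (snd (y T)) \<ge> 0" "bb T (snd (y T)) > 0 \<Longrightarrow> \<exists>T'>T. alive t0 l0 T'"
    using sol_extend[OF t00 t0 s M] by metis
  then have "bb T (snd (y T)) = 0" using dead by force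
  then have e0: "en T (snd (y T)) = 0" by (simp add: en_def)
  have "continuous_on {t0..T} (\<lambda>t. en t (snd (y t)))" by (intro continuous_intros y)
  then obtain d where d: "d > 0" "\<And>t. t \<in> {t0..T} \<Longrightarrow> \<bar>t - T\<bar> < d \<Longrightarrow> \<bar>en t (snd (y t)) - en T (snd (y T))\<bar> < \<epsilon>"
    using eps t0 unfolding continuous_on_iff dist_real_def by (metis atLeastAtMost_iff less_imp_le order_refl)
  define t where "t = max (T - d / 2) ((t0 + T) / 2)"
  have t: "t0 < t" "t < T" "T - d / 2 \<le> t" using t0 d(1) by (auto simp: t_def less_max_iff_disj)
  then have td: "\<bar>t - T\<bar> < d" using d(1) by linarith
  have "\<bar>en t (snd (y t)) - en T (snd (y T))\<bar> < \<epsilon>" by (rule d) (use t td in auto)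
  then show ?thesis using t e0 y(2)[of t] by (intro exI[of _ t]) auto
next
  case False
  then obtain n where n: "T = real n * pi + pi / 4"
    using l_bounded_unless_diagonal[OF adm t0 s] by blast
  \<comment> \<open>Chosen so that \<open>l\<close> above \<open>B\<close> makes P smaller than
    \<open>\<epsilon> / \<Omega>\<close>.\<close>
  define B where "B = (1 - p) * ln (\<Omega> / \<epsilon>) + 1"
  obtain T1 where T1: "t0 < T1" "real n * pi \<le> T1" "T1 < T" "\<And>t. t \<in> {T1..<T} \<Longrightarrow> B \<le> l t"
    using l_unbounded_imp_at_top[OF adm t0 n s False, of B] by blast
  have B: "B \<le> l T1" using T1 by auto
  have "(1 - p) * ln (\<Omega> / \<epsilon>) < l T1" using B by (simp add: B_def)
  then have "- l T1 / (1 - p) < - ln (\<Omega> / \<epsilon>)" using p_small by (simp add: field_simps)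
  then have "exp (- l T1 / (1 - p)) < exp (- ln (\<Omega> / \<epsilon>))" by simp
  also have "\<dots> = \<epsilon> / \<Omega>" using Om_pos eps by (simp add: exp_minus)
  finally have P: "exp (- l T1 / (1 - p)) < \<epsilon> / \<Omega>" .
  have "cos (2 * T1) = cos (2 * (T1 - real n * pi))" using cos_double_shift[of n "T1 - real n * pi"] by simp
  also have "\<dots> \<ge> 0" using T1 n by (intro cos_ge_zero) auto
  finally have c: "cos (2 * T1) \<ge> 0" .
  have "gam T1 \<ge> 0" unfolding gam_def using c by (rule spow_nonneg)
  then have "m * cos (2 * T1) \<ge> 0" "exp (l T1) * gam T1 \<ge> 0" using m_pos c by auto
  then have "bb T1 (l T1) \<le> \<Omega>" unfolding bb_def by linarith
  moreover have "0 < bb T1 (l T1)" using s[of T1] T1 by (auto simp: sol_def)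
  ultimately have "en T1 (l T1) \<le> exp (- l T1 / (1 - p)) * \<Omega>" unfolding en_def by (intro mult_left_mono) auto
  also have "\<dots> < \<epsilon>" using P Om_pos by (simp add: field_simps)
  finally show ?thesis using T1 by blast
qed

text \<open>The radius grows at most linearly with the angle, so the k-th half turn costs at least a
  multiple of 1 / (k + 1). The harmonic series diverges and would exhaust any initial
  energy.\<close>

lemma not_always_alive:
  assumes adm: "adm t0"
  shows "\<exists>N :: nat. 0 < N \<and> \<not> alive t0 l0 (real N * pi)"
proof (rule ccontr)
  assume "\<not> ?thesis"
  then have al: "alive t0 l0 (real N * pi)" if "0 < N" for N :: nat using that by blast
  have t00: "0 < t0" "t0 < pi / 8" using adm by (auto simp: adm_def)
  obtain \<epsilon> where eps: "\<epsilon> > 0"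
    and loss: "\<And>t0 l0 T r l n. adm t0 \<Longrightarrow> sol t0 l0 T r l \<Longrightarrow> t0 \<le> real n * pi + pi / 8 \<Longrightarrow> real n * pi + pi / 6 \<le> T \<Longrightarrow>
       en (real n * pi + pi / 6) (l (real n * pi + pi / 6)) + \<epsilon> / r (real n * pi + pi / 6)
         \<le> en (real n * pi + pi / 8) (l (real n * pi + pi / 8))"
    using energy_loss[of "pi / 8" "pi / 6"] pi_gt_zero by auto
  define C where "C = r0 + 8 * pi / \<Omega>"
  have C: "C > 0" using r0_pos Om_pos by (simp add: C_def add_pos_pos)
  define c where "c = \<epsilon> / C"
  have c: "c > 0" using C eps by (simp add: c_def)
  \<comment> \<open>The solution is taken up to one more half turn than is summed, so that the
    energy is still defined and positive at the angle N pi + pi/8.\<close>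
  have bound: "c * (\<Sum>k<N. 1 / (real k + 1)) \<le> en t0 l0" for N :: nat
  proof -
    obtain r l where s: "sol t0 l0 (real (N + 1) * pi) r l" using al[of "N + 1"] by (auto simp: alive_def)
    let ?E = "\<lambda>k. en (real k * pi + pi / 8) (l (real k * pi + pi / 8))"
    have step: "?E (Suc k) + c * (1 / (real k + 1)) \<le> ?E k" if k: "k < N" for k
    proof -
      have kN: "real k + 1 \<le> real N" using k by linarith
      then have kp: "real k * pi + pi \<le> real N * pi"
        using mult_right_mono[OF kN, of pi] by (simp add: algebra_simps)
      let ?t = "real k * pi + pi / 6"
      have kp0: "real k * pi \<ge> 0" by simp
      have NP: "real (N + 1) * pi = real N * pi + pi" "real (Suc k) * pi = real k * pi + pi"
        by (simp_all add: algebra_simps)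
      have tT: "t0 \<le> ?t" "?t \<le> real (N + 1) * pi" unfolding NP using t00 kp kp0 pi_gt_zero by linarith+
      have rt: "r ?t > 0" using sol_r_pos[OF s, of ?t] t00 tT by auto
      have "r ?t \<le> r t0 + 8 / \<Omega> * (?t - t0)"
        by (rule sol_r_growth(2)[OF s]) (use t00 tT in auto)
      also have "\<dots> \<le> r0 + 8 / \<Omega> * (real k * pi + pi)"
        using s t00 Om_pos pi_gt_zero by (intro add_mono mult_left_mono) (auto simp: sol_def)
      also have "\<dots> \<le> C * (real k + 1)"
        using r0_pos by (simp add: C_def algebra_simps add_divide_distrib)
      finally have "\<epsilon> / (C * (real k + 1)) \<le> \<epsilon> / r ?t"
        using rt eps C by (intro divide_left_mono) auto
      moreover have "en ?t (l ?t) + \<epsilon> / r ?t \<le> ?E k"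
        by (rule loss[OF adm s]; use t00 tT kp0 pi_gt_zero in linarith)
      moreover have "?E (Suc k) \<le> en ?t (l ?t)"
        by (rule sol_en_mono[OF s adm]; use t00 tT kp kp0 pi_gt_zero NP in linarith)
      ultimately show ?thesis by (simp add: c_def)
    qed
    have ind: "?E k + c * (\<Sum>i<k. 1 / (real i + 1)) \<le> en t0 l0" if "k \<le> N" for k
      using that
    proof (induction k)
      case 0
      have "?E 0 \<le> en t0 (l t0)"
        by (rule sol_en_mono[OF s adm]) (use t00 pi_gt_zero in \<open>auto simp: algebra_simps\<close>)
      then show ?case using s by (simp add: sol_def)
    next
      case (Suc k)
      then show ?case using step[of k] by (simp add: distrib_left)
    qed
    have "?E N > 0"
    proof (rule sol_en_pos[OF s])
      have "real N * pi \<ge> 0" "real (N + 1) * pi = real N * pi + pi" by (simp_all add: algebra_simps)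
      then show "real N * pi + pi / 8 \<in> {t0..real (N + 1) * pi}"
        using t00 pi_gt_zero unfolding atLeastAtMost_iff by linarith
    qed
    then show ?thesis using ind[of N] by simp
  qed
  have "summable (\<lambda>k. 1 / (real k + 1))"
  proof (rule summableI_nonneg_bounded)
    show "(\<Sum>k<N. 1 / (real k + 1)) \<le> en t0 l0 / c" for N
      using bound[of N] c by (simp add: field_simps)
  qed simp
  then have "summable (\<lambda>k. inverse (real (Suc k)))" by (simp add: inverse_eq_divide add.commute)
  then have "summable (\<lambda>k. inverse (real k))" by (simp only: summable_Suc_iff[of "\<lambda>k. inverse (real k)"])
  then show False using not_summable_harmonic[where 'a = real] by simp
qed

text \<open>Very negative \<open>l\<close> means a very large amplitude, for which the singular term
  is negligible. With the cap at 0 the total variation of \<open>l\<close> up to \<open>T\<close> is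
  bounded independently of the start.\<close>

lemma alive_of_small_start:
  assumes "0 < T"
  obtains L where "\<And>t0 l0. 0 < t0 \<Longrightarrow> t0 \<le> T \<Longrightarrow> l0 \<le> L \<Longrightarrow> alive t0 l0 T"
proof -
  obtain K where "continuous_on UNIV K" and K: "\<And>s t. 0 \<le> s \<Longrightarrow> s \<le> t \<Longrightarrow> t \<le> T \<Longrightarrow> K s \<le> K t"
    and K1: "\<And>t0 l0 y s t. trunc_sol t0 l0 T 0 y \<Longrightarrow> 0 \<le> t0 \<Longrightarrow> t0 \<le> s \<Longrightarrow> s \<le> t \<Longrightarrow> t \<le> T \<Longrightarrow>
       norm (y t - y s) \<le> K t - K s"
    by (rule trunc_sol_compare[OF assms, of 0]) blast
  \<comment> \<open>Starting this low leaves \<open>exp l\<close> at most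
    \<open>\<Omega> / 4\<close> after the largest possible variation, so the linear part of
    \<open>bb\<close> dominates.\<close>
  define L where "L = min 0 (ln (\<Omega> / 4)) - (K T - K 0)"
  show thesis
  proof (rule that[of L])
    fix t0 l0 assume t0: "0 < t0" "t0 \<le> T" "l0 \<le> L"
    obtain y where y: "trunc_sol t0 l0 T 0 y" using trunc_sol_exists[of t0 T l0 0] t0 by auto
    have le: "snd (y t) \<le> min 0 (ln (\<Omega> / 4))" if t: "t \<in> {t0..T}" for t
    proof -
      have "\<bar>snd (y t) - snd (y t0)\<bar> \<le> norm (y t - y t0)"
        by (rule abs_snd_diff_le)
      also have "\<dots> \<le> K t - K t0" using K1[OF y, of t0 t] t t0 by auto
      also have "\<dots> \<le> K T - K 0" using K[of t T] K[of 0 t0] t t0 by auto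
      finally show ?thesis using y t0 by (auto simp: trunc_sol_def L_def)
    qed
    have "sol t0 l0 T (\<lambda>s. fst (y s)) (\<lambda>s. snd (y s))"
    proof (rule trunc_sol_imp_sol[OF y])
      fix t assume t: "t \<in> {t0..T}"
      show "snd (y t) \<le> 0" using le[OF t] by simp
      have "exp (snd (y t)) \<le> exp (ln (\<Omega> / 4))" using le[OF t] by simp
      then have e: "exp (snd (y t)) \<le> \<Omega> / 4" using Om_pos by simp
      have "exp (snd (y t)) * gam t \<le> exp (snd (y t)) * 1"
        using abs_gam_le_1[of t] by (intro mult_left_mono) auto
      moreover have "m * cos (2 * t) \<le> m * 1" using m_pos by (intro mult_left_mono) auto
      ultimately show "0 < bb t (snd (y t))" unfolding bb_def using e Om_large Om_pos m_pos by linarith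
    qed (use t0 in simp)
    then show "alive t0 l0 T" unfolding alive_def by blast
  qed
qed

subsection \<open>Shooting\<close>

text \<open>Near the blow-up angle the energy is smaller than what any solution loses before the next diagonal.\<close>

lemma dies_early_open:
  fixes T0 L0 :: "real \<Rightarrow> real" and n :: nat
  assumes adm: "\<And>x. x \<ge> xs \<Longrightarrow> adm (T0 x)"
    and cT: "continuous_on {xs..} T0" and cL: "continuous_on {xs..} L0"
    and x: "x \<ge> xs" and die: "T0 x \<le> Td" "Td < real n * pi + pi / 4" "\<not> alive (T0 x) (L0 x) Td"
  obtains \<delta> where "\<delta> > 0" "\<And>x'. x' \<ge> xs \<Longrightarrow> \<bar>x' - x\<bar> < \<delta> \<Longrightarrow>
    \<exists>T'. T0 x' \<le> T' \<and> T' < real n * pi + pi / 4 \<and> \<not> alive (T0 x') (L0 x') T'"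
proof -
  have T0: "0 < T0 x" "T0 x < pi / 8" if "x \<ge> xs" for x using adm[OF that] by (auto simp: adm_def)
  have npi: "real n * pi \<ge> 0" by simp
  \<comment> \<open>The window used for the energy loss has to lie after \<open>Td\<close>, after
    every admissible start and before the diagonal; \<alpha> and \<beta> below are the third points
    between \<open>m1\<close> and pi/4.\<close>
  define m1 where "m1 = max (Td - real n * pi) (pi / 8)"
  have m1: "m1 < pi / 4" unfolding m1_def max_less_iff_conj using die(2) pi_gt_zero by (intro conjI; linarith)
  define \<alpha> where "\<alpha> = (2 * m1 + pi / 4) / 3"
  define \<beta> where "\<beta> = (m1 + 2 * (pi / 4)) / 3"
  have ab: "m1 < \<alpha>" "\<alpha> < \<beta>" "\<beta> < pi / 4" using m1 by (auto simp: \<alpha>_def \<beta>_def)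
  have al: "Td < real n * pi + \<alpha>" "pi / 8 < \<alpha>" using ab(1) by (auto simp: m1_def)
  have al0: "0 < \<alpha>" using al(2) pi_gt_zero by linarith
  let ?a = "real n * pi + \<alpha>" and ?b = "real n * pi + \<beta>"
  obtain \<epsilon> where eps: "\<epsilon> > 0"
    and loss: "\<And>t0 l0 T r l n. adm t0 \<Longrightarrow> sol t0 l0 T r l \<Longrightarrow> t0 \<le> real n * pi + \<alpha> \<Longrightarrow> real n * pi + \<beta> \<le> T \<Longrightarrow>
       en (real n * pi + \<beta>) (l (real n * pi + \<beta>)) + \<epsilon> / r (real n * pi + \<beta>)
         \<le> en (real n * pi + \<alpha>) (l (real n * pi + \<alpha>))"
    using energy_loss[OF al0 ab(2,3)] by blast
  define R where "R = r0 + 8 / \<Omega> * ?b"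
  have R: "R > 0" using r0_pos Om_pos npi ab al pi_gt_zero unfolding R_def
    by (intro add_pos_nonneg mult_nonneg_nonneg) auto
  define e1 where "e1 = \<epsilon> / R"
  have e1: "e1 > 0" using eps R by (simp add: e1_def)
  \<comment> \<open>Energy below \<open>e1\<close> at any angle up to the window is less than the
    loss inside the window, since \<open>R\<close> bounds the radius there for all starts. The
    solution thus ends before the diagonal.\<close>
  have must_die: "\<exists>T'. T0 x' \<le> T' \<and> T' < real n * pi + pi / 4 \<and> \<not> alive (T0 x') (L0 x') T'"
    if x': "x' \<ge> xs" and s': "sol (T0 x') (L0 x') t r' l'" and t: "t \<le> ?a" and small: "en t (l' t) < e1" for x' t r' l'
  proof (rule ccontr)
    assume neg: "\<not> ?thesis"
    have T0x': "0 < T0 x'" "T0 x' < pi / 8" by (rule T0[OF x'])+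
    have bT: "T0 x' \<le> ?a" "T0 x' \<le> ?b" "?b < real n * pi + pi / 4"
      using T0x' npi ab al by linarith+
    then have "alive (T0 x') (L0 x') ?b" using neg by blast
    then obtain r l where s: "sol (T0 x') (L0 x') ?b r l" by (auto simp: alive_def)
    have Tt: "T0 x' \<le> t" using s' by (simp add: sol_def)
    have "l t = l' t"
      by (rule sol_unique(2)[OF sol_restrict[OF s] s']) (use Tt t ab T0x' in auto)
    moreover have "en ?a (l ?a) \<le> en t (l t)"
      by (rule sol_en_mono[OF s adm[OF x']]) (use Tt t ab in auto)
    moreover have "en ?b (l ?b) + \<epsilon> / r ?b \<le> en ?a (l ?a)"
      by (rule loss[OF adm[OF x'] s bT(1)]) simp
    moreover have "0 < en ?b (l ?b)" by (rule sol_en_pos[OF s]) (use bT in auto)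
    moreover have "\<epsilon> / R \<le> \<epsilon> / r ?b"
    proof (rule divide_left_mono)
      have "r ?b \<le> r (T0 x') + 8 / \<Omega> * (?b - T0 x')"
        by (rule sol_r_growth(2)[OF s]) (use bT T0x' in auto)
      also have "\<dots> \<le> R" unfolding R_def using s T0x' Om_pos
        by (intro add_mono mult_left_mono) (auto simp: sol_def)
      finally show "r ?b \<le> R" .
      show "0 < R * r ?b" using R sol_r_pos[OF s, of ?b] bT T0x' by simp
    qed (use eps in simp)
    ultimately show False using small by (simp add: e1_def)
  qed
  show thesis
  proof (cases "bb (T0 x) (L0 x) > 0")
    \<comment> \<open>The start has nonpositive energy. Nearby starts either have no solution at all
      or have energy below \<open>e1\<close> at once.\<close>
    case False
    then have "en (T0 x) (L0 x) \<le> 0" by (simp add: en_def mult_nonneg_nonpos)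
    then have ex: "en (T0 x) (L0 x) < e1" using e1 by linarith
    have "continuous_on {xs..} (\<lambda>x. en (T0 x) (L0 x))" by (intro continuous_intros cT cL)
    then obtain d where d: "d > 0" "\<And>x'. x' \<in> {xs..} \<Longrightarrow> \<bar>x' - x\<bar> < d \<Longrightarrow>
        \<bar>en (T0 x') (L0 x') - en (T0 x) (L0 x)\<bar> < e1 - en (T0 x) (L0 x)"
      using ex x unfolding continuous_on_iff dist_real_def by (metis atLeast_iff diff_gt_0_iff_gt)
    show thesis
    proof (rule that[OF d(1)])
      fix x' assume x': "x' \<ge> xs" "\<bar>x' - x\<bar> < d"
      have small: "en (T0 x') (L0 x') < e1" using d(2)[of x'] x' by auto
      show "\<exists>T'. T0 x' \<le> T' \<and> T' < real n * pi + pi / 4 \<and> \<not> alive (T0 x') (L0 x') T'"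
      proof (cases "alive (T0 x') (L0 x') (T0 x')")
        case True
        then obtain r l where s: "sol (T0 x') (L0 x') (T0 x') r l" by (auto simp: alive_def)
        have "T0 x' \<le> ?a" using T0(2)[OF x'(1)] npi al(2) by linarith
        moreover have "l (T0 x') = L0 x'" using s by (simp add: sol_def)
        ultimately show ?thesis using small by (intro must_die[OF x'(1) s]) auto
      next
        case False
        moreover have "T0 x' < real n * pi + pi / 4" using T0(2)[OF x'(1)] npi pi_gt_zero by linarith
        ultimately show ?thesis by blast
      qed
    qed
  next
    case True
    \<comment> \<open>The angle at which the solution ends is the supremum of this set. Shortly
      before it the energy is below \<open>e1\<close>, and this strict inequality at a fixed angle
      carries over to neighbouring starts.\<close>
    define S where "S = {T. T0 x \<le> T \<and> alive (T0 x) (L0 x) T}"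
    obtain Ta where Ta: "Ta > T0 x" "alive (T0 x) (L0 x) Ta"
      using alive_beyond_start[OF T0(1)[OF x] True] by blast
    have "Ta \<in> S" using Ta by (simp add: S_def)
    then have Sne: "S \<noteq> {}" by blast
    have Sub: "T \<le> Td" if "T \<in> S" for T
      using that die alive_restrict[of "T0 x" "L0 x" T Td] by (force simp: S_def)
    then have Sb: "bdd_above S" by (rule bdd_aboveI)
    define Ts where "Ts = Sup S"
    have Ts1: "T0 x < Ts" using Ta cSup_upper[OF _ Sb, of Ta] by (auto simp: S_def Ts_def)
    have Ts2: "Ts \<le> Td" unfolding Ts_def by (rule cSup_least[OF Sne Sub])
    have live: "alive (T0 x) (L0 x) T'" if "T0 x \<le> T'" "T' < Ts" for T'
    proof -
      obtain T where "T \<in> S" "T' < T" using less_cSup_iff[OF Sne Sb] \<open>T' < Ts\<close> by (auto simp: Ts_def)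
      then show ?thesis using alive_restrict[of "T0 x" "L0 x" T T'] that by (auto simp: S_def)
    qed
    have dead: "\<not> alive (T0 x) (L0 x) T'" if "T' > Ts" for T'
      using cSup_upper[OF _ Sb, of T'] that Ts1 by (force simp: S_def Ts_def)
    obtain r l where s: "\<And>T'. T0 x \<le> T' \<Longrightarrow> T' < Ts \<Longrightarrow> sol (T0 x) (L0 x) T' r l"
      using sol_glue[OF T0(1)[OF x] Ts1 live] by blast
    obtain T1 where T1: "T0 x < T1" "T1 < Ts" "en T1 (l T1) < e1"
      using energy_at_blowup[OF adm[OF x] Ts1 s dead e1] by blast
    have "continuous_on UNIV (\<lambda>z. en T1 z)" by (intro continuous_intros)
    then obtain \<epsilon>2 where e2: "\<epsilon>2 > 0" "\<And>z. \<bar>z - l T1\<bar> < \<epsilon>2 \<Longrightarrow> \<bar>en T1 z - en T1 (l T1)\<bar> < e1 - en T1 (l T1)"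
      using T1(3) unfolding continuous_on_iff dist_real_def by (metis UNIV_I diff_gt_0_iff_gt)
    have sT1: "sol (T0 x) (L0 x) T1 r l" using T1 by (intro s) auto
    obtain \<delta> where d: "\<delta> > 0"
      "\<And>t0 l0. \<bar>t0 - T0 x\<bar> < \<delta> \<Longrightarrow> \<bar>l0 - L0 x\<bar> < \<delta> \<Longrightarrow> 0 < t0 \<Longrightarrow> t0 \<le> T1 \<Longrightarrow>
       \<exists>r' l'. sol t0 l0 T1 r' l' \<and> \<bar>l' T1 - l T1\<bar> < \<epsilon>2"
      using sol_stable[OF sT1 T0(1)[OF x] e2(1)] by blast
    have "min \<delta> (T1 - T0 x) > 0" using d T1 by simp
    then obtain d1 where d1: "d1 > 0" "\<And>x'. x' \<in> {xs..} \<Longrightarrow> \<bar>x' - x\<bar> < d1 \<Longrightarrow> \<bar>T0 x' - T0 x\<bar> < min \<delta> (T1 - T0 x)"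
      using cT x unfolding continuous_on_iff dist_real_def by (metis atLeast_iff)
    obtain d2 where d2: "d2 > 0" "\<And>x'. x' \<in> {xs..} \<Longrightarrow> \<bar>x' - x\<bar> < d2 \<Longrightarrow> \<bar>L0 x' - L0 x\<bar> < \<delta>"
      using cL x d(1) unfolding continuous_on_iff dist_real_def by (metis atLeast_iff)
    show thesis
    proof (rule that[of "min d1 d2"])
      show "min d1 d2 > 0" using d1 d2 by simp
      fix x' assume x': "x' \<ge> xs" "\<bar>x' - x\<bar> < min d1 d2"
      have "\<bar>T0 x' - T0 x\<bar> < min \<delta> (T1 - T0 x)" "\<bar>L0 x' - L0 x\<bar> < \<delta>"
        using d1(2)[of x'] d2(2)[of x'] x' by auto
      moreover from this(1) have "T0 x' \<le> T1" by linarith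
      ultimately obtain r' l' where s': "sol (T0 x') (L0 x') T1 r' l'" "\<bar>l' T1 - l T1\<bar> < \<epsilon>2"
        using d(2)[of "T0 x'" "L0 x'"] T0(1)[OF x'(1)] by auto
      show "\<exists>T'. T0 x' \<le> T' \<and> T' < real n * pi + pi / 4 \<and> \<not> alive (T0 x') (L0 x') T'"
        by (rule must_die[OF x'(1) s'(1)]) (use T1 Ts2 al e2(2)[OF s'(2)] in auto)
    qed
  qed
qed

text \<open>\<open>start\<close> says that the smallest parameter has no energy at all, so every one
  of the sets below contains it; \<open>infty\<close> makes the amplitude grow without bound, so
  they are bounded above.\<close>

lemma shooting:
  fixes T0 L0 :: "real \<Rightarrow> real"
  assumes adm: "\<And>x. x \<ge> xs \<Longrightarrow> adm (T0 x)"
    and cT: "continuous_on {xs..} T0" and cL: "continuous_on {xs..} L0"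
    and start: "bb (T0 xs) (L0 xs) \<le> 0"
    and infty: "\<And>L. \<exists>X. \<forall>x\<ge>X. x \<ge> xs \<longrightarrow> L0 x \<le> L"
  obtains X :: "nat \<Rightarrow> real" where "strict_mono X" "\<not> bdd_above (range X)" "\<And>n. X n \<ge> xs"
    "\<And>n T. T0 (X n) \<le> T \<Longrightarrow> T < real n * pi + pi / 4 \<Longrightarrow> alive (T0 (X n)) (L0 (X n)) T"
    "\<And>n. \<not> alive (T0 (X n)) (L0 (X n)) (real n * pi + pi / 4)"
proof -
  have T0: "0 < T0 x" "T0 x < pi / 8" if "x \<ge> xs" for x using adm[OF that] by (auto simp: adm_def)
  have npi: "real n * pi \<ge> 0" for n :: nat by simp
  \<comment> \<open>The end of the solution lies strictly before the n-th diagonal. By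
    \<open>dies_early_open\<close> this set is relatively open in the half line, hence it cannot
    contain its supremum.\<close>
  define A where "A n = {x. x \<ge> xs \<and> (\<exists>T. T0 x \<le> T \<and> T < real n * pi + pi / 4 \<and> \<not> alive (T0 x) (L0 x) T)}" for n :: nat
  have xsA: "xs \<in> A n" for n
  proof -
    have "\<not> alive (T0 xs) (L0 xs) (T0 xs)" using start by (force simp: alive_def sol_def)
    moreover have "T0 xs < real n * pi + pi / 4" using T0[of xs] npi[of n] pi_gt_zero by linarith
    ultimately show ?thesis by (auto simp: A_def)
  qed
  have bdd: "bdd_above (A n)" for n
  proof -
    have "0 < real n * pi + pi / 4" using npi[of n] pi_gt_zero by linarith
    then obtain L where L: "\<And>t0 l0. 0 < t0 \<Longrightarrow> t0 \<le> real n * pi + pi / 4 \<Longrightarrow> l0 \<le> L \<Longrightarrow> alive t0 l0 (real n * pi + pi / 4)"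
      using alive_of_small_start by blast
    obtain X where X: "\<And>x. x \<ge> X \<Longrightarrow> x \<ge> xs \<Longrightarrow> L0 x \<le> L" using infty by blast
    have "x \<le> X" if x: "x \<in> A n" for x
    proof (rule ccontr)
      assume "\<not> x \<le> X"
      then have "L0 x \<le> L" using X[of x] x by (auto simp: A_def)
      then have "alive (T0 x) (L0 x) (real n * pi + pi / 4)"
        using T0[of x] x npi[of n] pi_gt_zero by (intro L) (auto simp: A_def)
      then have "alive (T0 x) (L0 x) T" if "T0 x \<le> T" "T < real n * pi + pi / 4" for T
        using alive_restrict that by auto
      then show False using x by (auto simp: A_def)
    qed
    then show ?thesis by (rule bdd_aboveI)
  qed
  define X where "X n = Sup (A n)" for n
  have Xge: "X n \<ge> xs" for n unfolding X_def by (rule cSup_upper[OF xsA bdd])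
  have upper: "x \<le> X n" if "x \<in> A n" for x n unfolding X_def by (rule cSup_upper[OF that bdd])
  have notA: "X n \<notin> A n" for n
  proof
    assume XA: "X n \<in> A n"
    then obtain Td where Td: "T0 (X n) \<le> Td" "Td < real n * pi + pi / 4" "\<not> alive (T0 (X n)) (L0 (X n)) Td"
      by (auto simp: A_def)
    obtain \<delta> where d: "\<delta> > 0" "\<And>x'. x' \<ge> xs \<Longrightarrow> \<bar>x' - X n\<bar> < \<delta> \<Longrightarrow>
      \<exists>T'. T0 x' \<le> T' \<and> T' < real n * pi + pi / 4 \<and> \<not> alive (T0 x') (L0 x') T'"
      using dies_early_open[OF adm cT cL Xge Td] by blast
    have "X n + \<delta> / 2 \<in> A n"
      using d Xge[of n] by (auto simp: A_def)
    from upper[OF this] show False using d(1) by simp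
  qed
  have live: "alive (T0 (X n)) (L0 (X n)) T" if "T0 (X n) \<le> T" "T < real n * pi + pi / 4" for n T
    using notA[of n] Xge[of n] that by (auto simp: A_def)
  have dead: "\<not> alive (T0 (X n)) (L0 (X n)) (real n * pi + pi / 4)" for n
  proof
    let ?T = "real n * pi + pi / 4"
    assume "alive (T0 (X n)) (L0 (X n)) ?T"
    then obtain r l where s: "sol (T0 (X n)) (L0 (X n)) ?T r l" by (auto simp: alive_def)
    obtain \<delta> where d: "\<delta> > 0"
      "\<And>t0 l0. \<bar>t0 - T0 (X n)\<bar> < \<delta> \<Longrightarrow> \<bar>l0 - L0 (X n)\<bar> < \<delta> \<Longrightarrow> 0 < t0 \<Longrightarrow> t0 \<le> ?T \<Longrightarrow>
       \<exists>r' l'. sol t0 l0 ?T r' l' \<and> \<bar>l' ?T - l ?T\<bar> < 1"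
      using sol_stable[OF s T0(1)[OF Xge], of 1] by auto
    obtain d1 where d1: "d1 > 0" "\<And>x'. x' \<in> {xs..} \<Longrightarrow> \<bar>x' - X n\<bar> < d1 \<Longrightarrow> \<bar>T0 x' - T0 (X n)\<bar> < \<delta>"
      using cT Xge[of n] d(1) unfolding continuous_on_iff dist_real_def by (metis atLeast_iff)
    obtain d2 where d2: "d2 > 0" "\<And>x'. x' \<in> {xs..} \<Longrightarrow> \<bar>x' - X n\<bar> < d2 \<Longrightarrow> \<bar>L0 x' - L0 (X n)\<bar> < \<delta>"
      using cL Xge[of n] d(1) unfolding continuous_on_iff dist_real_def by (metis atLeast_iff)
    \<comment> \<open>Parameters of \<open>A n\<close> come arbitrarily close to the supremum, but
      stability would make their solutions live up to the diagonal.\<close>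
    have "A n \<noteq> {}" using xsA by blast
    have "X n - min d1 d2 < Sup (A n)" using d1 d2 by (simp add: X_def)
    then obtain x where x: "x \<in> A n" "X n - min d1 d2 < x"
      using less_cSup_iff[OF \<open>A n \<noteq> {}\<close> bdd] by blast
    have xx: "x \<ge> xs" "\<bar>x - X n\<bar> < d1" "\<bar>x - X n\<bar> < d2" using x upper[OF x(1)] by (auto simp: A_def)
    have "T0 x \<le> ?T" using T0(2)[OF xx(1)] npi[of n] pi_gt_zero by linarith
    then have "\<exists>r' l'. sol (T0 x) (L0 x) ?T r' l' \<and> \<bar>l' ?T - l ?T\<bar> < 1"
      using d1(2)[of x] d2(2)[of x] T0[of x] xx by (intro d(2)) auto
    then have "alive (T0 x) (L0 x) ?T" by (auto simp: alive_def)
    then have "alive (T0 x) (L0 x) T" if "T0 x \<le> T" "T < ?T" for T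
      using alive_restrict that by auto
    then show False using x(1) by (auto simp: A_def)
  qed
  have mono: "strict_mono X"
  proof (rule strict_mono_Suc_iff[THEN iffD2], rule allI)
    fix n
    have "real n * pi + pi / 4 < real (Suc n) * pi + pi / 4" by (simp add: algebra_simps)
    then have "A n \<subseteq> A (Suc n)" unfolding A_def using less_trans by blast
    then have "X n \<le> X (Suc n)"
      unfolding X_def using xsA bdd by (intro cSup_subset_mono) auto
    \<comment> \<open>Equal parameters would give one solution that ends at the n-th diagonal and
      also lives up to the next one.\<close>
    moreover have "X n \<noteq> X (Suc n)"
    proof
      assume eq: "X n = X (Suc n)"
      have "alive (T0 (X (Suc n))) (L0 (X (Suc n))) (real n * pi + pi / 4)"
      proof (rule live)
        show "T0 (X (Suc n)) \<le> real n * pi + pi / 4"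
          using T0(2)[OF Xge[of "Suc n"]] npi[of n] pi_gt_zero by linarith
      qed (simp add: algebra_simps)
      with dead[of n] eq show False by simp
    qed
    ultimately show "X n < X (Suc n)" by simp
  qed
  \<comment> \<open>Every solution ends at a finite angle, so any parameter beyond a supposed bound
    belongs to \<open>A N\<close> for large N and lies below \<open>X N\<close>.\<close>
  have unb: "\<not> bdd_above (range X)"
  proof
    assume "bdd_above (range X)"
    then obtain Bd where Bd: "\<And>n. X n \<le> Bd" by (auto simp: bdd_above_def)
    define x where "x = max xs (Bd + 1)"
    have x: "x \<ge> xs" by (simp add: x_def)
    obtain N :: nat where N: "0 < N" "\<not> alive (T0 x) (L0 x) (real N * pi)"
      using not_always_alive[OF adm[OF x]] by blast
    have "1 * pi \<le> real N * pi" using N(1) by (intro mult_right_mono) auto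
    then have "T0 x \<le> real N * pi" using T0(2)[OF x] pi_gt_zero by linarith
    then have "x \<in> A N" using N x pi_gt_zero by (auto simp: A_def intro!: exI[of _ "real N * pi"])
    then have "x \<le> X N" by (rule upper)
    then show False using Bd[of N] by (simp add: x_def)
  qed
  show thesis
  proof (rule that[of X])
    show "alive (T0 (X n)) (L0 (X n)) T" if "T0 (X n) \<le> T" "T < real n * pi + pi / 4" for n T
      by (rule live[OF that])
  qed (rule mono unb Xge dead)+
qed

subsection \<open>The solution near the origin\<close>

definition cu :: "real \<Rightarrow> real" where "cu x = max (- 1 / 2) (min (1 / 2) x)"
definition cv :: "real \<Rightarrow> real" where "cv x = max (1 / 2) (min (3 / 2) x)"

text \<open>
  Near \<open>r = 0\<close> the solution is rescaled to \<open>u = x U\<close>, \<open>v = x V\<close>, with \<open>V 0 = 1\<close> and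
  \<open>\<mu> = x powr (2 p - 2)\<close>. The truncations are inactive on \<open>{0..r0}\<close>.
\<close>

definition qq :: "real \<Rightarrow> real \<times> real \<Rightarrow> real" where
  "qq \<mu> y = p * \<mu> * max (1 / 2) ((cv (snd y))\<^sup>2 - (cu (fst y))\<^sup>2) powr (p - 1)"
definition f1 :: "real \<Rightarrow> real \<times> real \<Rightarrow> real" where
  "f1 \<mu> y = cv (snd y) * (\<Omega> - m - qq \<mu> y)"
definition f2 :: "real \<Rightarrow> real \<times> real \<Rightarrow> real" where
  "f2 \<mu> y = - cu (fst y) * (qq \<mu> y + m + \<Omega>)"

section \<open>Estimates for the rescaled right-hand side\<close>

lemma half_powr_le: "(S :: real) \<ge> 1 / 2 \<Longrightarrow> S powr (p - 1) \<le> 2"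
proof -
  assume S: "S \<ge> 1 / 2"
  have "S powr (p - 1) \<le> (1 / 2) powr (p - 1)" using S p_small by (intro powr_mono2') auto
  also have "\<dots> \<le> (1 / 2) powr (- 1)" using p_pos by (intro powr_mono') auto
  also have "\<dots> = 2" by (simp add: powr_minus)
  finally show ?thesis .
qed

lemma powr_lipschitz:
  fixes S S' :: real
  assumes "S \<ge> 1 / 2" "S' \<ge> 1 / 2"
  shows "\<bar>S powr (p - 1) - S' powr (p - 1)\<bar> \<le> 4 * \<bar>S - S'\<bar>"
proof -
  have "norm (S powr (p - 1) - S' powr (p - 1)) \<le> 4 * norm (S - S')"
  proof (rule field_differentiable_bound[where S = "{1/2..}" and f' = "\<lambda>z. (p - 1) * z powr (p - 1 - 1)"])
    fix z :: real assume z: "z \<in> {1/2..}"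
    show "((\<lambda>z. z powr (p - 1)) has_field_derivative (p - 1) * z powr (p - 1 - 1)) (at z within {1/2..})"
      by (rule has_field_derivative_at_within[OF has_real_derivative_powr]) (use z in auto)
    have "z powr (p - 1 - 1) \<le> (1 / 2) powr (p - 1 - 1)" using z p_small by (intro powr_mono2') auto
    also have "\<dots> \<le> (1 / 2) powr (- 2)" using p_pos by (intro powr_mono') auto
    also have "\<dots> = 4" by (simp add: powr_minus powr_numeral power2_eq_square)
    finally have "z powr (p - 1 - 1) \<le> 4" .
    then have "(1 - p) * z powr (p - 1 - 1) \<le> 1 * 4" using p_pos p_small by (intro mult_mono) auto
    then show "norm ((p - 1) * z powr (p - 1 - 1)) \<le> 4" using p_small by (simp add: abs_mult)
  qed (use assms in auto)
  then show ?thesis by simp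
qed

lemma cu_bounds: "\<bar>cu x\<bar> \<le> 1 / 2" and cv_bounds: "1 / 2 \<le> cv x" "cv x \<le> 3 / 2"
  by (auto simp: cu_def cv_def)

lemma cu_lip: "\<bar>cu x - cu y\<bar> \<le> \<bar>x - y\<bar>" and cv_lip: "\<bar>cv x - cv y\<bar> \<le> \<bar>x - y\<bar>"
  by (auto simp: cu_def cv_def max_def min_def)

text \<open>The range of \<mu> belongs to the amplitudes used in the shooting; \<mu> decreases in x
  and equals \<open>2 * \<Omega>\<close> at the smallest one. Smallness of p keeps the nonlinear
  term a perturbation of \<Omega> even there.\<close>

lemma qq_bounds:
  assumes "\<mu> \<in> {0..2 * \<Omega>}"
  shows "0 \<le> qq \<mu> y" "qq \<mu> y \<le> \<Omega> / 5"
proof -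
  let ?h = "max (1 / 2) ((cv (snd y))\<^sup>2 - (cu (fst y))\<^sup>2) powr (p - 1)"
  have h: "?h \<le> 2" by (rule half_powr_le) simp
  show "0 \<le> qq \<mu> y" using assms p_pos by (simp add: qq_def)
  have "p * \<mu> * ?h \<le> 1 / 20 * (2 * \<Omega>) * 2"
    using assms p_pos p_small h Om_pos by (intro mult_mono) auto
  then show "qq \<mu> y \<le> \<Omega> / 5" by (simp add: qq_def)
qed

lemma qq_lip:
  assumes "\<mu> \<in> {0..2 * \<Omega>}" "\<nu> \<in> {0..2 * \<Omega>}"
  shows "\<bar>qq \<mu> y - qq \<nu> z\<bar> \<le> \<bar>\<mu> - \<nu>\<bar> + 2 * \<Omega> * (\<bar>fst y - fst z\<bar> + \<bar>snd y - snd z\<bar>)"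
proof -
  define S where "S = max (1 / 2) ((cv (snd y))\<^sup>2 - (cu (fst y))\<^sup>2)"
  define S' where "S' = max (1 / 2) ((cv (snd z))\<^sup>2 - (cu (fst z))\<^sup>2)"
  have S: "S \<ge> 1 / 2" "S' \<ge> 1 / 2" by (auto simp: S_def S'_def)
  have "\<bar>(cv (snd y))\<^sup>2 - (cv (snd z))\<^sup>2\<bar> = \<bar>cv (snd y) - cv (snd z)\<bar> * \<bar>cv (snd y) + cv (snd z)\<bar>"
    by (simp add: power2_eq_square algebra_simps flip: abs_mult)
  also have "\<dots> \<le> \<bar>snd y - snd z\<bar> * 3"
    using cv_bounds[of "snd y"] cv_bounds[of "snd z"] by (intro mult_mono cv_lip) auto
  finally have 1: "\<bar>(cv (snd y))\<^sup>2 - (cv (snd z))\<^sup>2\<bar> \<le> 3 * \<bar>snd y - snd z\<bar>" by simp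
  have "\<bar>(cu (fst y))\<^sup>2 - (cu (fst z))\<^sup>2\<bar> = \<bar>cu (fst y) - cu (fst z)\<bar> * \<bar>cu (fst y) + cu (fst z)\<bar>"
    by (simp add: power2_eq_square algebra_simps flip: abs_mult)
  also have "\<dots> \<le> \<bar>fst y - fst z\<bar> * 1"
    using cu_bounds[of "fst y"] cu_bounds[of "fst z"] by (intro mult_mono cu_lip) auto
  finally have 2: "\<bar>(cu (fst y))\<^sup>2 - (cu (fst z))\<^sup>2\<bar> \<le> \<bar>fst y - fst z\<bar>" by simp
  have SS: "\<bar>S - S'\<bar> \<le> 3 * \<bar>snd y - snd z\<bar> + \<bar>fst y - fst z\<bar>"
    using 1 2 unfolding S_def S'_def by linarith
  have "qq \<mu> y - qq \<nu> z = p * (\<mu> - \<nu>) * S powr (p - 1) + p * \<nu> * (S powr (p - 1) - S' powr (p - 1))"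
    unfolding qq_def S_def S'_def by (simp add: algebra_simps)
  then have "\<bar>qq \<mu> y - qq \<nu> z\<bar> \<le> \<bar>p * (\<mu> - \<nu>) * S powr (p - 1)\<bar> + \<bar>p * \<nu> * (S powr (p - 1) - S' powr (p - 1))\<bar>"
    by (metis abs_triangle_ineq)
  also have "\<bar>p * (\<mu> - \<nu>) * S powr (p - 1)\<bar> = p * \<bar>\<mu> - \<nu>\<bar> * S powr (p - 1)"
    using p_pos by (simp add: abs_mult)
  also have "\<dots> \<le> 1 / 20 * \<bar>\<mu> - \<nu>\<bar> * 2"
    using p_pos p_small half_powr_le[OF S(1)] by (intro mult_mono) auto
  also have "\<bar>p * \<nu> * (S powr (p - 1) - S' powr (p - 1))\<bar> = p * \<nu> * \<bar>S powr (p - 1) - S' powr (p - 1)\<bar>"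
    using p_pos assms by (simp add: abs_mult)
  also have "\<dots> \<le> 1 / 20 * (2 * \<Omega>) * (4 * (3 * \<bar>snd y - snd z\<bar> + \<bar>fst y - fst z\<bar>))"
    using p_pos p_small assms Om_pos SS powr_lipschitz[OF S] by (intro mult_mono) auto
  finally have "\<bar>qq \<mu> y - qq \<nu> z\<bar> \<le> 1 / 20 * \<bar>\<mu> - \<nu>\<bar> * 2
      + 1 / 20 * (2 * \<Omega>) * (4 * (3 * \<bar>snd y - snd z\<bar> + \<bar>fst y - fst z\<bar>))" by simp
  also have "\<dots> \<le> \<bar>\<mu> - \<nu>\<bar> + 2 * \<Omega> * (\<bar>fst y - fst z\<bar> + \<bar>snd y - snd z\<bar>)"
  proof -
    have "d + 2 * \<Omega> * (a + b) = 1 / 20 * d * 2 + 1 / 20 * (2 * \<Omega>) * (4 * (3 * b + a))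
        + (9 / 10 * d + 4 / 5 * (\<Omega> * b) + 8 / 5 * (\<Omega> * a))" for a b d
      by (simp add: algebra_simps)
    moreover have "\<Omega> * \<bar>snd y - snd z\<bar> \<ge> 0" "\<Omega> * \<bar>fst y - fst z\<bar> \<ge> 0" using Om_pos by auto
    ultimately show ?thesis by simp
  qed
  finally show ?thesis .
qed

text \<open>The Lipschitz estimate includes the parameter \<mu>, since the state at
  \<open>r0\<close> has to depend continuously on x.\<close>

lemma init_rhs_lip:
  assumes "\<mu> \<in> {0..2 * \<Omega>}" "\<nu> \<in> {0..2 * \<Omega>}"
  shows "\<bar>f1 \<mu> y - f1 \<nu> z\<bar> \<le> (5 * \<Omega> + 2) * (\<bar>fst y - fst z\<bar> + \<bar>snd y - snd z\<bar> + \<bar>\<mu> - \<nu>\<bar>)"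
    and "\<bar>f2 \<mu> y - f2 \<nu> z\<bar> \<le> (5 * \<Omega> + 2) * (\<bar>fst y - fst z\<bar> + \<bar>snd y - snd z\<bar> + \<bar>\<mu> - \<nu>\<bar>)"
proof -
  note q = qq_bounds[OF assms(1), of y]
  let ?E = "\<bar>\<mu> - \<nu>\<bar> + 2 * \<Omega> * (\<bar>fst y - fst z\<bar> + \<bar>snd y - snd z\<bar>)"
  have comb: "b * \<Omega> + 3 / 2 * (d + 2 * \<Omega> * (a + b)) \<le> (5 * \<Omega> + 2) * (a + b + d)"
    "a * (5 / 4 * \<Omega>) + 1 / 2 * (d + 2 * \<Omega> * (a + b)) \<le> (5 * \<Omega> + 2) * (a + b + d)"
    if "0 \<le> a" "0 \<le> b" "0 \<le> d" for a b d
  proof -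
    have e1: "(5 * \<Omega> + 2) * (a + b + d) = (b * \<Omega> + 3 / 2 * (d + 2 * \<Omega> * (a + b)))
        + (2 * (\<Omega> * a) + \<Omega> * b + 5 * (\<Omega> * d) + 2 * a + 2 * b + d / 2)"
      by (simp add: algebra_simps)
    have e2: "(5 * \<Omega> + 2) * (a + b + d) = (a * (5 / 4 * \<Omega>) + 1 / 2 * (d + 2 * \<Omega> * (a + b)))
        + (11 / 4 * (\<Omega> * a) + 4 * (\<Omega> * b) + 5 * (\<Omega> * d) + 2 * a + 2 * b + 3 / 2 * d)"
      by (simp add: algebra_simps)
    have nn: "0 \<le> \<Omega> * a" "0 \<le> \<Omega> * b" "0 \<le> \<Omega> * d" using that Om_pos by simp_all
    show "b * \<Omega> + 3 / 2 * (d + 2 * \<Omega> * (a + b)) \<le> (5 * \<Omega> + 2) * (a + b + d)"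
      unfolding e1 le_add_same_cancel1 using that nn by simp
    show "a * (5 / 4 * \<Omega>) + 1 / 2 * (d + 2 * \<Omega> * (a + b)) \<le> (5 * \<Omega> + 2) * (a + b + d)"
      unfolding e2 le_add_same_cancel1 using that nn by simp
  qed
  have "f1 \<mu> y - f1 \<nu> z = (cv (snd y) - cv (snd z)) * (\<Omega> - m - qq \<mu> y) + - cv (snd z) * (qq \<mu> y - qq \<nu> z)"
    unfolding f1_def by (simp add: algebra_simps)
  then have "\<bar>f1 \<mu> y - f1 \<nu> z\<bar> \<le> \<bar>cv (snd y) - cv (snd z)\<bar> * \<bar>\<Omega> - m - qq \<mu> y\<bar> + \<bar>- cv (snd z)\<bar> * \<bar>qq \<mu> y - qq \<nu> z\<bar>"
    by (metis abs_triangle_ineq abs_mult)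
  also have "\<dots> \<le> \<bar>snd y - snd z\<bar> * \<Omega> + 3 / 2 * ?E"
    using q m_pos Om_large Om_pos cv_bounds[of "snd z"] qq_lip[OF assms]
    by (intro add_mono mult_mono cv_lip) auto
  finally show "\<bar>f1 \<mu> y - f1 \<nu> z\<bar> \<le> (5 * \<Omega> + 2) * (\<bar>fst y - fst z\<bar> + \<bar>snd y - snd z\<bar> + \<bar>\<mu> - \<nu>\<bar>)"
    by (rule order_trans) (rule comb(1); simp)
  have "f2 \<mu> y - f2 \<nu> z = - (cu (fst y) - cu (fst z)) * (qq \<mu> y + m + \<Omega>) + - cu (fst z) * (qq \<mu> y - qq \<nu> z)"
    unfolding f2_def by (simp add: algebra_simps)
  then have "\<bar>f2 \<mu> y - f2 \<nu> z\<bar> \<le> \<bar>- (cu (fst y) - cu (fst z))\<bar> * \<bar>qq \<mu> y + m + \<Omega>\<bar> + \<bar>- cu (fst z)\<bar> * \<bar>qq \<mu> y - qq \<nu> z\<bar>"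
    by (metis abs_triangle_ineq abs_mult)
  also have "\<dots> \<le> \<bar>fst y - fst z\<bar> * (5 / 4 * \<Omega>) + 1 / 2 * ?E"
    using q m_pos Om_large Om_pos cu_bounds[of "fst z"] qq_lip[OF assms] cu_lip[of "fst y" "fst z"]
    by (intro add_mono mult_mono) auto
  finally show "\<bar>f2 \<mu> y - f2 \<nu> z\<bar> \<le> (5 * \<Omega> + 2) * (\<bar>fst y - fst z\<bar> + \<bar>snd y - snd z\<bar> + \<bar>\<mu> - \<nu>\<bar>)"
    by (rule order_trans) (rule comb(2); simp)
qed

lemma init_rhs_bounds:
  assumes "\<mu> \<in> {0..2 * \<Omega>}"
  shows "cv (snd y) * (3 / 4 * \<Omega>) \<le> f1 \<mu> y" "f1 \<mu> y \<le> cv (snd y) * \<Omega>" "\<bar>f2 \<mu> y\<bar> \<le> 5 / 8 * \<Omega>"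
proof -
  note q = qq_bounds[OF assms, of y]
  show "cv (snd y) * (3 / 4 * \<Omega>) \<le> f1 \<mu> y" "f1 \<mu> y \<le> cv (snd y) * \<Omega>"
    unfolding f1_def using q m_pos Om_large cv_bounds[of "snd y"] by (intro mult_left_mono; linarith)+
  have "\<bar>f2 \<mu> y\<bar> = \<bar>cu (fst y)\<bar> * \<bar>qq \<mu> y + m + \<Omega>\<bar>" by (simp add: f2_def abs_mult)
  also have "\<dots> \<le> 1 / 2 * (5 / 4 * \<Omega>)"
    using q m_pos Om_large Om_pos cu_bounds[of "fst y"] by (intro mult_mono) auto
  finally show "\<bar>f2 \<mu> y\<bar> \<le> 5 / 8 * \<Omega>" by simp
qed

lemma continuous_on_init_rhs:
  assumes "\<mu> \<in> {0..2 * \<Omega>}" "continuous_on S y"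
  shows "continuous_on S (\<lambda>s. f1 \<mu> (y s))" "continuous_on S (\<lambda>s. f2 \<mu> (y s))"
  unfolding f1_def f2_def qq_def cu_def cv_def
  by (intro continuous_intros assms; auto simp: max_def)+

definition init_sol :: "real \<Rightarrow> (real \<Rightarrow> real) \<Rightarrow> (real \<Rightarrow> real) \<Rightarrow> bool" where
  "init_sol \<mu> U V \<longleftrightarrow> continuous_on {0..r0} U \<and> continuous_on {0..r0} V \<and> U 0 = 0 \<and> V 0 = 1 \<and>
     (\<forall>r\<in>{0<..<r0}. (U has_real_derivative f1 \<mu> (U r, V r) - 2 * U r / r) (at r) \<and>
        (V has_real_derivative f2 \<mu> (U r, V r)) (at r))"

text \<open>The equation for U is integrated with the factor r^2, which absorbs the singular term 2
  U / r into a weighted average; the one for V is integrated directly.\<close>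

lemma init_sol_exists:
  assumes mu: "\<mu> \<in> {0..2 * \<Omega>}"
  obtains U V where "init_sol \<mu> U V"
proof -
  define L where "L = 5 * \<Omega> + 2"
  have L: "L > 0" using Om_pos by (simp add: L_def)
  define A where "A y = (\<lambda>r. if r = 0 then 0 else integral {0..r} (\<lambda>s. s\<^sup>2 * f1 \<mu> (y s)) / r\<^sup>2)" for y :: "real \<Rightarrow> real \<times> real"
  define Bq where "Bq y = (\<lambda>r. 1 + integral {0..r} (\<lambda>s. f2 \<mu> (y s)))" for y :: "real \<Rightarrow> real \<times> real"
  obtain y where cy: "continuous_on {0..r0} y" and fy: "\<And>t. t \<in> {0..r0} \<Longrightarrow> (A y t, Bq y t) = y t"
  \<comment> \<open>With weight \<open>4 * L * s\<close> each component of the difference of the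
    images is at most a quarter of the weighted distance, so the pair has the factor 1/2.\<close>
  proof (rule volterra_fixpoint[of 0 r0 "\<lambda>s. 4 * L * s" "\<lambda>y t. (A y t, Bq y t)"])
    show "continuous_on {0..r0} (\<lambda>s. 4 * L * s)" by (intro continuous_intros)
    show "continuous_on {0..r0} (\<lambda>t. (A y t, Bq y t))" if "continuous_on {0..r0} y" for y
      unfolding A_def Bq_def
      by (intro continuous_on_Pair weighted_average_continuous continuous_on_add continuous_on_const
          indefinite_integral_continuous_1 integrable_continuous_interval continuous_on_init_rhs[OF mu] that)
    fix y z :: "real \<Rightarrow> real \<times> real" and C t
    assume y: "continuous_on {0..r0} y" and z: "continuous_on {0..r0} z"
      and C: "\<And>s. s \<in> {0..r0} \<Longrightarrow> norm (y s - z s) \<le> C * exp (2 * (4 * L * s))" and t: "t \<in> {0..r0}"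
    have C0: "C \<ge> 0" using order_trans[OF norm_ge_zero C[of 0]] r0_pos by simp
    show "norm ((A y t, Bq y t) - (A z t, Bq z t)) \<le> C / 2 * exp (2 * (4 * L * t))"
    proof (cases "t = 0")
      case True
      then show ?thesis using C0 by (simp add: A_def Bq_def)
    next
      case False
      then have t0: "0 < t" using t by simp
      have sub: "{0..t} \<subseteq> {0..r0}" using t by auto
      have cyt: "continuous_on {0..t} y" "continuous_on {0..t} z"
        using y z sub continuous_on_subset by blast+
      define G where "G s = 2 * L * C * exp (8 * L * s)" for s
      have G: "(G has_integral (C / 4 * exp (8 * L * t) - C / 4 * exp (8 * L * 0))) {0..t}"
        unfolding G_def
        by (rule fundamental_theorem_of_calculus[where f = "\<lambda>s. C / 4 * exp (8 * L * s)"])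
          (use t0 in \<open>auto intro!: derivative_eq_intros simp flip: has_real_derivative_iff_has_vector_derivative\<close>)
      have cG: "continuous_on {0..t} G" unfolding G_def by (intro continuous_intros)
      have dl: "\<bar>fst (y s) - fst (z s)\<bar> + \<bar>snd (y s) - snd (z s)\<bar> \<le> 2 * (C * exp (8 * L * s))" if "s \<in> {0..t}" for s
      proof -
        have "\<bar>fst (y s) - fst (z s)\<bar> \<le> norm (y s - z s)"
          using norm_fst_le[of "fst (y s - z s)" "snd (y s - z s)"] unfolding prod.collapse by simp
        moreover have "norm (y s - z s) \<le> C * exp (8 * L * s)" using C[of s] that sub by (auto simp: mult.assoc)
        ultimately show ?thesis using abs_snd_diff_le[of "y s" "z s"] by linarith
      qed
      have d1: "\<bar>f1 \<mu> (y s) - f1 \<mu> (z s)\<bar> \<le> G s" if "s \<in> {0..t}" for s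
      proof -
        have "\<bar>f1 \<mu> (y s) - f1 \<mu> (z s)\<bar> \<le> L * (\<bar>fst (y s) - fst (z s)\<bar> + \<bar>snd (y s) - snd (z s)\<bar>)"
          using init_rhs_lip(1)[OF mu mu, of "y s" "z s"] by (simp add: L_def)
        also have "\<dots> \<le> L * (2 * (C * exp (8 * L * s)))" using L dl[OF that] by (intro mult_left_mono) auto
        finally show ?thesis by (simp add: G_def)
      qed
      have d2: "\<bar>f2 \<mu> (y s) - f2 \<mu> (z s)\<bar> \<le> G s" if "s \<in> {0..t}" for s
      proof -
        have "\<bar>f2 \<mu> (y s) - f2 \<mu> (z s)\<bar> \<le> L * (\<bar>fst (y s) - fst (z s)\<bar> + \<bar>snd (y s) - snd (z s)\<bar>)"
          using init_rhs_lip(2)[OF mu mu, of "y s" "z s"] by (simp add: L_def)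
        also have "\<dots> \<le> L * (2 * (C * exp (8 * L * s)))" using L dl[OF that] by (intro mult_left_mono) auto
        finally show ?thesis by (simp add: G_def)
      qed
      note c = continuous_on_init_rhs[OF mu cyt(1)] continuous_on_init_rhs[OF mu cyt(2)]
      have "A y t - A z t = integral {0..t} (\<lambda>s. s\<^sup>2 * (f1 \<mu> (y s) - f1 \<mu> (z s))) / t\<^sup>2"
        unfolding A_def right_diff_distrib using False
        by (subst integral_diff)
          (auto intro!: integrable_continuous_interval continuous_intros c simp: diff_divide_distrib)
      also have "\<bar>\<dots>\<bar> \<le> C / 4 * exp (8 * L * t) - C / 4 * exp (8 * L * 0)"
        by (rule weighted_average_bound[OF _ t0 G]) (auto intro!: continuous_intros c d1)
      finally have a: "\<bar>A y t - A z t\<bar> \<le> C / 4 * exp (8 * L * t)" using C0 by simp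
      have "Bq y t - Bq z t = integral {0..t} (\<lambda>s. f2 \<mu> (y s) - f2 \<mu> (z s))"
        unfolding Bq_def
        by (subst integral_diff) (auto intro!: integrable_continuous_interval c)
      also have "\<bar>\<dots>\<bar> \<le> integral {0..t} G"
        unfolding real_norm_def[symmetric]
        by (rule integral_norm_bound_integral)
          (use d2 in \<open>auto intro!: integrable_continuous_interval continuous_intros c cG\<close>)
      also have "\<dots> = C / 4 * exp (8 * L * t) - C / 4 * exp (8 * L * 0)" using G by (rule integral_unique)
      finally have b: "\<bar>Bq y t - Bq z t\<bar> \<le> C / 4 * exp (8 * L * t)" using C0 by simp
      have "norm ((A y t, Bq y t) - (A z t, Bq z t)) \<le> \<bar>A y t - A z t\<bar> + \<bar>Bq y t - Bq z t\<bar>"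
        using norm_Pair_le[of "A y t - A z t" "Bq y t - Bq z t"] by simp
      moreover have "2 * (4 * L * t) = 8 * L * t" by simp
      ultimately show ?thesis using a b by (simp only:)
    qed
  qed blast
  have eq: "fst (y t) = A y t" "snd (y t) = Bq y t" if "t \<in> {0..r0}" for t
    using fy[OF that] by (metis fst_conv, metis snd_conv)
  have "init_sol \<mu> (\<lambda>t. fst (y t)) (\<lambda>t. snd (y t))"
    unfolding init_sol_def
  proof (intro conjI ballI)
    show "continuous_on {0..r0} (\<lambda>t. fst (y t))" "continuous_on {0..r0} (\<lambda>t. snd (y t))"
      by (intro continuous_intros cy)+
    show "fst (y 0) = 0" "snd (y 0) = 1" using eq[of 0] r0_pos by (simp_all add: A_def Bq_def)
    fix r assume r: "r \<in> {0<..<r0}"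
    note c = continuous_on_init_rhs[OF mu cy]
    have eqA: "integral {0..r} (\<lambda>s. s\<^sup>2 * f1 \<mu> (y s)) / r\<^sup>2 = fst (y r)"
      using eq(1)[of r] r by (simp add: A_def)
    have "(A y has_real_derivative f1 \<mu> (y r) - 2 * (integral {0..r} (\<lambda>s. s\<^sup>2 * f1 \<mu> (y s)) / r\<^sup>2) / r) (at r)"
      unfolding A_def by (rule weighted_average_derivative[OF c(1)]) (use r in auto)
    then have "(A y has_real_derivative f1 \<mu> (fst (y r), snd (y r)) - 2 * fst (y r) / r) (at r)"
      by (simp only: eqA prod.collapse)
    then show "((\<lambda>t. fst (y t)) has_real_derivative f1 \<mu> (fst (y r), snd (y r)) - 2 * fst (y r) / r) (at r)"
      by (rule has_field_derivative_transform_within_open[OF _ open_greaterThanLessThan[of 0 r0]]) (use r eq in auto)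
    have "((\<lambda>r. integral {0..r} (\<lambda>s. f2 \<mu> (y s))) has_real_derivative f2 \<mu> (y r)) (at r within {0..r0})"
      using integral_has_real_derivative[OF c(2), of r] r by simp
    moreover have "at r within {0..r0} = at r" using r by (intro at_within_interior) auto
    ultimately have "(Bq y has_real_derivative f2 \<mu> (y r)) (at r)"
      unfolding Bq_def by (auto intro!: derivative_eq_intros)
    then have "(Bq y has_real_derivative f2 \<mu> (fst (y r), snd (y r))) (at r)" by simp
    then show "((\<lambda>t. snd (y t)) has_real_derivative f2 \<mu> (fst (y r), snd (y r))) (at r)"
      by (rule has_field_derivative_transform_within_open[OF _ open_greaterThanLessThan[of 0 r0]]) (use r eq in auto)
  qed
  then show thesis by (rule that)
qed

text \<open>The derivative of s^2 U is s^2 \<open>f1\<close>, which is compared with that of c s^3 /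
  3.\<close>

lemma init_sol_fst_bounds:
  assumes ph: "init_sol \<mu> U V" and r: "r \<in> {0..r0}"
    and c: "\<And>s. s \<in> {0<..<r0} \<Longrightarrow> c1 \<le> f1 \<mu> (U s, V s) \<and> f1 \<mu> (U s, V s) \<le> c2"
  shows "c1 * r / 3 \<le> U r" "U r \<le> c2 * r / 3"
proof -
  have cU: "continuous_on {0..r} U" using ph r unfolding init_sol_def by (auto intro: continuous_on_subset)
  have d: "((\<lambda>s. s\<^sup>2 * U s) has_real_derivative s\<^sup>2 * f1 \<mu> (U s, V s)) (at s)" if s: "0 < s" "s < r" for s
  proof -
    have "(U has_real_derivative f1 \<mu> (U s, V s) - 2 * U s / s) (at s)" using ph s r unfolding init_sol_def by auto
    then have "((\<lambda>s. s\<^sup>2 * U s) has_real_derivative 2 * s * U s + (f1 \<mu> (U s, V s) - 2 * U s / s) * s\<^sup>2) (at s)"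
      by (auto intro!: derivative_eq_intros)
    moreover have "2 * s * U s + (f1 \<mu> (U s, V s) - 2 * U s / s) * s\<^sup>2 = s\<^sup>2 * f1 \<mu> (U s, V s)"
      using s by (simp add: field_simps power2_eq_square)
    ultimately show ?thesis by simp
  qed
  have p3: "((\<lambda>s. k * s ^ 3 / 3) has_real_derivative k * s\<^sup>2) (at s)" for k s :: real
    by (auto intro!: derivative_eq_intros simp: power2_eq_square)
  have "c1 * r ^ 3 / 3 - r\<^sup>2 * U r \<le> c1 * 0 ^ 3 / 3 - 0\<^sup>2 * U 0"
  proof (rule DERIV_nonpos_imp_decreasing_open[of 0 r "\<lambda>s. c1 * s ^ 3 / 3 - s\<^sup>2 * U s"])
    fix s assume s: "0 < s" "s < r"
    have "c1 * s\<^sup>2 - s\<^sup>2 * f1 \<mu> (U s, V s) \<le> 0" using c[of s] s r by (simp add: mult.commute mult_left_mono)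
    then show "\<exists>d. ((\<lambda>s. c1 * s ^ 3 / 3 - s\<^sup>2 * U s) has_real_derivative d) (at s) \<and> d \<le> 0"
      using DERIV_diff[OF p3[of c1 s] d[OF s]] by blast
  qed (use r cU in \<open>auto intro!: continuous_intros\<close>)
  moreover have "r\<^sup>2 * U r - c2 * r ^ 3 / 3 \<le> 0\<^sup>2 * U 0 - c2 * 0 ^ 3 / 3"
  proof (rule DERIV_nonpos_imp_decreasing_open[of 0 r "\<lambda>s. s\<^sup>2 * U s - c2 * s ^ 3 / 3"])
    fix s assume s: "0 < s" "s < r"
    have "s\<^sup>2 * f1 \<mu> (U s, V s) - c2 * s\<^sup>2 \<le> 0" using c[of s] s r by (simp add: mult.commute mult_left_mono)
    then show "\<exists>d. ((\<lambda>s. s\<^sup>2 * U s - c2 * s ^ 3 / 3) has_real_derivative d) (at s) \<and> d \<le> 0"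
      using DERIV_diff[OF d[OF s] p3[of c2 s]] by blast
  qed (use r cU in \<open>auto intro!: continuous_intros\<close>)
  ultimately have *: "r\<^sup>2 * (c1 * r / 3) \<le> r\<^sup>2 * U r" "r\<^sup>2 * U r \<le> r\<^sup>2 * (c2 * r / 3)"
    by (simp_all add: power2_eq_square power3_eq_cube mult_ac)
  have U0: "U 0 = 0" using ph by (simp add: init_sol_def)
  show "c1 * r / 3 \<le> U r" "U r \<le> c2 * r / 3"
    using * U0 by (cases "r = 0"; simp add: mult_le_cancel_left)+
qed

lemma init_sol_bounds:
  assumes ph: "init_sol \<mu> U V" and mu: "\<mu> \<in> {0..2 * \<Omega>}" and r: "r \<in> {0..r0}"
  shows "99 / 100 \<le> V r" "V r \<le> 101 / 100" "\<Omega> / 8 * r \<le> U r" "U r \<le> 101 / 300 * \<Omega> * r"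
proof -
  have V: "99 / 100 \<le> V s \<and> V s \<le> 101 / 100" if s: "s \<in> {0..r0}" for s
  proof -
    have cV: "continuous_on {0..s} V" using ph s unfolding init_sol_def by (auto intro: continuous_on_subset)
    have "norm (V s - V 0) \<le> 5 / 8 * \<Omega> * s - 5 / 8 * \<Omega> * 0"
    proof (rule variation_bound[of "{}" 0 s "\<lambda>s. 5 / 8 * \<Omega> * s" "\<lambda>_. 5 / 8 * \<Omega>" V "\<lambda>s. f2 \<mu> (U s, V s)"])
      fix t assume t: "t \<in> {0<..<s} - {}"
      show "((\<lambda>s. 5 / 8 * \<Omega> * s) has_real_derivative 5 / 8 * \<Omega>) (at t)"
        by (auto intro!: derivative_eq_intros)
      show "(V has_vector_derivative f2 \<mu> (U t, V t)) (at t)"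
        using ph t s unfolding init_sol_def has_real_derivative_iff_has_vector_derivative by auto
      show "norm (f2 \<mu> (U t, V t)) \<le> 5 / 8 * \<Omega>" using init_rhs_bounds(3)[OF mu] by simp
    qed (use s cV in \<open>auto intro!: continuous_intros\<close>)
    also have "\<dots> \<le> 5 / 8 * \<Omega> * r0" using s Om_pos by simp
    also have "\<dots> \<le> 1 / 100" using Om_pos by (simp add: r0_def)
    finally have "\<bar>V s - V 0\<bar> \<le> 1 / 100" by simp
    moreover have "V 0 = 1" using ph by (simp add: init_sol_def)
    ultimately show ?thesis by linarith
  qed
  show "99 / 100 \<le> V r" "V r \<le> 101 / 100" using V[OF r] by auto
  have c: "3 / 8 * \<Omega> \<le> f1 \<mu> (U s, V s) \<and> f1 \<mu> (U s, V s) \<le> 101 / 100 * \<Omega>" if "s \<in> {0<..<r0}" for s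
  proof -
    have vs: "cv (V s) \<ge> 1 / 2" "cv (V s) \<le> 101 / 100" using V[of s] that by (auto simp: cv_def)
    have "1 / 2 * (3 / 4 * \<Omega>) \<le> cv (V s) * (3 / 4 * \<Omega>)" "cv (V s) * \<Omega> \<le> 101 / 100 * \<Omega>"
      using vs Om_pos by (intro mult_right_mono; simp)+
    then show ?thesis using init_rhs_bounds(1,2)[OF mu, of "(U s, V s)"] unfolding snd_conv by linarith
  qed
  show "\<Omega> / 8 * r \<le> U r" "U r \<le> 101 / 300 * \<Omega> * r"
    using init_sol_fst_bounds[OF ph r c] by simp_all
qed

lemma init_sol_rhs:
  assumes ph: "init_sol \<mu> U V" and mu: "\<mu> \<in> {0..2 * \<Omega>}" and r: "r \<in> {0..r0}"
  shows "f1 \<mu> (U r, V r) = V r * (\<Omega> - m - p * \<mu> * ((V r)\<^sup>2 - (U r)\<^sup>2) powr (p - 1))"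
    "f2 \<mu> (U r, V r) = - U r * (p * \<mu> * ((V r)\<^sup>2 - (U r)\<^sup>2) powr (p - 1) + m + \<Omega>)"
    "0 \<le> U r" "U r \<le> 1 / 100" "1 / 2 \<le> (V r)\<^sup>2 - (U r)\<^sup>2"
proof -
  note b = init_sol_bounds[OF ph mu r]
  have "0 \<le> \<Omega> / 8 * r" using Om_pos r by simp
  then show U0: "0 \<le> U r" using b(3) by linarith
  have "101 / 300 * \<Omega> * r \<le> 101 / 300 * \<Omega> * r0" using r Om_pos by simp
  also have "\<dots> \<le> 1 / 100" using Om_pos by (simp add: r0_def)
  finally show U1: "U r \<le> 1 / 100" using b(4) by linarith
  have "(99 / 100)\<^sup>2 \<le> (V r)\<^sup>2" using b by (intro power_mono) auto
  moreover have "(U r)\<^sup>2 \<le> (1 / 100)\<^sup>2" using U0 U1 by (intro power_mono) auto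
  ultimately show S: "1 / 2 \<le> (V r)\<^sup>2 - (U r)\<^sup>2" by (simp add: power2_eq_square)
  have "cu (U r) = U r" "cv (V r) = V r" using U0 U1 b by (auto simp: cu_def cv_def)
  then show "f1 \<mu> (U r, V r) = V r * (\<Omega> - m - p * \<mu> * ((V r)\<^sup>2 - (U r)\<^sup>2) powr (p - 1))"
    "f2 \<mu> (U r, V r) = - U r * (p * \<mu> * ((V r)\<^sup>2 - (U r)\<^sup>2) powr (p - 1) + m + \<Omega>)"
    using S by (simp_all add: f1_def f2_def qq_def max_absorb2)
qed

text \<open>Uniqueness is the case of equal parameters, so it does not matter which solution is
  chosen for each x.\<close>

lemma init_sol_dependence:
  assumes ph: "init_sol \<mu> U V" "init_sol \<nu> U' V'" and mu: "\<mu> \<in> {0..2 * \<Omega>}" "\<nu> \<in> {0..2 * \<Omega>}"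
  shows "\<bar>U r0 - U' r0\<bar> \<le> \<bar>\<mu> - \<nu>\<bar> * exp (6 * (5 * \<Omega> + 2) * r0)"
    "\<bar>V r0 - V' r0\<bar> \<le> \<bar>\<mu> - \<nu>\<bar> * exp (6 * (5 * \<Omega> + 2) * r0)"
proof -
  define L where "L = 5 * \<Omega> + 2"
  have L: "L > 0" using Om_pos by (simp add: L_def)
  \<comment> \<open>The parameter is carried along as a constant third component, which turns
    dependence on it into dependence on initial values.\<close>
  define y where "y = (\<lambda>r. (U r, V r, \<mu>))"
  define z where "z = (\<lambda>r. (U' r, V' r, \<nu>))"
  have c: "continuous_on {0..r0} U" "continuous_on {0..r0} V" "continuous_on {0..r0} U'" "continuous_on {0..r0} V'"
    using ph by (auto simp: init_sol_def)
  have "norm (y r0 - z r0) \<le> norm (y 0 - z 0) * exp (6 * L * r0 - 6 * L * 0)"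
  proof (rule gronwall_diff[where Z = "{}" and k = "\<lambda>_. 6 * L"
      and y' = "\<lambda>s. (f1 \<mu> (U s, V s) - 2 * U s / s, f2 \<mu> (U s, V s), 0)"
      and z' = "\<lambda>s. (f1 \<nu> (U' s, V' s) - 2 * U' s / s, f2 \<nu> (U' s, V' s), 0)"])
    show "continuous_on {0..r0} y" "continuous_on {0..r0} z"
      unfolding y_def z_def by (intro continuous_intros c)+
    fix s assume "s \<in> {0<..<r0} - {}"
    then have s: "s \<in> {0<..<r0}" by simp
    show "((\<lambda>s. 6 * L * s) has_real_derivative 6 * L) (at s)" by (auto intro!: derivative_eq_intros)
    show "(y has_vector_derivative (f1 \<mu> (U s, V s) - 2 * U s / s, f2 \<mu> (U s, V s), 0)) (at s)"
      "(z has_vector_derivative (f1 \<nu> (U' s, V' s) - 2 * U' s / s, f2 \<nu> (U' s, V' s), 0)) (at s)"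
      unfolding y_def z_def
      using ph s unfolding init_sol_def has_real_derivative_iff_has_vector_derivative
      by (auto intro!: has_vector_derivative_Pair)
    define a b d where "a = U s - U' s" and "b = V s - V' s" and "d = \<mu> - \<nu>"
    define A where "A = f1 \<mu> (U s, V s) - f1 \<nu> (U' s, V' s)"
    define B where "B = f2 \<mu> (U s, V s) - f2 \<nu> (U' s, V' s)"
    have A: "\<bar>A\<bar> \<le> L * (\<bar>a\<bar> + \<bar>b\<bar> + \<bar>d\<bar>)" and B: "\<bar>B\<bar> \<le> L * (\<bar>a\<bar> + \<bar>b\<bar> + \<bar>d\<bar>)"
      using init_rhs_lip[OF mu, of "(U s, V s)" "(U' s, V' s)"] by (simp_all add: A_def B_def a_def b_def d_def L_def)
    have "(y s - z s) \<bullet> ((f1 \<mu> (U s, V s) - 2 * U s / s, f2 \<mu> (U s, V s), 0) - (f1 \<nu> (U' s, V' s) - 2 * U' s / s, f2 \<nu> (U' s, V' s), 0))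
        = a * A - 2 * a\<^sup>2 / s + b * B"
      using s by (simp add: y_def z_def a_def b_def A_def B_def inner_prod_def field_simps power2_eq_square)
    \<comment> \<open>The friction contributes - 2 a^2 / s, whose sign is favourable; its
      coefficient has no Lipschitz bound near 0.\<close>
    also have "\<dots> \<le> \<bar>a\<bar> * \<bar>A\<bar> + \<bar>b\<bar> * \<bar>B\<bar>"
    proof -
      have "a * A \<le> \<bar>a\<bar> * \<bar>A\<bar>" "b * B \<le> \<bar>b\<bar> * \<bar>B\<bar>" by (metis abs_ge_self abs_mult)+
      moreover have "0 \<le> 2 * a\<^sup>2 / s" using s by simp
      ultimately show ?thesis by linarith
    qed
    also have "\<dots> \<le> \<bar>a\<bar> * (L * (\<bar>a\<bar> + \<bar>b\<bar> + \<bar>d\<bar>)) + \<bar>b\<bar> * (L * (\<bar>a\<bar> + \<bar>b\<bar> + \<bar>d\<bar>))"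
      using A B by (intro add_mono mult_left_mono) auto
    also have "\<dots> = L * ((\<bar>a\<bar> + \<bar>b\<bar>) * (\<bar>a\<bar> + \<bar>b\<bar> + \<bar>d\<bar>))" by (simp add: algebra_simps)
    also have "\<dots> \<le> L * (6 * (\<bar>a\<bar>\<^sup>2 + \<bar>b\<bar>\<^sup>2 + \<bar>d\<bar>\<^sup>2))"
    proof (rule mult_left_mono)
      have "(x + y) * (x + y + z) \<le> 6 * (x\<^sup>2 + y\<^sup>2 + z\<^sup>2)" for x y z :: real
      proof -
        have "(x + y) * (x + y + z) = x\<^sup>2 + y\<^sup>2 + 2 * (x * y) + x * z + y * z"
          by (simp add: algebra_simps power2_eq_square)
        moreover have "2 * (x * y) \<le> x\<^sup>2 + y\<^sup>2" "2 * (x * z) \<le> x\<^sup>2 + z\<^sup>2" "2 * (y * z) \<le> y\<^sup>2 + z\<^sup>2"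
          using sum_squares_bound[of x y] sum_squares_bound[of x z] sum_squares_bound[of y z] by (simp_all add: mult.assoc)
        ultimately show ?thesis
          using zero_le_power2[of x] zero_le_power2[of y] zero_le_power2[of z] unfolding distrib_left by linarith
      qed
      then show "(\<bar>a\<bar> + \<bar>b\<bar>) * (\<bar>a\<bar> + \<bar>b\<bar> + \<bar>d\<bar>) \<le> 6 * (\<bar>a\<bar>\<^sup>2 + \<bar>b\<bar>\<^sup>2 + \<bar>d\<bar>\<^sup>2)" .
    qed (use L in simp)
    also have "\<dots> = 6 * L * (norm (y s - z s))\<^sup>2"
      by (simp add: y_def z_def a_def b_def d_def norm_Pair power2_eq_square)
    finally show "(y s - z s) \<bullet> ((f1 \<mu> (U s, V s) - 2 * U s / s, f2 \<mu> (U s, V s), 0) - (f1 \<nu> (U' s, V' s) - 2 * U' s / s, f2 \<nu> (U' s, V' s), 0))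
        \<le> 6 * L * (norm (y s - z s))\<^sup>2" .
  qed (use r0_pos in \<open>auto intro!: continuous_intros\<close>)
  moreover have "norm (y 0 - z 0) = \<bar>\<mu> - \<nu>\<bar>"
    using ph by (simp add: y_def z_def init_sol_def norm_Pair)
  moreover have "\<bar>U r0 - U' r0\<bar> \<le> norm (y r0 - z r0)"
    using norm_fst_le[of "fst (y r0 - z r0)" "snd (y r0 - z r0)"] unfolding prod.collapse by (simp add: y_def z_def)
  moreover have "\<bar>V r0 - V' r0\<bar> \<le> norm (y r0 - z r0)"
  proof -
    have "\<bar>V r0 - V' r0\<bar> \<le> norm (V r0 - V' r0, \<mu> - \<nu>)"
      using norm_fst_le[of "V r0 - V' r0" "\<mu> - \<nu>"] by simp
    also have "\<dots> \<le> norm (y r0 - z r0)"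
      using norm_snd_le[of "(V r0 - V' r0, \<mu> - \<nu>)" "U r0 - U' r0"] by (simp add: y_def z_def)
    finally show ?thesis .
  qed
  ultimately show "\<bar>U r0 - U' r0\<bar> \<le> \<bar>\<mu> - \<nu>\<bar> * exp (6 * (5 * \<Omega> + 2) * r0)"
    "\<bar>V r0 - V' r0\<bar> \<le> \<bar>\<mu> - \<nu>\<bar> * exp (6 * (5 * \<Omega> + 2) * r0)"
    by (simp_all add: L_def)
qed

subsection \<open>Compactly supported solutions\<close>

text \<open>A return to the radius as independent variable: the radius is strictly increasing and
  bounded on the angular interval, so it can be inverted, and its supremum \<open>Re\<close> is
  where the origin is reached. \<open>Q\<close> is the square root of P.\<close>

lemma terminal_curve:
  assumes adm: "adm t0" and T: "T = real n * pi + pi / 4"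
    and live: "\<And>T'. t0 \<le> T' \<Longrightarrow> T' < T \<Longrightarrow> alive t0 l0 T'" and dead: "\<not> alive t0 l0 T"
  obtains Re g Q where "r0 < Re" "continuous_on {r0..Re} g" "continuous_on {r0..Re} Q"
    "g r0 = t0" "Q r0 = exp (- l0 / (2 * (1 - p)))" "Q Re = 0"
    "inj_on g {r0..Re}" "g ` {r0..<Re} = {t0..<T}" "\<And>\<rho>. \<rho> \<in> {r0..<Re} \<Longrightarrow> Q \<rho> > 0"
    "\<And>\<rho>. \<rho> \<in> {r0<..<Re} \<Longrightarrow> cos (2 * g \<rho>) \<noteq> 0 \<Longrightarrow>
       \<exists>L D. Q \<rho> = exp (- L / (2 * (1 - p))) \<and>
         D = \<Omega> - m * cos (2 * g \<rho>) - p * exp L * gam (g \<rho>) - sin (2 * g \<rho>) / \<rho> \<and>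
         (g has_real_derivative D) (at \<rho>) \<and>
         (Q has_real_derivative - (Q \<rho> * Nm (g \<rho>) \<rho> L / 2)) (at \<rho>)"
proof -
  have t0: "0 < t0" "t0 < pi / 8" using adm by (auto simp: adm_def)
  have "0 \<le> real n * pi" by simp
  then have t0T: "t0 < T" using t0 T pi_gt_zero by linarith
  obtain r l where s: "\<And>T'. t0 \<le> T' \<Longrightarrow> T' < T \<Longrightarrow> sol t0 l0 T' r l"
    using sol_glue[OF t0(1) t0T live] by blast
  have unb: "\<not> (\<exists>M. \<forall>t\<in>{t0..<T}. l t \<le> M)"
  proof
    assume "\<exists>M. \<forall>t\<in>{t0..<T}. l t \<le> M"
    then obtain M where M: "\<And>t. t \<in> {t0..<T} \<Longrightarrow> l t \<le> M" by blast
    obtain y :: "real \<Rightarrow> real \<times> real" where y: "bb T (snd (y T)) > 0 \<Longrightarrow> \<exists>T'>T. alive t0 l0 T'"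
      using sol_extend[OF t0(1) t0T s M] by blast
    \<comment> \<open>On the diagonal \<open>gam\<close> vanishes and \<open>bb\<close> is
      \<open>\<Omega>\<close>, so a bounded \<open>l\<close> would permit continuation. Hence
      \<open>l\<close> is unbounded and \<open>Q\<close> tends to 0.\<close>
    have "cos (2 * T) = 0" unfolding T using cos_double_shift[of n "pi / 4"] by simp
    then have "bb T l > 0" for l using Om_pos by (simp add: bb_def gam_def)
    then obtain T' where "T' > T" "alive t0 l0 T'" using y by blast
    then show False using alive_restrict[of t0 l0 T' T] dead t0T by auto
  qed
  \<comment> \<open>On compact subintervals the angular speed is bounded above, so the radius has a
    positive minimal slope.\<close>
  have strict: "r a < r b" if ab: "t0 \<le> a" "a < b" "b < T" for a b
  proof -
    have sb: "sol t0 l0 b r l" using ab by (intro s) auto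
    have cr: "continuous_on {t0..b} r" "continuous_on {t0..b} l" using sb by (auto simp: sol_def)
    have rn: "r s \<noteq> 0" if "s \<in> {t0..b}" for s using sol_r_pos[OF sb _ that] t0 by simp
    have "continuous_on {t0..b} (\<lambda>s. Dn s (r s) (l s))"
      unfolding Dn_def by (intro continuous_intros cr) (use rn in auto)
    then obtain B where B: "\<And>s. s \<in> {t0..b} \<Longrightarrow> Dn s (r s) (l s) \<le> B"
      using continuous_on_Icc_upper_bound by blast
    have B0: "B > 0" using B[of b] ab Dn_pos[of b "r b" "l b"] by auto
    have "r a + 1 / B * (b - a) \<le> r b"
    proof (rule monotone_with_slope)
      show "continuous_on {a..b} r" using cr(1) by (rule continuous_on_subset) (use ab in auto)
      fix u assume u: "u \<in> {a<..<b}" "cos (2 * u) \<noteq> 0"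
      show "(r has_real_derivative 1 / Dn u (r u) (l u)) (at u)"
        using sb u ab unfolding sol_def by auto
      show "1 / B \<le> 1 / Dn u (r u) (l u)"
        using B[of u] u ab B0 Dn_pos by (intro divide_left_mono mult_pos_pos) auto
    qed (use ab t0 in auto)
    moreover have "1 / B * (b - a) > 0" using B0 ab by simp
    ultimately show ?thesis by linarith
  qed
  have r_t0: "r t0 = r0" "l t0 = l0" using s[of t0] t0T by (auto simp: sol_def)
  have bound: "r a \<le> r0 + 8 / \<Omega> * (T - t0)" if a: "t0 \<le> a" "a < T" for a
  proof -
    have "r a \<le> r t0 + 8 / \<Omega> * (a - t0)"
      by (rule sol_r_growth(2)[OF s[OF a]]) (use t0 a in auto)
    also have "\<dots> \<le> r0 + 8 / \<Omega> * (T - t0)"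
      unfolding r_t0 using a Om_pos by (intro add_left_mono mult_left_mono) auto
    finally show ?thesis .
  qed
  define Re where "Re = Sup (r ` {t0..<T})"
  have bdd: "bdd_above (r ` {t0..<T})" using bound by (intro bdd_aboveI[of _ "r0 + 8 / \<Omega> * (T - t0)"]) auto
  have ne: "r ` {t0..<T} \<noteq> {}" using t0T by auto
  have r_less: "r a < Re" if a: "t0 \<le> a" "a < T" for a
  proof -
    have "r a < r ((a + T) / 2)" using a by (intro strict) auto
    also have "\<dots> \<le> Re" unfolding Re_def using a by (intro cSup_upper imageI bdd) auto
    finally show ?thesis .
  qed
  have r0Re: "r0 < Re" using r_less[of t0] t0T r_t0 by simp
  define rb where "rb a = (if a < T then r a else Re)" for a
  define q where "q a = (if a < T then exp (- l a / (2 * (1 - p))) else 0)" for a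
  \<comment> \<open>A monotone function converges to its supremum, which makes the extension
    \<open>rb\<close> continuous at \<open>T\<close>.\<close>
  have near: "\<exists>T1. t0 \<le> T1 \<and> T1 < T \<and> (\<forall>t\<in>{T1..T}. \<bar>rb t - rb T\<bar> < e)" if "e > 0" for e
  proof -
    obtain a where a: "a \<in> {t0..<T}" "Re - e < r a"
      using less_cSup_iff[OF ne bdd, of "Re - e"] \<open>e > 0\<close> unfolding Re_def by auto
    have "\<bar>rb t - rb T\<bar> < e" if t: "t \<in> {a..T}" for t
    proof (cases "t < T")
      case True
      have "r a \<le> r t" using strict[of a t] a t True by (cases "a = t") auto
      then show ?thesis using True r_less[of t] a t by (auto simp: rb_def)
    qed (use \<open>e > 0\<close> t in \<open>auto simp: rb_def\<close>)
    then show ?thesis using a by (intro exI[of _ a]) auto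
  qed
  have nearq: "\<exists>T1. t0 \<le> T1 \<and> T1 < T \<and> (\<forall>t\<in>{T1..T}. \<bar>q t - q T\<bar> < e)" if "e > 0" for e
  proof -
    obtain T1 where T1: "t0 < T1" "T1 < T" "\<And>t. t \<in> {T1..<T} \<Longrightarrow> - (2 * (1 - p)) * ln e + 1 \<le> l t"
      using l_unbounded_imp_at_top[OF adm t0T T s unb, of "- (2 * (1 - p)) * ln e + 1"] by blast
    have "\<bar>q t - q T\<bar> < e" if t: "t \<in> {T1..T}" for t
    proof (cases "t < T")
      case True
      then have "- (2 * (1 - p)) * ln e < l t" using T1(3)[of t] t by simp
      then have "- l t / (2 * (1 - p)) < ln e" using p_small by (simp add: field_simps)
      then have "exp (- l t / (2 * (1 - p))) < e" using \<open>e > 0\<close> by (metis exp_less_mono exp_ln)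
      then show ?thesis using True by (simp add: q_def)
    qed (use \<open>e > 0\<close> t in \<open>auto simp: q_def\<close>)
    then show ?thesis using T1 by (intro exI[of _ T1]) auto
  qed
  \<comment> \<open>Continuity on all shorter intervals together with convergence at the end
    point.\<close>
  have glue: "continuous_on {t0..T} f"
    if loc: "\<And>b. t0 \<le> b \<Longrightarrow> b < T \<Longrightarrow> continuous_on {t0..b} f"
      and fT: "\<And>e. e > 0 \<Longrightarrow> \<exists>T1. t0 \<le> T1 \<and> T1 < T \<and> (\<forall>t\<in>{T1..T}. \<bar>f t - f T\<bar> < e)" for f :: "real \<Rightarrow> real"
    unfolding continuous_on_eq_continuous_within
  proof
    fix a assume a: "a \<in> {t0..T}"
    show "continuous (at a within {t0..T}) f"
    proof (cases "a < T")
      case True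
      define b where "b = (a + T) / 2"
      have b: "a < b" "b < T" "t0 \<le> b" using True a by (auto simp: b_def)
      have "continuous (at a within {t0..b}) f"
        using loc[OF b(3,2)] a b unfolding continuous_on_eq_continuous_within by auto
      moreover have "at a within {t0..T} = at a within {t0..b}"
        by (rule at_within_nhd[of a "{..<b}"]) (use a b in auto)
      ultimately show ?thesis by simp
    next
      case False
      then have aT: "a = T" using a by simp
      show ?thesis
        unfolding aT continuous_within_eps_delta
      proof (intro allI impI)
        fix e :: real assume "e > 0"
        then obtain T1 where T1: "t0 \<le> T1" "T1 < T" "\<And>t. t \<in> {T1..T} \<Longrightarrow> \<bar>f t - f T\<bar> < e" using fT by blast
        show "\<exists>d>0. \<forall>x'\<in>{t0..T}. dist x' T < d \<longrightarrow> dist (f x') (f T) < e"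
          by (rule exI[of _ "T - T1"]) (use T1 in \<open>auto simp: dist_real_def\<close>)
      qed
    qed
  qed
  have crb: "continuous_on {t0..T} rb"
  proof (rule glue)
    fix b assume b: "t0 \<le> b" "b < T"
    have "continuous_on {t0..b} r" using s[OF b] by (simp add: sol_def)
    then show "continuous_on {t0..b} rb" by (rule continuous_on_eq) (use b in \<open>auto simp: rb_def\<close>)
  qed (rule near)
  have cq: "continuous_on {t0..T} q"
  proof (rule glue)
    fix b assume b: "t0 \<le> b" "b < T"
    have "continuous_on {t0..b} l" using s[OF b] by (simp add: sol_def)
    then have "continuous_on {t0..b} (\<lambda>a. exp (- l a / (2 * (1 - p))))"
      by (intro continuous_intros) (use p_small in auto)
    then show "continuous_on {t0..b} q" by (rule continuous_on_eq) (use b in \<open>auto simp: q_def\<close>)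
  qed (rule nearq)
  have rb_strict: "rb a < rb b" if "t0 \<le> a" "a < b" "b \<le> T" for a b
    using that strict[of a b] r_less[of a] by (auto simp: rb_def)
  then have inj: "inj_on rb {t0..T}"
    by (intro linorder_inj_onI') force
  have rb_le: "rb a \<le> rb b" if "t0 \<le> a" "a \<le> b" "b \<le> T" for a b
    using rb_strict[of a b] that by (cases "a = b") auto
  have rb_ends: "rb t0 = r0" "rb T = Re" using t0T r_t0 by (auto simp: rb_def)
  have img: "rb ` {t0..T} = {r0..Re}"
  proof
    show "rb ` {t0..T} \<subseteq> {r0..Re}" using rb_le[of t0] rb_le[of _ T] t0T rb_ends by auto
    show "{r0..Re} \<subseteq> rb ` {t0..T}"
    proof
      fix \<rho> assume "\<rho> \<in> {r0..Re}"
      then have "\<exists>a. t0 \<le> a \<and> a \<le> T \<and> rb a = \<rho>" using crb t0T rb_ends by (intro IVT') auto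
      then show "\<rho> \<in> rb ` {t0..T}" by auto
    qed
  qed
  define g where "g = the_inv_into {t0..T} rb"
  have g_rb: "g (rb a) = a" if "a \<in> {t0..T}" for a
    unfolding g_def by (rule the_inv_into_f_f[OF inj that])
  have rb_g: "rb (g \<rho>) = \<rho>" and g_in: "g \<rho> \<in> {t0..T}" if "\<rho> \<in> {r0..Re}" for \<rho>
    using that img g_rb by (metis imageE)+
  have cg: "continuous_on {r0..Re} g"
    unfolding img[symmetric] by (rule continuous_on_inv[OF crb compact_Icc]) (use g_rb in auto)
  have g_ends: "g r0 = t0" "g Re = T" using g_rb[of t0] g_rb[of T] rb_ends t0T by auto
  have g_less: "g \<rho> < T" if "\<rho> \<in> {r0..<Re}" for \<rho>
    using g_in[of \<rho>] rb_g[of \<rho>] that rb_ends(2) by (cases "g \<rho> = T") auto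
  have g_gt: "t0 < g \<rho>" if "\<rho> \<in> {r0<..Re}" for \<rho>
    using g_in[of \<rho>] rb_g[of \<rho>] that rb_ends(1) by (cases "g \<rho> = t0") auto
  define Q where "Q \<rho> = q (g \<rho>)" for \<rho>
  show thesis
  proof (rule that[of Re g Q])
    show "r0 < Re" by (rule r0Re)
    show "continuous_on {r0..Re} g" by (rule cg)
    show "continuous_on {r0..Re} Q"
      unfolding Q_def by (rule continuous_on_compose2[OF cq cg]) (use g_in in auto)
    show "g r0 = t0" by (rule g_ends)
    show "Q r0 = exp (- l0 / (2 * (1 - p)))" using t0T by (simp add: Q_def g_ends q_def r_t0)
    show "Q Re = 0" by (simp add: Q_def g_ends q_def)
    show "inj_on g {r0..Re}" using rb_g by (metis inj_onI)
    show "g ` {r0..<Re} = {t0..<T}"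
    proof
      show "g ` {r0..<Re} \<subseteq> {t0..<T}" using g_in g_less by force
      show "{t0..<T} \<subseteq> g ` {r0..<Re}"
      proof
        fix a assume a: "a \<in> {t0..<T}"
        then have "rb a \<in> {r0..<Re}" using rb_le[of t0 a] rb_strict[of a T] rb_ends by auto
        moreover have "g (rb a) = a" using a by (intro g_rb) auto
        ultimately show "a \<in> g ` {r0..<Re}" by (metis imageI)
      qed
    qed
    show "Q \<rho> > 0" if "\<rho> \<in> {r0..<Re}" for \<rho> using g_less[OF that] by (simp add: Q_def q_def)
    fix \<rho> assume \<rho>: "\<rho> \<in> {r0<..<Re}" and nz: "cos (2 * g \<rho>) \<noteq> 0"
    define a where "a = g \<rho>"
    have a: "t0 < a" "a < T" using g_gt[of \<rho>] g_less[of \<rho>] \<rho> by (auto simp: a_def)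
    define b where "b = (a + T) / 2"
    have b: "a < b" "b < T" using a by (auto simp: b_def)
    have sb: "sol t0 l0 b r l" using a b by (intro s) auto
    have ra: "r a = \<rho>" using rb_g[of \<rho>] \<rho> a by (simp add: a_def rb_def split: if_splits)
    define D where "D = Dn a (r a) (l a)"
    have D0: "D > 0" unfolding D_def by (rule Dn_pos)
    have D: "D = \<Omega> - m * cos (2 * a) - p * exp (l a) * gam a - sin (2 * a) / \<rho>"
      unfolding D_def using sol_Dn[OF sb adm, of a] a b by (simp add: ra)
    have dr: "(r has_real_derivative 1 / D) (at a)" and dll: "(l has_real_derivative dl a (r a) (l a)) (at a)"
      using sb a b nz unfolding sol_def D_def a_def by auto
    have drb: "(rb has_real_derivative 1 / D) (at a)"
      by (rule has_field_derivative_transform_within_open[OF dr open_lessThan[of T]])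
        (use a in \<open>auto simp: rb_def\<close>)
    have "isCont g \<rho>"
      using cg \<rho> by (simp add: continuous_on_interior)
    then have dg: "(g has_real_derivative inverse (1 / D)) (at \<rho>)"
      by (intro DERIV_inverse_function[where f = rb and a = r0 and b = Re])
        (use drb D0 \<rho> rb_g in \<open>auto simp: a_def\<close>)
    then have dg': "(g has_real_derivative D) (at \<rho>)" by simp
    have "((\<lambda>a. exp (- l a / (2 * (1 - p)))) has_real_derivative
        exp (- l a / (2 * (1 - p))) * (- dl a (r a) (l a) / (2 * (1 - p)))) (at a)"
      by (rule DERIV_fun_exp[OF DERIV_cdivide[OF DERIV_minus[OF dll]]])
    then have "(q has_real_derivative exp (- l a / (2 * (1 - p))) * (- dl a (r a) (l a) / (2 * (1 - p)))) (at a)"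
      by (rule has_field_derivative_transform_within_open[OF _ open_lessThan[of T]])
        (use a in \<open>auto simp: q_def\<close>)
    from DERIV_chain2[OF this[unfolded a_def] dg']
    have "(Q has_real_derivative exp (- l a / (2 * (1 - p))) * (- dl a (r a) (l a) / (2 * (1 - p))) * D) (at \<rho>)"
      unfolding Q_def[abs_def] a_def .
    moreover have "E * (- dl a (r a) (l a) / (2 * (1 - p))) * D = - (E * Nm a (r a) (l a) / 2)" for E
    proof -
      have h: "dl a (r a) (l a) * D = (1 - p) * Nm a (r a) (l a)"
        using D0 by (simp add: dl_def D_def)
      have "E * (- dl a (r a) (l a) / (2 * (1 - p))) * D = - E * (dl a (r a) (l a) * D) / (2 * (1 - p))"
        by simp
      also have "\<dots> = - (E * Nm a (r a) (l a) / 2)"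
        unfolding h using p_small by (simp add: field_simps)
      finally show ?thesis .
    qed
    moreover have Qr: "Q \<rho> = exp (- l a / (2 * (1 - p)))" using a by (simp add: Q_def q_def a_def)
    ultimately have "(Q has_real_derivative - (Q \<rho> * Nm a \<rho> (l a) / 2)) (at \<rho>)"
      by (simp only: ra)
    then show "\<exists>L D. Q \<rho> = exp (- L / (2 * (1 - p))) \<and>
         D = \<Omega> - m * cos (2 * g \<rho>) - p * exp L * gam (g \<rho>) - sin (2 * g \<rho>) / \<rho> \<and>
         (g has_real_derivative D) (at \<rho>) \<and>
         (Q has_real_derivative - (Q \<rho> * Nm (g \<rho>) \<rho> L / 2)) (at \<rho>)"
      using Qr D dg' unfolding a_def by (intro exI[of _ "l (g \<rho>)"] exI[of _ D]) simp
  qed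
qed

definition field :: "real \<Rightarrow> real \<times> real \<Rightarrow> real \<times> real" where
  "field r w = (snd w * (- F p ((snd w)\<^sup>2 - (fst w)\<^sup>2) - (m - \<Omega>)) - 2 * fst w / r,
     fst w * (- F p ((snd w)\<^sup>2 - (fst w)\<^sup>2) - (m + \<Omega>)))"

lemma dirac_system_field: "dirac_system p m \<Omega> r w (field r w)"
  by (simp add: dirac_system_def field_def split: prod.splits)

text \<open>\<open>F p\<close> is discontinuous at 0, so continuity along a curve is available only
  off the diagonals, where the case distinction in \<open>F\<close> is locally constant.\<close>

lemma isCont_field:
  assumes w: "isCont w r" and r: "r \<noteq> 0" and nz: "(snd (w r))\<^sup>2 - (fst (w r))\<^sup>2 \<noteq> 0"
  shows "isCont (\<lambda>r. field r (w r)) r"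
proof -
  let ?s = "\<lambda>r. (snd (w r))\<^sup>2 - (fst (w r))\<^sup>2"
  have cs: "isCont ?s r" using w by (intro continuous_intros)
  have c: "isCont (\<lambda>r. p * \<bar>?s r\<bar> powr (p - 1)) r"
    using w nz by (intro continuous_intros) auto
  have ev: "\<forall>\<^sub>F x in nhds r. p * \<bar>?s x\<bar> powr (p - 1) = F p (?s x)"
  proof -
    have "(?s \<longlongrightarrow> ?s r) (nhds r)"
      using cs unfolding isCont_def by (rule tendsto_at_iff_tendsto_nhds[THEN iffD1])
    then have "\<forall>\<^sub>F x in nhds r. ?s x \<noteq> 0"
      using nz by (rule tendsto_imp_eventually_ne)
    then show ?thesis by eventually_elim (simp add: F_def)
  qed
  have cF: "isCont (\<lambda>r. F p (?s r)) r"
    using c unfolding isCont_cong[OF ev] .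
  show ?thesis
    unfolding field_def by (intro continuous_intros cF w) (use r in auto)
qed

text \<open>The polar substitution read backwards: the angular equations for \<open>Q\<close> and
  \<theta> reproduce the right-hand side of the system.\<close>

lemma polar_field:
  fixes \<rho> \<theta> L Q :: real
  assumes Q: "Q = exp (- L / (2 * (1 - p)))" and nz: "cos (2 * \<theta>) \<noteq> 0" and rho: "\<rho> > 0"
    and D: "D = \<Omega> - m * cos (2 * \<theta>) - p * exp L * gam \<theta> - sin (2 * \<theta>) / \<rho>"
  shows "field \<rho> (Q * sin \<theta>, Q * cos \<theta>) =
      (- (Q * Nm \<theta> \<rho> L / 2) * sin \<theta> + Q * (cos \<theta> * D), - (Q * Nm \<theta> \<rho> L / 2) * cos \<theta> + Q * (- sin \<theta> * D))"
    and "(Q * cos \<theta>)\<^sup>2 - (Q * sin \<theta>)\<^sup>2 \<noteq> 0"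
proof -
  have Q0: "Q > 0" by (simp add: Q)
  have s: "(Q * cos \<theta>)\<^sup>2 - (Q * sin \<theta>)\<^sup>2 = Q\<^sup>2 * cos (2 * \<theta>)"
    unfolding cos_double by (simp add: power_mult_distrib right_diff_distrib)
  then show nz': "(Q * cos \<theta>)\<^sup>2 - (Q * sin \<theta>)\<^sup>2 \<noteq> 0" using Q0 nz by simp
  have "Q\<^sup>2 = exp (- L / (1 - p))" unfolding Q by (simp add: power2_eq_square flip: exp_add) (use p_small in \<open>simp add: field_simps\<close>)
  then have "Q\<^sup>2 powr (p - 1) = exp L" using p_small by (simp add: powr_def field_simps)
  then have FX: "F p ((Q * cos \<theta>)\<^sup>2 - (Q * sin \<theta>)\<^sup>2) = p * exp L * kap \<theta>"
    using nz' unfolding F_def s by (simp add: abs_mult powr_mult kap_def)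
  define X where "X = p * exp L * kap \<theta>"
  define S C where "S = sin \<theta>" and "C = cos \<theta>"
  have SC: "C * C = 1 - S * S" using sin_cos_squared_add3[of \<theta>] unfolding S_def C_def by linarith
  have N: "Nm \<theta> \<rho> L = 4 * S * C * (X + m) + 4 * (S * S) / \<rho>"
    by (simp add: Nm_def X_def S_def C_def sin_double power2_eq_square)
  have DD: "D = \<Omega> - (m + X) * (1 - 2 * (S * S)) - 2 * S * C / \<rho>"
  proof -
    have "cos (2 * \<theta>) = 1 - 2 * (S * S)" "sin (2 * \<theta>) = 2 * S * C"
      by (simp_all add: S_def C_def sin_double cos_double_sin power2_eq_square)
    then show ?thesis unfolding D gam_eq X_def by (simp only:) (simp add: algebra_simps)
  qed
  have "C * (- X - (m - \<Omega>)) - 2 * S / \<rho> = - ((4 * S * C * (X + m) + 4 * (S * S) / \<rho>) / 2) * S + C * D"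
  proof -
    have "- ((4 * S * C * (X + m) + 4 * (S * S) / \<rho>) / 2) * S + C * D =
        C * (\<Omega> - (m + X)) - 2 * S * (S * S) / \<rho> - 2 * S * (C * C) / \<rho>"
      unfolding DD by (simp add: algebra_simps add_divide_distrib)
    also have "\<dots> = C * (\<Omega> - (m + X)) - 2 * S / \<rho>"
      unfolding SC by (simp add: algebra_simps diff_divide_distrib)
    finally show ?thesis by (simp add: algebra_simps)
  qed
  moreover have "S * (- X - (m + \<Omega>)) = - ((4 * S * C * (X + m) + 4 * (S * S) / \<rho>) / 2) * C + - S * D"
  proof -
    have "- ((4 * S * C * (X + m) + 4 * (S * S) / \<rho>) / 2) * C + - S * D =
        - 2 * S * (X + m) * (C * C) - S * \<Omega> + S * (m + X) - 2 * S * (S * S) * (m + X)"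
      unfolding DD by (simp add: algebra_simps add_divide_distrib)
    also have "\<dots> = - S * (X + m) - S * \<Omega>"
      unfolding SC by (simp add: algebra_simps)
    finally show ?thesis by (simp add: algebra_simps)
  qed
  ultimately have "Q * (C * (- X - (m - \<Omega>)) - 2 * S / \<rho>) = Q * (- (Nm \<theta> \<rho> L / 2) * S + C * D)"
    "Q * (S * (- X - (m + \<Omega>))) = Q * (- (Nm \<theta> \<rho> L / 2) * C + - S * D)"
    unfolding N by simp_all
  then show "field \<rho> (Q * sin \<theta>, Q * cos \<theta>) =
      (- (Q * Nm \<theta> \<rho> L / 2) * sin \<theta> + Q * (cos \<theta> * D), - (Q * Nm \<theta> \<rho> L / 2) * cos \<theta> + Q * (- sin \<theta> * D))"
    unfolding field_def fst_conv snd_conv FX X_def[symmetric] S_def C_def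
    by (simp add: algebra_simps)
qed

text \<open>The curve has three pieces: the rescaled solution near the origin, the polar curve up to
  \<open>Re\<close>, and zero. Crossings can occur on the second piece only, where they correspond
  to zeros of the cosine of the angle.\<close>

lemma compact_solution:
  assumes x: "x > 0" and mu: "\<mu> = x powr (2 * p - 2)" "\<mu> \<in> {0..2 * \<Omega>}" and ph: "init_sol \<mu> U V"
    and t0: "t0 = arctan (U r0 / V r0)" and l0: "l0 = (p - 1) * ln (x\<^sup>2 * ((U r0)\<^sup>2 + (V r0)\<^sup>2))"
    and adm: "adm t0" and T: "T = real n * pi + pi / 4"
    and live: "\<And>T'. t0 \<le> T' \<Longrightarrow> T' < T \<Longrightarrow> alive t0 l0 T'" and dead: "\<not> alive t0 l0 T"
  shows "\<exists>u v. extended_solution {0..} (dirac_system p m \<Omega>) (\<lambda>r. (u r, v r)) \<and> (u 0, v 0) = (0, x) \<and>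
    compactly_supported_on {0..} (\<lambda>r. (u r, v r)) \<and>
    crosses_exactly {0..} (\<lambda>r. (u r, v r)) {(a, 0) |a. a \<noteq> 0} n"
proof -
  obtain Re g Q where Re: "r0 < Re" and cg: "continuous_on {r0..Re} g" and cQ: "continuous_on {r0..Re} Q"
    and g0: "g r0 = t0" and Q0: "Q r0 = exp (- l0 / (2 * (1 - p)))" and QRe: "Q Re = 0"
    and inj: "inj_on g {r0..Re}" and img: "g ` {r0..<Re} = {t0..<T}" and Qpos: "\<And>\<rho>. \<rho> \<in> {r0..<Re} \<Longrightarrow> Q \<rho> > 0"
    and der: "\<And>\<rho>. \<rho> \<in> {r0<..<Re} \<Longrightarrow> cos (2 * g \<rho>) \<noteq> 0 \<Longrightarrow>
       \<exists>L D. Q \<rho> = exp (- L / (2 * (1 - p))) \<and>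
         D = \<Omega> - m * cos (2 * g \<rho>) - p * exp L * gam (g \<rho>) - sin (2 * g \<rho>) / \<rho> \<and>
         (g has_real_derivative D) (at \<rho>) \<and>
         (Q has_real_derivative - (Q \<rho> * Nm (g \<rho>) \<rho> L / 2)) (at \<rho>)"
    using terminal_curve[OF adm T live dead] by blast
  define w where "w r = (if r \<le> r0 then (x * U r, x * V r)
      else if r \<le> Re then (Q r * sin (g r), Q r * cos (g r)) else (0, 0))" for r
  have V0: "V r0 > 0" using init_sol_bounds(1)[OF ph mu(2), of r0] r0_pos by auto
  \<comment> \<open>The initial data \<open>t0\<close> and \<open>l0\<close> are exactly the polar
    coordinates of the end point of the first piece.\<close>
  have glue0: "Q r0 * sin (g r0) = x * U r0" "Q r0 * cos (g r0) = x * V r0"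
  proof -
    have UV: "(U r0)\<^sup>2 + (V r0)\<^sup>2 > 0" using V0 by (simp add: add_nonneg_pos)
    have "Q r0 = exp (ln (x\<^sup>2 * ((U r0)\<^sup>2 + (V r0)\<^sup>2)) / 2)"
      unfolding Q0 l0 using p_small by (simp add: field_simps)
    also have "\<dots> = sqrt (x\<^sup>2 * ((U r0)\<^sup>2 + (V r0)\<^sup>2))"
      using UV V0 x by (simp add: powr_half_sqrt[symmetric] powr_def)
    also have "\<dots> = x * sqrt ((U r0)\<^sup>2 + (V r0)\<^sup>2)" using x by (simp add: real_sqrt_mult)
    finally have q: "Q r0 = x * sqrt ((U r0)\<^sup>2 + (V r0)\<^sup>2)" .
    have "1 + (U r0 / V r0)\<^sup>2 = ((U r0)\<^sup>2 + (V r0)\<^sup>2) / (V r0)\<^sup>2"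
      using V0 by (simp add: power_divide field_simps)
    then have sq: "sqrt (1 + (U r0 / V r0)\<^sup>2) = sqrt ((U r0)\<^sup>2 + (V r0)\<^sup>2) / V r0"
      using V0 by (simp add: real_sqrt_divide)
    show "Q r0 * sin (g r0) = x * U r0" "Q r0 * cos (g r0) = x * V r0"
      unfolding q g0 t0 sin_arctan cos_arctan sq using V0 UV by simp_all
  qed
  have cw: "continuous_on {0..} w"
  proof -
    have 1: "continuous_on {0..r0} w"
    proof (rule continuous_on_eq)
      show "continuous_on {0..r0} (\<lambda>r. (x * U r, x * V r))"
        using ph unfolding init_sol_def by (intro continuous_intros) auto
    qed (simp add: w_def)
    have 2: "continuous_on {r0..Re} w"
    proof (rule continuous_on_eq)
      show "continuous_on {r0..Re} (\<lambda>r. (Q r * sin (g r), Q r * cos (g r)))"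
        by (intro continuous_intros cQ cg)
      show "(Q r * sin (g r), Q r * cos (g r)) = w r" if "r \<in> {r0..Re}" for r
        using that glue0 by (cases "r = r0") (auto simp: w_def)
    qed
    have 3: "continuous_on {Re..} w"
    proof (rule continuous_on_eq)
      show "continuous_on {Re..} (\<lambda>r. (0 :: real, 0 :: real))" by (intro continuous_intros)
      show "(0, 0) = w r" if "r \<in> {Re..}" for r
        using that Re QRe by (cases "r = Re") (auto simp: w_def)
    qed
    have "continuous_on (({0..r0} \<union> {r0..Re}) \<union> {Re..}) w"
      by (intro continuous_on_closed_Un 1 2 3 closed_Un) auto
    moreover have "({0..r0} \<union> {r0..Re}) \<union> {Re..} = {0..}" using Re r0_pos by auto
    ultimately show ?thesis by simp
  qed
  define Z where "Z = {r \<in> {r0..<Re}. cos (2 * g r) = 0}"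
  have "finite Z"
  proof -
    have "finite {s \<in> {t0..T}. cos (2 * s) = 0}"
      using adm by (intro finite_cos_double_zeros) (simp add: adm_def)
    moreover have "g r \<in> {t0..<T}" if "r \<in> Z" for r
      unfolding img[symmetric] using that by (auto simp: Z_def)
    then have "g ` Z \<subseteq> {s \<in> {t0..T}. cos (2 * s) = 0}" by (force simp: Z_def)
    ultimately have "finite (g ` Z)" by (rule finite_subset[rotated])
    moreover have "inj_on g Z" using inj by (rule inj_on_subset) (auto simp: Z_def)
    ultimately show ?thesis by (rule finite_imageD)
  qed
  \<comment> \<open>Besides the diagonals, both joining radii are treated as exceptional; the
    extended sense permits any finite set.\<close>
  define S where "S = insert r0 (insert Re Z)"
  have S: "finite S" "S \<subseteq> {0..}" using \<open>finite Z\<close> r0_pos Re by (auto simp: S_def Z_def)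
  have iI: "interior {0 :: real..} = {0<..}" by (rule interior_real_atLeast)
  have "continuous_on {0<..} w" by (rule continuous_on_subset[OF cw]) auto
  then have iw: "isCont w r" if "r > 0" for r
    using that by (simp add: continuous_on_eq_continuous_at)
  have main: "(w has_vector_derivative field r (w r)) (at r) \<and> isCont (\<lambda>r. field r (w r)) r"
    if r: "r \<in> {0<..} - S" for r
  proof -
    have rr: "r > 0" "r \<noteq> r0" "r \<noteq> Re" "r \<notin> Z" using r by (auto simp: S_def)
    consider "r < r0" | "r0 < r" "r < Re" | "Re < r" using rr by linarith
    then show ?thesis
    proof cases
      case 1
      then have rI: "r \<in> {0..r0}" "r \<in> {0<..<r0}" using rr by auto
      note R = init_sol_rhs[OF ph mu(2) rI(1)]
      have wr: "w r = (x * U r, x * V r)" using 1 by (simp add: w_def)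
      have sx: "(x * V r)\<^sup>2 - (x * U r)\<^sup>2 = x\<^sup>2 * ((V r)\<^sup>2 - (U r)\<^sup>2)" by (simp add: power_mult_distrib algebra_simps)
      have nz: "(snd (w r))\<^sup>2 - (fst (w r))\<^sup>2 \<noteq> 0" unfolding wr fst_conv snd_conv sx using R(5) x by simp
      have "x\<^sup>2 powr (p - 1) = \<mu>" unfolding mu(1) using x by (simp add: powr_def ln_realpow algebra_simps)
      then have Fx: "F p ((x * V r)\<^sup>2 - (x * U r)\<^sup>2) = p * \<mu> * ((V r)\<^sup>2 - (U r)\<^sup>2) powr (p - 1)"
        unfolding sx using R(5) x by (simp add: F_def powr_mult abs_mult)
      have dU: "(U has_real_derivative f1 \<mu> (U r, V r) - 2 * U r / r) (at r)"
        and dV: "(V has_real_derivative f2 \<mu> (U r, V r)) (at r)"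
        using ph rI unfolding init_sol_def by auto
      have "((\<lambda>r. (x * U r, x * V r)) has_vector_derivative (x * (f1 \<mu> (U r, V r) - 2 * U r / r), x * f2 \<mu> (U r, V r))) (at r)"
        using DERIV_cmult[OF dU, of x] DERIV_cmult[OF dV, of x]
        unfolding has_real_derivative_iff_has_vector_derivative by (intro has_vector_derivative_Pair)
      moreover have "(x * (f1 \<mu> (U r, V r) - 2 * U r / r), x * f2 \<mu> (U r, V r)) = field r (w r)"
        unfolding wr field_def fst_conv snd_conv Fx R(1,2) by (simp add: algebra_simps)
      ultimately have "((\<lambda>r. (x * U r, x * V r)) has_vector_derivative field r (w r)) (at r)" by simp
      then have "(w has_vector_derivative field r (w r)) (at r)"
        by (rule has_vector_derivative_transform_within_open[OF _ open_lessThan[of r0]]) (use 1 in \<open>auto simp: w_def\<close>)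
      then show ?thesis using isCont_field[OF iw nz] rr isCont_field[OF iw[OF rr(1)] _ nz] by simp
    next
      case 2
      then have nzg: "cos (2 * g r) \<noteq> 0" using rr by (auto simp: Z_def)
      obtain L D where LD: "Q r = exp (- L / (2 * (1 - p)))"
        "D = \<Omega> - m * cos (2 * g r) - p * exp L * gam (g r) - sin (2 * g r) / r"
        "(g has_real_derivative D) (at r)" "(Q has_real_derivative - (Q r * Nm (g r) r L / 2)) (at r)"
        using der[OF _ nzg] 2 unfolding greaterThanLessThan_iff by blast
      note P = polar_field[OF LD(1) nzg rr(1) LD(2)]
      have wr: "w r = (Q r * sin (g r), Q r * cos (g r))" using 2 by (simp add: w_def)
      have nz: "(snd (w r))\<^sup>2 - (fst (w r))\<^sup>2 \<noteq> 0" unfolding wr fst_conv snd_conv by (rule P(2))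
      have "((\<lambda>r. Q r * sin (g r)) has_real_derivative - (Q r * Nm (g r) r L / 2) * sin (g r) + Q r * (cos (g r) * D)) (at r)"
        using DERIV_mult[OF LD(4) DERIV_chain2[OF DERIV_sin LD(3)]] by (simp add: mult_ac)
      moreover have "((\<lambda>r. Q r * cos (g r)) has_real_derivative - (Q r * Nm (g r) r L / 2) * cos (g r) + Q r * (- sin (g r) * D)) (at r)"
        using DERIV_mult[OF LD(4) DERIV_chain2[OF DERIV_cos LD(3)]] by (simp add: mult_ac)
      ultimately have "((\<lambda>r. (Q r * sin (g r), Q r * cos (g r))) has_vector_derivative field r (w r)) (at r)"
        unfolding wr P(1) has_real_derivative_iff_has_vector_derivative by (intro has_vector_derivative_Pair)
      then have "(w has_vector_derivative field r (w r)) (at r)"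
        by (rule has_vector_derivative_transform_within_open[OF _ open_greaterThanLessThan[of r0 Re]]) (use 2 in \<open>auto simp: w_def\<close>)
      then show ?thesis using isCont_field[OF iw[OF rr(1)] _ nz] rr by simp
    next
      case 3
      have z: "w s = (0, 0)" if "s > Re" for s using that Re by (simp add: w_def)
      have f0: "field s (0, 0) = (0, 0)" for s by (simp add: field_def)
      have "((\<lambda>_. (0 :: real, 0 :: real)) has_vector_derivative (0, 0)) (at r)"
        using has_vector_derivative_const[of "(0 :: real, 0 :: real)" "at r"] by (simp add: zero_prod_def)
      then have "(w has_vector_derivative field r (w r)) (at r)"
        unfolding z[OF 3] f0
        by (rule has_vector_derivative_transform_within_open[OF _ open_greaterThan[of Re]]) (use 3 z in auto)
      \<comment> \<open>The zero solution lies on the diagonals, so \<open>isCont_field\<close> does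
        not apply; the field is constant along it.\<close>
      moreover have "isCont (\<lambda>r. field r (w r)) r"
      proof -
        have "continuous_on {Re<..} (\<lambda>r. field r (w r))"
          by (rule continuous_on_eq[of _ "\<lambda>_. (0, 0)"]) (auto simp: z f0)
        then show ?thesis using 3 by (simp add: continuous_on_eq_continuous_at)
      qed
      ultimately show ?thesis by blast
    qed
  qed
  have ext: "extended_solution {0..} (dirac_system p m \<Omega>) w"
    unfolding extended_solution_def iI
  proof (intro conjI exI[of _ S])
    show "w C1_differentiable_on ({0<..} - S)"
      unfolding C1_differentiable_on_def
      by (rule exI[of _ "\<lambda>r. field r (w r)"]) (use main in \<open>auto intro!: continuous_at_imp_continuous_on\<close>)
    show "\<forall>r\<in>{0<..} - S. dirac_system p m \<Omega> r (w r) (vector_derivative w (at r))"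
    proof
      fix r assume "r \<in> {0<..} - S"
      then have "vector_derivative w (at r) = field r (w r)" using main by (intro vector_derivative_at) blast
      then show "dirac_system p m \<Omega> r (w r) (vector_derivative w (at r))" by (simp add: dirac_system_field)
    qed
  qed (use cw S in auto)
  have comp: "compactly_supported_on {0..} w"
  proof -
    have "w r = 0" if "r > Re" for r using that Re by (simp add: w_def zero_prod_def)
    then have "{r \<in> {0..}. w r \<noteq> 0} \<subseteq> {0..Re}" by force
    then show ?thesis unfolding compactly_supported_on_def
      by (simp add: bounded_subset[OF bounded_closed_interval])
  qed
  have cross: "crosses_exactly {0..} w {(a, 0) |a. a \<noteq> 0} n"
  proof -
    define C where "C = {r \<in> {0..}. w r \<in> {(a, 0) |a. a \<noteq> 0}}"
    \<comment> \<open>On the first piece V stays near 1, so v cannot vanish; from \<open>Re\<close>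
      on the curve is at the origin, which the crossing set excludes.\<close>
    have C: "C = {r \<in> {r0..<Re}. cos (g r) = 0}"
    proof (intro equalityI subsetI)
      fix r assume "r \<in> C"
      then have r: "r \<ge> 0" "fst (w r) \<noteq> 0" "snd (w r) = 0" by (auto simp: C_def)
      have "\<not> r \<le> r0" using r init_sol_bounds(1)[OF ph mu(2), of r] x by (auto simp: w_def)
      moreover have "r < Re"
      proof (rule ccontr)
        assume "\<not> r < Re"
        then have "w r = (0, 0)" using Re QRe by (cases "r = Re") (auto simp: w_def)
        then show False using r by simp
      qed
      ultimately show "r \<in> {r \<in> {r0..<Re}. cos (g r) = 0}"
        using r Qpos[of r] by (auto simp: w_def)
    next
      fix r assume "r \<in> {r \<in> {r0..<Re}. cos (g r) = 0}"
      then have r: "r0 \<le> r" "r < Re" "cos (g r) = 0" by auto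
      have "r \<noteq> r0" using glue0(2) r V0 x by auto
      then have "w r = (Q r * sin (g r), 0)" using r by (simp add: w_def)
      moreover have "sin (g r) \<noteq> 0" using r(3) sin_cos_squared_add3[of "g r"] by auto
      moreover have "Q r \<noteq> 0" using Qpos[of r] r by simp
      ultimately show "r \<in> C" using r r0_pos by (auto simp: C_def)
    qed
    have gC: "g ` C = {t \<in> {t0..<T}. cos t = 0}"
      unfolding C img[symmetric] by auto
    have "inj_on g C" using inj by (rule inj_on_subset) (auto simp: C)
    moreover have "0 < t0" "t0 < pi / 8" using adm by (auto simp: adm_def)
    note cnt = cos_zeros_count[OF this T]
    ultimately have "finite C" "card C = n"
      using cnt gC by (metis finite_imageD, metis card_image)
    then show ?thesis by (simp add: crosses_exactly_def C_def)
  qed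
  have w0: "w 0 = (0, x)" using ph r0_pos by (simp add: w_def init_sol_def)
  have ww: "(\<lambda>r. (fst (w r), snd (w r))) = w" by simp
  show ?thesis
    by (rule exI[of _ "\<lambda>r. fst (w r)"], rule exI[of _ "\<lambda>r. snd (w r)"])
      (use ext comp cross w0 in \<open>simp add: ww\<close>)
qed

text \<open>Provides the one-parameter family of starts at \<open>r0\<close> that the shooting
  argument needs: continuous in x, without energy at the lower end and of unbounded amplitude at the
  upper end.\<close>

lemma initial_data:
  obtains xs T0 L0 and U V :: "real \<Rightarrow> real \<Rightarrow> real" where "xs > 0"
    "\<And>x. x \<ge> xs \<Longrightarrow> x powr (2 * p - 2) \<in> {0..2 * \<Omega>} \<and> init_sol (x powr (2 * p - 2)) (U x) (V x) \<and>
       T0 x = arctan (U x r0 / V x r0) \<and> L0 x = (p - 1) * ln (x\<^sup>2 * ((U x r0)\<^sup>2 + (V x r0)\<^sup>2)) \<and> adm (T0 x)"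
    "continuous_on {xs..} T0" "continuous_on {xs..} L0" "bb (T0 xs) (L0 xs) \<le> 0"
    "\<And>L. \<exists>X. \<forall>x\<ge>X. x \<ge> xs \<longrightarrow> L0 x \<le> L"
proof -
  \<comment> \<open>The amplitude for which \<mu> equals \<open>2 * \<Omega>\<close>. At the almost
    vertical state (0, 1) the singular part of the scaled energy is then about twice the linear
    part.\<close>
  define xs where "xs = (2 * \<Omega>) powr (1 / (2 * p - 2))"
  have xs0: "xs > 0" using Om_pos by (simp add: xs_def)
  define mu where "mu x = x powr (2 * p - 2)" for x :: real
  have mu_xs: "mu xs = 2 * \<Omega>" unfolding mu_def xs_def powr_powr using Om_pos p_small by simp
  have mu: "mu x \<in> {0..2 * \<Omega>}" if "x \<ge> xs" for x
  proof -
    have "mu x \<le> mu xs" unfolding mu_def using that xs0 p_small by (intro powr_mono2') auto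
    then show ?thesis by (simp add: mu_xs) (simp add: mu_def)
  qed
  have "\<exists>UV. init_sol (mu x) (fst UV) (snd UV)" if "x \<ge> xs" for x
    using init_sol_exists[OF mu[OF that]] by (metis fst_conv snd_conv)
  then obtain UV where UV: "\<And>x. x \<ge> xs \<Longrightarrow> init_sol (mu x) (fst (UV x)) (snd (UV x))" by metis
  define U where "U x = fst (UV x)" for x
  define V where "V x = snd (UV x)" for x
  have ph: "init_sol (mu x) (U x) (V x)" if "x \<ge> xs" for x using UV[OF that] by (simp add: U_def V_def)
  define T0 where "T0 x = arctan (U x r0 / V x r0)" for x
  define L0 where "L0 x = (p - 1) * ln (x\<^sup>2 * ((U x r0)\<^sup>2 + (V x r0)\<^sup>2))" for x
  have r0m: "r0 \<in> {0..r0}" using r0_pos by simp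
  have Omr0: "\<Omega> * r0 = 1 / 100" using Om_pos by (simp add: r0_def)
  have bnd: "99 / 100 \<le> V x r0" "V x r0 \<le> 101 / 100" "0 < U x r0" "U x r0 \<le> 101 / 30000"
    "U x r0 \<le> 101 / 300 * \<Omega> * r0" if "x \<ge> xs" for x
    using init_sol_bounds[OF ph[OF that] mu[OF that] r0m] Omr0 by auto
  have cmu: "continuous_on {xs..} mu" unfolding mu_def by (intro continuous_intros) (use xs0 in auto)
  define C where "C = exp (6 * (5 * \<Omega> + 2) * r0)"
  have C: "C > 0" by (simp add: C_def)
  \<comment> \<open>Quantities at \<open>r0\<close> are Lipschitz in \<mu>, and \<mu> is continuous
    in x.\<close>
  have cont: "continuous_on {xs..} f" if f: "\<And>x y. x \<ge> xs \<Longrightarrow> y \<ge> xs \<Longrightarrow> \<bar>f x - f y\<bar> \<le> \<bar>mu x - mu y\<bar> * C" for f :: "real \<Rightarrow> real"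
    unfolding continuous_on_iff
  proof (intro ballI allI impI)
    fix x and e :: real assume x: "x \<in> {xs..}" and "e > 0"
    then have "e / C > 0" using C by simp
    then obtain d where d: "d > 0" "\<And>y. y \<in> {xs..} \<Longrightarrow> dist y x < d \<Longrightarrow> dist (mu y) (mu x) < e / C"
      using cmu x unfolding continuous_on_iff by blast
    have "dist (f y) (f x) < e" if y: "y \<in> {xs..}" "dist y x < d" for y
    proof -
      have "\<bar>f y - f x\<bar> \<le> \<bar>mu y - mu x\<bar> * C" using f[of y x] y x by simp
      also have "\<dots> < e / C * C" using d(2)[OF y] C by (intro mult_strict_right_mono) (auto simp: dist_real_def)
      finally show ?thesis using C by (simp add: dist_real_def)
    qed
    then show "\<exists>d>0. \<forall>y\<in>{xs..}. dist y x < d \<longrightarrow> dist (f y) (f x) < e" using d(1) by blast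
  qed
  have cU: "continuous_on {xs..} (\<lambda>x. U x r0)" and cV: "continuous_on {xs..} (\<lambda>x. V x r0)"
    unfolding C_def[symmetric]
    by (rule cont; use init_sol_dependence[OF ph ph mu mu] in \<open>simp add: C_def\<close>)+
  have sumpos: "x\<^sup>2 * ((U x r0)\<^sup>2 + (V x r0)\<^sup>2) > 0" if "x \<ge> xs" for x
    using bnd(1,3)[OF that] that xs0 by (intro mult_pos_pos add_pos_pos) auto
  have cT: "continuous_on {xs..} T0"
    unfolding T0_def by (intro continuous_intros cU cV) (use bnd(1) in force)
  have cL: "continuous_on {xs..} L0"
    unfolding L0_def by (intro continuous_intros cU cV) (use sumpos in force)
  have quot: "0 < U x r0 / V x r0" "U x r0 / V x r0 \<le> 103 / 300 * \<Omega> * r0" if "x \<ge> xs" for x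
  proof -
    have V: "V x r0 > 0" using bnd(1)[OF that] by simp
    show "0 < U x r0 / V x r0" using V bnd(3)[OF that] by simp
    have "U x r0 / V x r0 \<le> (101 / 300 * \<Omega> * r0) / (101 / 103)"
      using bnd[OF that] by (intro frac_le) auto
    then show "U x r0 / V x r0 \<le> 103 / 300 * \<Omega> * r0" by simp
  qed
  have T0pos: "0 < T0 x" "T0 x \<le> 35 / 10000" "T0 x \<le> 103 / 300 * \<Omega> * r0" if "x \<ge> xs" for x
  proof -
    show "0 < T0 x" using quot(1)[OF that] by (simp add: T0_def)
    have "T0 x \<le> U x r0 / V x r0" unfolding T0_def using quot(1)[OF that] by (intro arctan_le_self) auto
    then show *: "T0 x \<le> 103 / 300 * \<Omega> * r0" using quot(2)[OF that] by linarith
    then show "T0 x \<le> 35 / 10000" using Omr0 by simp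
  qed
  have adm: "adm (T0 x)" if "x \<ge> xs" for x
  proof -
    \<comment> \<open>U is about \<open>\<Omega> * r0 / 3\<close> at \<open>r0\<close>, so the left
      side of the admissibility condition is about 8/9 of \<open>r0\<close>.\<close>
    have "sin (2 * T0 x) \<le> 2 * T0 x" using T0pos[OF that] by (intro sin_x_le_x) auto
    then have "sin (2 * T0 x) \<le> 206 / 300 * \<Omega> * r0" using T0pos(3)[OF that] by linarith
    then have "4 / (3 * \<Omega>) * sin (2 * T0 x) \<le> 4 / (3 * \<Omega>) * (206 / 300 * \<Omega> * r0)"
      using Om_pos by (intro mult_left_mono) auto
    also have "\<dots> < r0" using Om_pos r0_pos by simp
    finally show ?thesis using T0pos[OF that] pi_ge_two by (simp add: adm_def)
  qed
  \<comment> \<open>The small deviations of V and of the angle at \<open>r0\<close> cost the factors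
    10/11 and 9/10, and 2 * 10/11 * 9/10 still exceeds 1.\<close>
  have start: "bb (T0 xs) (L0 xs) \<le> 0"
  proof -
    have le: "xs \<le> xs" by simp
    define s where "s = (U xs r0)\<^sup>2 + (V xs r0)\<^sup>2"
    have s: "s > 0" "s \<le> 11 / 10"
    proof -
      show "s > 0" using bnd(1,3)[OF le] by (auto simp: s_def intro!: add_pos_pos)
      have "(U xs r0)\<^sup>2 \<le> (1 / 100)\<^sup>2" "(V xs r0)\<^sup>2 \<le> (101 / 100)\<^sup>2"
        using bnd[OF le] by (intro power_mono; simp)+
      then show "s \<le> 11 / 10" by (simp add: s_def power2_eq_square)
    qed
    have "exp (L0 xs) = (xs\<^sup>2 * s) powr (p - 1)"
      unfolding L0_def s_def[symmetric] using s xs0 by (simp add: powr_def)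
    also have "\<dots> = (xs\<^sup>2) powr (p - 1) * s powr (p - 1)" using s xs0 by (simp add: powr_mult)
    also have "(xs\<^sup>2) powr (p - 1) = mu xs"
      unfolding mu_def using xs0 by (simp add: powr_def ln_realpow algebra_simps)
    finally have eL: "exp (L0 xs) = 2 * \<Omega> * s powr (p - 1)" by (simp add: mu_xs)
    have "(11 / 10) powr (- 1) \<le> (11 / 10) powr (p - 1)" using p_pos by (intro powr_mono) auto
    also have "\<dots> \<le> s powr (p - 1)" using s p_small by (intro powr_mono2') auto
    finally have sp: "10 / 11 \<le> s powr (p - 1)" by (simp add: powr_minus)
    define c where "c = cos (2 * T0 xs)"
    have T: "0 < T0 xs" "T0 xs \<le> 35 / 10000" using T0pos[OF le] by auto
    have "sin (T0 xs) \<le> 35 / 10000" "0 \<le> sin (T0 xs)"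
      using sin_x_le_x[of "T0 xs"] T pi_ge_two by (auto intro!: sin_ge_zero)
    then have "(sin (T0 xs))\<^sup>2 \<le> (35 / 10000)\<^sup>2" by (intro power_mono) auto
    then have c: "9 / 10 \<le> c" "c \<le> 1" by (auto simp: c_def cos_double_sin power2_eq_square)
    have "c powr 1 \<le> c powr p" using c p_small by (intro powr_mono') auto
    then have g: "9 / 10 \<le> gam (T0 xs)" using c by (simp add: gam_def c_def[symmetric] spow_pos)
    have "(2 * \<Omega> * (10 / 11)) * (9 / 10) \<le> exp (L0 xs) * gam (T0 xs)"
      unfolding eL using sp g Om_pos by (intro mult_mono) auto
    moreover have "0 \<le> m * c" using m_pos c by simp
    ultimately show ?thesis unfolding bb_def c_def[symmetric] using Om_pos by simp
  qed
  \<comment> \<open>V stays near 1, so the squared amplitude at \<open>r0\<close> is at least x^2 /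
    2, and the negative factor \<open>p - 1\<close> sends \<open>L0\<close> to minus
    infinity.\<close>
  have infty: "\<exists>X. \<forall>x\<ge>X. x \<ge> xs \<longrightarrow> L0 x \<le> L" for L
  proof -
    define X where "X = exp (\<bar>L\<bar> + 1)"
    have "L0 x \<le> L" if x: "x \<ge> X" "x \<ge> xs" for x
    proof -
      have xp: "x > 0" using x xs0 by linarith
      have "1 / 2 \<le> (99 / 100 :: real)\<^sup>2" by (simp add: power2_eq_square)
      also have "\<dots> \<le> (V x r0)\<^sup>2" using bnd(1)[OF x(2)] by (intro power_mono) auto
      also have "\<dots> \<le> (U x r0)\<^sup>2 + (V x r0)\<^sup>2" by simp
      finally have "x\<^sup>2 * (1 / 2) \<le> x\<^sup>2 * ((U x r0)\<^sup>2 + (V x r0)\<^sup>2)" by (intro mult_left_mono) auto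
      then have "ln (x\<^sup>2 * (1 / 2)) \<le> ln (x\<^sup>2 * ((U x r0)\<^sup>2 + (V x r0)\<^sup>2))" using xp by (intro ln_mono) auto
      moreover have "ln (x\<^sup>2 * (1 / 2)) = 2 * ln x - ln 2" using xp by (simp add: ln_div ln_realpow)
      moreover have "\<bar>L\<bar> + 1 \<le> ln x" using x(1) xp by (simp add: X_def ln_ge_iff)
      moreover have "ln 2 \<le> (1 :: real)" using ln_2_less_1 by simp
      ultimately have big: "2 * \<bar>L\<bar> + 1 \<le> ln (x\<^sup>2 * ((U x r0)\<^sup>2 + (V x r0)\<^sup>2))" by linarith
      have "(1 - p) * (2 * \<bar>L\<bar> + 1) \<le> (1 - p) * ln (x\<^sup>2 * ((U x r0)\<^sup>2 + (V x r0)\<^sup>2))"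
        using big p_small by (intro mult_left_mono) auto
      moreover have "1 / 2 * (2 * \<bar>L\<bar> + 1) \<le> (1 - p) * (2 * \<bar>L\<bar> + 1)" using p_small by (intro mult_right_mono) auto
      ultimately have "\<bar>L\<bar> \<le> - L0 x" by (simp add: L0_def algebra_simps)
      then show ?thesis by linarith
    qed
    then show ?thesis by blast
  qed
  show thesis
  proof (rule that[of xs U V T0 L0])
    show "x powr (2 * p - 2) \<in> {0..2 * \<Omega>} \<and> init_sol (x powr (2 * p - 2)) (U x) (V x) \<and>
       T0 x = arctan (U x r0 / V x r0) \<and> L0 x = (p - 1) * ln (x\<^sup>2 * ((U x r0)\<^sup>2 + (V x r0)\<^sup>2)) \<and> adm (T0 x)"
      if "x \<ge> xs" for x
      using mu[OF that] ph[OF that] adm[OF that] by (simp add: mu_def T0_def L0_def)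
  qed (use xs0 cT cL start infty in auto)
qed

lemma compact_solutions:
  "\<exists>x :: nat \<Rightarrow> real. strict_mono x \<and> \<not> bdd_above (range x) \<and> (\<forall>k. x k \<ge> 0) \<and>
    (\<forall>k. \<exists>u v :: real \<Rightarrow> real.
      extended_solution {0..} (dirac_system p m \<Omega>) (\<lambda>r. (u r, v r)) \<and>
      (u 0, v 0) = (0, x k) \<and>
      compactly_supported_on {0..} (\<lambda>r. (u r, v r)) \<and>
      crosses_exactly {0..} (\<lambda>r. (u r, v r)) {(a, 0) |a. a \<noteq> 0} k)"
proof -
  obtain xs T0 L0 and U V :: "real \<Rightarrow> real \<Rightarrow> real" where xs: "xs > 0"
    and dat: "\<And>x. x \<ge> xs \<Longrightarrow> x powr (2 * p - 2) \<in> {0..2 * \<Omega>} \<and> init_sol (x powr (2 * p - 2)) (U x) (V x) \<and>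
       T0 x = arctan (U x r0 / V x r0) \<and> L0 x = (p - 1) * ln (x\<^sup>2 * ((U x r0)\<^sup>2 + (V x r0)\<^sup>2)) \<and> adm (T0 x)"
    and cont: "continuous_on {xs..} T0" "continuous_on {xs..} L0" and start: "bb (T0 xs) (L0 xs) \<le> 0"
    and infty: "\<And>L. \<exists>X. \<forall>x\<ge>X. x \<ge> xs \<longrightarrow> L0 x \<le> L"
    by (rule initial_data) (rule that; assumption)
  have adm: "adm (T0 x)" if "x \<ge> xs" for x using dat[OF that] by blast
  obtain X :: "nat \<Rightarrow> real" where X: "strict_mono X" "\<not> bdd_above (range X)" "\<And>n. X n \<ge> xs"
    and live: "\<And>n T. T0 (X n) \<le> T \<Longrightarrow> T < real n * pi + pi / 4 \<Longrightarrow> alive (T0 (X n)) (L0 (X n)) T"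
    and dead: "\<And>n. \<not> alive (T0 (X n)) (L0 (X n)) (real n * pi + pi / 4)"
    using shooting[OF adm cont start infty] by blast
  have "\<exists>u v. extended_solution {0..} (dirac_system p m \<Omega>) (\<lambda>r. (u r, v r)) \<and> (u 0, v 0) = (0, X n) \<and>
    compactly_supported_on {0..} (\<lambda>r. (u r, v r)) \<and>
    crosses_exactly {0..} (\<lambda>r. (u r, v r)) {(a, 0) |a. a \<noteq> 0} n" for n
    using dat[OF X(3)[of n]] X(3)[of n] xs live[of n] dead[of n]
    by (intro compact_solution[OF _ refl, where U = "U (X n)" and V = "V (X n)" and T = "real n * pi + pi / 4"]) auto
  moreover have "X n \<ge> 0" for n using X(3)[of n] xs by linarith
  ultimately show ?thesis using X(1,2) by (intro exI[of _ X] conjI allI) assumption+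
qed

end

theorem theorem1p2:
  fixes m :: real
  assumes "m > 0"
  shows "\<exists>pbar :: real. 0 < pbar \<and> pbar < 1 \<and>
    (\<forall>p :: real. 0 < p \<and> p < pbar \<longrightarrow>
      (\<exists>\<Omega>\<^sub>p :: real. \<Omega>\<^sub>p > m \<and>
        (\<forall>\<Omega> :: real. \<Omega> > \<Omega>\<^sub>p \<longrightarrow>
          (\<exists>x :: nat \<Rightarrow> real.
            strict_mono x \<and> \<not> bdd_above (range x) \<and> (\<forall>k. x k \<ge> 0) \<and>
            (\<forall>k. \<exists>u v :: real \<Rightarrow> real.
              extended_solution {0..} (dirac_system p m \<Omega>) (\<lambda>r. (u r, v r)) \<and>
              (u 0, v 0) = (0, x k) \<and>
              compactly_supported_on {0..} (\<lambda>r. (u r, v r)) \<and>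
              crosses_exactly {0..} (\<lambda>r. (u r, v r)) {(a, 0) |a. a \<noteq> 0} k)))))"
\<comment> \<open>Both thresholds are those of the locale; the one for \<Omega> is the same for all
  p.\<close>
proof (rule exI[of _ "1 / 20 :: real"], intro conjI allI impI)
  fix p :: real assume p: "0 < p \<and> p < 1 / 20"
  show "\<exists>\<Omega>\<^sub>p :: real. \<Omega>\<^sub>p > m \<and>
        (\<forall>\<Omega> :: real. \<Omega> > \<Omega>\<^sub>p \<longrightarrow>
          (\<exists>x :: nat \<Rightarrow> real.
            strict_mono x \<and> \<not> bdd_above (range x) \<and> (\<forall>k. x k \<ge> 0) \<and>
            (\<forall>k. \<exists>u v :: real \<Rightarrow> real.
              extended_solution {0..} (dirac_system p m \<Omega>) (\<lambda>r. (u r, v r)) \<and>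
              (u 0, v 0) = (0, x k) \<and>
              compactly_supported_on {0..} (\<lambda>r. (u r, v r)) \<and>
              crosses_exactly {0..} (\<lambda>r. (u r, v r)) {(a, 0) |a. a \<noteq> 0} k)))"
  proof (rule exI[of _ "20 * m"], intro conjI allI impI)
    show "m < 20 * m" using assms by simp
    fix \<Omega> assume "20 * m < \<Omega>"
    then interpret dirac m p \<Omega> using assms p by unfold_locales auto
    show "\<exists>x :: nat \<Rightarrow> real.
            strict_mono x \<and> \<not> bdd_above (range x) \<and> (\<forall>k. x k \<ge> 0) \<and>
            (\<forall>k. \<exists>u v :: real \<Rightarrow> real.
              extended_solution {0..} (dirac_system p m \<Omega>) (\<lambda>r. (u r, v r)) \<and>
              (u 0, v 0) = (0, x k) \<and>
              compactly_supported_on {0..} (\<lambda>r. (u r, v r)) \<and>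
              crosses_exactly {0..} (\<lambda>r. (u r, v r)) {(a, 0) |a. a \<noteq> 0} k)"
      by (rule compact_solutions)
  qed
qed auto

end
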